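(* Let $M$ be a smooth manifold and $L$ a twisted Dirac structure on $M$, with twist a closed 3-form $H\in\Omega^3(M)$. For any closed, embedded submanifold $N\subseteq M$ which is a transversal for $L$, $L$ lifts to the real projective blowup $\mathrm{Blup}(M,N)$, and the blowdown map $p:\mathrm{Blup}(M,N)\to M$ is a backward Dirac map (with respect to the lifted Dirac structure and $L$).
   Context: Blowup. For a closed embedded submanifold $N\subseteq M$ with normal bundle $\nu_N(M)=TM|_N/TN$, the real projective blowup is, as a set, $\mathrm{Blup}(M,N)=(M\setminus N)\sqcup\mathbb{P}(\nu_N(M))$, where $\mathbb{P}(\nu_N(M))$ is the projectivised normal bundle. The blowdown map $p:\mathrm{Blup}(M,N)\to M$ is the identity on $M\setminus N$ and the bundle projection on $\mathbb{P}(\nu_N(M))\to N$. The smooth structure is determined by charts: for a submanifold chart $(U,(x,y))$ with $U\cap N=\{x=0\}$ and $1\le i\le \operatorname{codim}N$, the set $U_i=p^{-1}(\{x_i\neq0\})\cup\{[v]\in\mathbb{P}(\nu_N(M))|_{U\cap N}:dx_i(v)\neq0\}$ has coordinates $(\tilde x,y)$ in which $p(\tilde x,y)=(x,y)$ with $x_i=\tilde x_i$ and $x_j=\tilde x_i\tilde x_j$ for $j\ne i$; thus $\mathbb{P}(\nu_N(M))\cap U_i=\{\tilde x_i=0\}$. Dirac structures. $\mathbb{T}M=TM\oplus T^*M$ carries the pairing $\langle(v,\xi),(w,\eta)\rangle=\frac12(\xi(w)+\eta(v))$ and, for a closed 3-form $H$, the bracket $[(X,\alpha),(Y,\beta)]=([X,Y],\mathcal{L}_X\beta-i_Yd\alpha+i_Yi_XH)$.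 An $H$-twisted Dirac structure is a smooth subbundle $L\subseteq\mathbb{T}M$ which is maximally isotropic and whose sections are closed under this bracket. A smooth map $f:(B,L_B)\to(M,L_M)$ (with twists $H_B=f^*H_M$) is backward Dirac if $(L_B)_b=\{(w,(T_bf)^*\xi):(T_bf(w),\xi)\in(L_M)_{f(b)}\}$ for all $b\in B$. Lifting. $L$ lifts to $\mathrm{Blup}(M,N)$ if there is a ($p^*H$-twisted) Dirac structure $\tilde L$ on $\mathrm{Blup}(M,N)$ whose restriction to $\mathrm{Blup}(M,N)\setminus\mathbb{P}(\nu_N(M))$ equals $p^*(L|_{M\setminus N})$, i.e. the transport of $L|_{M\setminus N}$ by the diffeomorphism $p$. Such an $\tilde L$ is unique. $N$ is a transversal for $L$ if $T_qN+\mathrm{pr}_{TM}(L_q)=T_qM$ for all $q\in N$. *)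

theory Defs
  imports "HOL-Analysis.Analysis"
begin

section \<open>Smooth maps between open subsets of normed spaces\<close>

primrec Ck_on :: "nat \<Rightarrow> 'a::real_normed_vector set \<Rightarrow> ('a \<Rightarrow> 'b::real_normed_vector) \<Rightarrow> bool" where
  "Ck_on 0 S f \<longleftrightarrow> continuous_on S f"
| "Ck_on (Suc k) S f \<longleftrightarrow>
     (\<forall>x\<in>S. f differentiable (at x)) \<and> (\<forall>v. Ck_on k S (\<lambda>x. frechet_derivative f (at x) v))"

text \<open>Only used for open \<open>S\<close>; the values of \<open>f\<close> outside \<open>S\<close> are then irrelevant.\<close>

definition smooth_on :: "'a::real_normed_vector set \<Rightarrow> ('a \<Rightarrow> 'b::real_normed_vector) \<Rightarrow> bool" where
  "smooth_on S f \<longleftrightarrow> (\<forall>k. Ck_on k S f)"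


section \<open>Smooth manifolds\<close>

text \<open>
  A smooth manifold is represented by its maximal smooth atlas; its underlying set is the union of
  the chart domains and its topology is the one induced by the charts. A chart is a domain together
  with a coordinate map, whose values outside the domain are irrelevant.
\<close>

type_synonym ('a, 'n) chart = "'a set \<times> ('a \<Rightarrow> real ^ 'n)"

definition is_chart :: "('a, 'n::finite) chart \<Rightarrow> bool" where
  "is_chart c \<longleftrightarrow> inj_on (snd c) (fst c) \<and> open (snd c ` fst c)"

definition chart_inv :: "('a, 'n::finite) chart \<Rightarrow> real ^ 'n \<Rightarrow> 'a" where
  "chart_inv c = inv_into (fst c) (snd c)"

definition compatible :: "('a, 'n::finite) chart \<Rightarrow> ('a, 'n) chart \<Rightarrow> bool" where
  "compatible c d \<longleftrightarrow>
     open (snd c ` (fst c \<inter> fst d)) \<and> open (snd d ` (fst c \<inter> fst d)) \<and>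
     smooth_on (snd c ` (fst c \<inter> fst d)) (snd d \<circ> chart_inv c) \<and>
     smooth_on (snd d ` (fst c \<inter> fst d)) (snd c \<circ> chart_inv d)"

definition smooth_atlas :: "('a, 'n::finite) chart set \<Rightarrow> bool" where
  "smooth_atlas A \<longleftrightarrow> (\<forall>c\<in>A. is_chart c) \<and> (\<forall>c\<in>A. \<forall>d\<in>A. compatible c d)"

definition points :: "('a, 'n::finite) chart set \<Rightarrow> 'a set" where
  "points A = (\<Union>c\<in>A. fst c)"

definition max_atlas :: "('a, 'n::finite) chart set \<Rightarrow> ('a, 'n) chart set" where
  "max_atlas A = {c. is_chart c \<and> fst c \<subseteq> points A \<and> (\<forall>d\<in>A. compatible c d)}"

definition mtop :: "('a, 'n::finite) chart set \<Rightarrow> 'a topology" where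
  "mtop A = topology (\<lambda>V. V \<subseteq> points A \<and> (\<forall>c\<in>A. open (snd c ` (fst c \<inter> V))))"

definition smooth_manifold :: "('a, 'n::finite) chart set \<Rightarrow> bool" where
  "smooth_manifold M \<longleftrightarrow>
     smooth_atlas M \<and> max_atlas M = M \<and> Hausdorff_space (mtop M) \<and> second_countable (mtop M)"

definition charts_at :: "('a, 'n::finite) chart set \<Rightarrow> 'a \<Rightarrow> ('a, 'n) chart set" where
  "charts_at M p = {c \<in> M. p \<in> fst c}"

definition chart_at :: "('a, 'n::finite) chart set \<Rightarrow> 'a \<Rightarrow> ('a, 'n) chart" where
  "chart_at M p = (SOME c. c \<in> charts_at M p)"

definition smooth_map ::
  "('b, 'm::finite) chart set \<Rightarrow> ('a, 'n::finite) chart set \<Rightarrow> ('b \<Rightarrow> 'a) \<Rightarrow> bool" where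
  "smooth_map B M f \<longleftrightarrow>
     f ` points B \<subseteq> points M \<and>
     (\<forall>b\<in>points B. \<exists>c\<in>charts_at B b. \<exists>d\<in>charts_at M (f b).
        f ` fst c \<subseteq> fst d \<and> smooth_on (snd c ` fst c) (snd d \<circ> f \<circ> chart_inv c))"


section \<open>Tangent and cotangent vectors\<close>

text \<open>
  A tangent vector at \<open>p\<close> is the family of its coordinate vectors in all charts around \<open>p\<close>, related
  by the derivatives of the transition maps (and \<open>0\<close> for the charts not containing \<open>p\<close>). A covector
  is a linear functional on the tangent space, extended by \<open>0\<close>.
\<close>

type_synonym ('a, 'n) tvec = "('a, 'n) chart \<Rightarrow> real ^ 'n"
type_synonym ('a, 'n) covec = "('a, 'n) tvec \<Rightarrow> real"

definition tangent_space :: "('a, 'n::finite) chart set \<Rightarrow> 'a \<Rightarrow> ('a, 'n) tvec set" where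
  "tangent_space M p =
     {v. (\<forall>c\<in>charts_at M p. \<forall>d\<in>charts_at M p.
            v d = frechet_derivative (snd d \<circ> chart_inv c) (at (snd c p)) (v c)) \<and>
         (\<forall>c. c \<notin> charts_at M p \<longrightarrow> v c = 0)}"

definition tadd :: "('a, 'n::finite) tvec \<Rightarrow> ('a, 'n) tvec \<Rightarrow> ('a, 'n) tvec" where
  "tadd v w = (\<lambda>c. v c + w c)"

definition tscale :: "real \<Rightarrow> ('a, 'n::finite) tvec \<Rightarrow> ('a, 'n) tvec" where
  "tscale r v = (\<lambda>c. r *\<^sub>R v c)"

text \<open>The tangent vector at \<open>p\<close> with coordinate vector \<open>u\<close> in the chart \<open>c\<close>. For fixed \<open>c\<close> and \<open>u\<close>
  and varying \<open>p\<close> this is a vector field with constant coefficients in the chart \<open>c\<close>.\<close>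

definition tvec_of :: "('a, 'n::finite) chart set \<Rightarrow> ('a, 'n) chart \<Rightarrow> 'a \<Rightarrow> real ^ 'n \<Rightarrow> ('a, 'n) tvec" where
  "tvec_of M c p u = (\<lambda>d. if d \<in> charts_at M p
     then frechet_derivative (snd d \<circ> chart_inv c) (at (snd c p)) u else 0)"

definition tlinear :: "('a, 'n::finite) chart set \<Rightarrow> 'a \<Rightarrow> (('a, 'n) tvec \<Rightarrow> real) \<Rightarrow> bool" where
  "tlinear M p \<xi> \<longleftrightarrow>
     (\<forall>v\<in>tangent_space M p. \<forall>w\<in>tangent_space M p. \<xi> (tadd v w) = \<xi> v + \<xi> w) \<and>
     (\<forall>r. \<forall>v\<in>tangent_space M p. \<xi> (tscale r v) = r * \<xi> v)"

definition cotangent_space :: "('a, 'n::finite) chart set \<Rightarrow> 'a \<Rightarrow> ('a, 'n) covec set" where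
  "cotangent_space M p = {\<xi>. tlinear M p \<xi> \<and> (\<forall>v. v \<notin> tangent_space M p \<longrightarrow> \<xi> v = 0)}"

definition tangent_map ::
  "('b, 'm::finite) chart set \<Rightarrow> ('a, 'n::finite) chart set \<Rightarrow> ('b \<Rightarrow> 'a) \<Rightarrow> 'b \<Rightarrow>
     ('b, 'm) tvec \<Rightarrow> ('a, 'n) tvec" where
  "tangent_map B M f b w = (\<lambda>d. if d \<in> charts_at M (f b)
     then frechet_derivative (snd d \<circ> f \<circ> chart_inv (chart_at B b)) (at (snd (chart_at B b) b))
            (w (chart_at B b))
     else 0)"

definition covec_pullback ::
  "('b, 'm::finite) chart set \<Rightarrow> ('a, 'n::finite) chart set \<Rightarrow> ('b \<Rightarrow> 'a) \<Rightarrow> 'b \<Rightarrow>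
     ('a, 'n) covec \<Rightarrow> ('b, 'm) covec" where
  "covec_pullback B M f b \<xi> =
     (\<lambda>w. if w \<in> tangent_space B b then \<xi> (tangent_map B M f b w) else 0)"


section \<open>Vector fields and differential forms\<close>

text \<open>The differential \<open>(df)\<^sub>p(v)\<close> of a real-valued function defined near \<open>p\<close>.\<close>

definition differential :: "('a, 'n::finite) chart set \<Rightarrow> ('a \<Rightarrow> real) \<Rightarrow> 'a \<Rightarrow> ('a, 'n) tvec \<Rightarrow> real" where
  "differential M f p v =
     frechet_derivative (f \<circ> chart_inv (chart_at M p)) (at (snd (chart_at M p) p)) (v (chart_at M p))"

definition lie_bracket ::
  "('a, 'n::finite) chart set \<Rightarrow> ('a \<Rightarrow> ('a, 'n) tvec) \<Rightarrow> ('a \<Rightarrow> ('a, 'n) tvec) \<Rightarrow> 'a \<Rightarrow> ('a, 'n) tvec" where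
  "lie_bracket M X Y p = (\<lambda>c. if c \<in> charts_at M p
     then frechet_derivative (\<lambda>x. Y (chart_inv c x) c) (at (snd c p)) (X p c)
        - frechet_derivative (\<lambda>x. X (chart_inv c x) c) (at (snd c p)) (Y p c)
     else 0)"

text \<open>Exterior derivatives are computed by the invariant formula, extending the tangent vectors to
  (commuting) vector fields with constant coefficients in a chart.\<close>

definition const_ext :: "('a, 'n::finite) chart set \<Rightarrow> 'a \<Rightarrow> ('a, 'n) tvec \<Rightarrow> 'a \<Rightarrow> ('a, 'n) tvec" where
  "const_ext M p u q = tvec_of M (chart_at M p) q (u (chart_at M p))"

definition ext_deriv1 ::
  "('a, 'n::finite) chart set \<Rightarrow> ('a \<Rightarrow> ('a, 'n) covec) \<Rightarrow> 'a \<Rightarrow> ('a, 'n) tvec \<Rightarrow> ('a, 'n) tvec \<Rightarrow> real" where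
  "ext_deriv1 M \<alpha> p u v =
     differential M (\<lambda>q. \<alpha> q (const_ext M p v q)) p u
   - differential M (\<lambda>q. \<alpha> q (const_ext M p u q)) p v"

text \<open>Cartan's formula \<open>\<L>\<^sub>X \<beta> = d(i\<^sub>X \<beta>) + i\<^sub>X d\<beta>\<close>.\<close>

definition lie_deriv1 ::
  "('a, 'n::finite) chart set \<Rightarrow> ('a \<Rightarrow> ('a, 'n) tvec) \<Rightarrow> ('a \<Rightarrow> ('a, 'n) covec) \<Rightarrow> 'a \<Rightarrow>
     ('a, 'n) tvec \<Rightarrow> real" where
  "lie_deriv1 M X \<beta> p v = differential M (\<lambda>q. \<beta> q (X q)) p v + ext_deriv1 M \<beta> p (X p) v"

text \<open>Forms of degree 3 are only ever evaluated on tangent vectors; their other values are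
  irrelevant.\<close>

type_synonym ('a, 'n) form3 = "'a \<Rightarrow> ('a, 'n) tvec \<Rightarrow> ('a, 'n) tvec \<Rightarrow> ('a, 'n) tvec \<Rightarrow> real"

definition smooth_form3 :: "('a, 'n::finite) chart set \<Rightarrow> ('a, 'n) form3 \<Rightarrow> bool" where
  "smooth_form3 M H \<longleftrightarrow>
     (\<forall>p\<in>points M. \<forall>u\<in>tangent_space M p. \<forall>v\<in>tangent_space M p.
        tlinear M p (H p u v) \<and> tlinear M p (\<lambda>w. H p u w v) \<and> tlinear M p (\<lambda>w. H p w u v) \<and>
        H p u u v = 0 \<and> H p u v u = 0 \<and> H p v u u = 0) \<and>
     (\<forall>c\<in>M. \<forall>u v w. smooth_on (snd c ` fst c)
        (\<lambda>x. let q = chart_inv c x in H q (tvec_of M c q u) (tvec_of M c q v) (tvec_of M c q w)))"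

definition ext_deriv3 ::
  "('a, 'n::finite) chart set \<Rightarrow> ('a, 'n) form3 \<Rightarrow> 'a \<Rightarrow>
     ('a, 'n) tvec \<Rightarrow> ('a, 'n) tvec \<Rightarrow> ('a, 'n) tvec \<Rightarrow> ('a, 'n) tvec \<Rightarrow> real" where
  "ext_deriv3 M H p u0 u1 u2 u3 =
     (let E = const_ext M p in
       differential M (\<lambda>q. H q (E u1 q) (E u2 q) (E u3 q)) p u0
     - differential M (\<lambda>q. H q (E u0 q) (E u2 q) (E u3 q)) p u1
     + differential M (\<lambda>q. H q (E u0 q) (E u1 q) (E u3 q)) p u2
     - differential M (\<lambda>q. H q (E u0 q) (E u1 q) (E u2 q)) p u3)"

definition closed_form3 :: "('a, 'n::finite) chart set \<Rightarrow> ('a, 'n) form3 \<Rightarrow> bool" where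
  "closed_form3 M H \<longleftrightarrow> smooth_form3 M H \<and>
     (\<forall>p\<in>points M. \<forall>u0\<in>tangent_space M p. \<forall>u1\<in>tangent_space M p.
        \<forall>u2\<in>tangent_space M p. \<forall>u3\<in>tangent_space M p. ext_deriv3 M H p u0 u1 u2 u3 = 0)"

definition form3_pullback ::
  "('b, 'm::finite) chart set \<Rightarrow> ('a, 'n::finite) chart set \<Rightarrow> ('b \<Rightarrow> 'a) \<Rightarrow>
     ('a, 'n) form3 \<Rightarrow> ('b, 'm) form3" where
  "form3_pullback B M f H b u v w =
     H (f b) (tangent_map B M f b u) (tangent_map B M f b v) (tangent_map B M f b w)"


section \<open>Dirac structures\<close>

type_synonym ('a, 'n) gvec = "('a, 'n) tvec \<times> ('a, 'n) covec"

definition gtangent_space :: "('a, 'n::finite) chart set \<Rightarrow> 'a \<Rightarrow> ('a, 'n) gvec set" where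
  "gtangent_space M p = tangent_space M p \<times> cotangent_space M p"

definition pairing :: "('a, 'n::finite) gvec \<Rightarrow> ('a, 'n) gvec \<Rightarrow> real" where
  "pairing s t = (snd s (fst t) + snd t (fst s)) / 2"

definition gcoords ::
  "('a, 'n::finite) chart set \<Rightarrow> ('a, 'n) chart \<Rightarrow> 'a \<Rightarrow> ('a, 'n) gvec \<Rightarrow> (real ^ 'n) \<times> (real ^ 'n)" where
  "gcoords M c p s = (fst s c, \<chi> i. snd s (tvec_of M c p (axis i 1)))"

text \<open>Smooth sections of \<open>TM \<oplus> T\<^sup>*M\<close> over an open set \<open>U\<close>.\<close>

definition smooth_section ::
  "('a, 'n::finite) chart set \<Rightarrow> 'a set \<Rightarrow> ('a \<Rightarrow> ('a, 'n) gvec) \<Rightarrow> bool" where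
  "smooth_section M U \<sigma> \<longleftrightarrow>
     (\<forall>q\<in>U. \<sigma> q \<in> gtangent_space M q) \<and>
     (\<forall>c\<in>M. smooth_on (snd c ` (fst c \<inter> U))
        (\<lambda>x. gcoords M c (chart_inv c x) (\<sigma> (chart_inv c x))))"

text \<open>Around every point there is a smooth frame; its linear independence and its span are expressed
  in coordinates. The domain of the frame may be taken to be a chart domain, since charts can be
  restricted.\<close>

definition smooth_subbundle :: "('a, 'n::finite) chart set \<Rightarrow> ('a \<Rightarrow> ('a, 'n) gvec set) \<Rightarrow> bool" where
  "smooth_subbundle M L \<longleftrightarrow>
     (\<forall>p\<in>points M. L p \<subseteq> gtangent_space M p) \<and>
     (\<forall>p\<in>points M. \<exists>c\<in>charts_at M p. \<exists>r::nat. \<exists>\<sigma>.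
        (\<forall>j<r. smooth_section M (fst c) (\<sigma> j)) \<and>
        (\<forall>q\<in>fst c.
           inj_on (\<lambda>j. gcoords M c q (\<sigma> j q)) {..<r} \<and>
           independent ((\<lambda>j. gcoords M c q (\<sigma> j q)) ` {..<r}) \<and>
           gcoords M c q ` L q = span ((\<lambda>j. gcoords M c q (\<sigma> j q)) ` {..<r})))"

definition isotropic_at :: "('a, 'n::finite) chart set \<Rightarrow> 'a \<Rightarrow> ('a, 'n) gvec set \<Rightarrow> bool" where
  "isotropic_at M p K \<longleftrightarrow> K \<subseteq> gtangent_space M p \<and> (\<forall>s\<in>K. \<forall>t\<in>K. pairing s t = 0)"

text \<open>The span of an isotropic set is isotropic, so maximality among isotropic subsets is the same
  as maximality among isotropic linear subspaces.\<close>

definition maximally_isotropic :: "('a, 'n::finite) chart set \<Rightarrow> ('a \<Rightarrow> ('a, 'n) gvec set) \<Rightarrow> bool" where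
  "maximally_isotropic M L \<longleftrightarrow>
     (\<forall>p\<in>points M. isotropic_at M p (L p) \<and> (\<forall>K. isotropic_at M p K \<and> L p \<subseteq> K \<longrightarrow> K = L p))"

definition courant_bracket ::
  "('a, 'n::finite) chart set \<Rightarrow> ('a, 'n) form3 \<Rightarrow> ('a \<Rightarrow> ('a, 'n) gvec) \<Rightarrow> ('a \<Rightarrow> ('a, 'n) gvec) \<Rightarrow>
     'a \<Rightarrow> ('a, 'n) gvec" where
  "courant_bracket M H \<sigma> \<tau> p =
     (let X = (\<lambda>q. fst (\<sigma> q)); \<alpha> = (\<lambda>q. snd (\<sigma> q)); Y = (\<lambda>q. fst (\<tau> q)); \<beta> = (\<lambda>q. snd (\<tau> q)) in
       (lie_bracket M X Y p,
        \<lambda>v. if v \<in> tangent_space M p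
             then lie_deriv1 M X \<beta> p v - ext_deriv1 M \<alpha> p (Y p) v + H p (X p) (Y p) v
             else 0))"

definition involutive ::
  "('a, 'n::finite) chart set \<Rightarrow> ('a, 'n) form3 \<Rightarrow> ('a \<Rightarrow> ('a, 'n) gvec set) \<Rightarrow> bool" where
  "involutive M H L \<longleftrightarrow>
     (\<forall>U \<sigma> \<tau>. openin (mtop M) U \<and> smooth_section M U \<sigma> \<and> smooth_section M U \<tau> \<and>
        (\<forall>q\<in>U. \<sigma> q \<in> L q \<and> \<tau> q \<in> L q) \<longrightarrow>
        (\<forall>q\<in>U. courant_bracket M H \<sigma> \<tau> q \<in> L q))"

definition twisted_dirac ::
  "('a, 'n::finite) chart set \<Rightarrow> ('a, 'n) form3 \<Rightarrow> ('a \<Rightarrow> ('a, 'n) gvec set) \<Rightarrow> bool" where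
  "twisted_dirac M H L \<longleftrightarrow>
     smooth_manifold M \<and> closed_form3 M H \<and>
     smooth_subbundle M L \<and> maximally_isotropic M L \<and> involutive M H L"

definition backward_image ::
  "('b, 'm::finite) chart set \<Rightarrow> ('a, 'n::finite) chart set \<Rightarrow> ('b \<Rightarrow> 'a) \<Rightarrow>
     ('a \<Rightarrow> ('a, 'n) gvec set) \<Rightarrow> 'b \<Rightarrow> ('b, 'm) gvec set" where
  "backward_image B M f L b =
     {(w, covec_pullback B M f b \<xi>) | w \<xi>.
        w \<in> tangent_space B b \<and> (tangent_map B M f b w, \<xi>) \<in> L (f b)}"

definition backward_dirac ::
  "('b, 'm::finite) chart set \<Rightarrow> ('b, 'm) form3 \<Rightarrow> ('b \<Rightarrow> ('b, 'm) gvec set) \<Rightarrow>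
   ('a, 'n::finite) chart set \<Rightarrow> ('a, 'n) form3 \<Rightarrow> ('a \<Rightarrow> ('a, 'n) gvec set) \<Rightarrow> ('b \<Rightarrow> 'a) \<Rightarrow> bool" where
  "backward_dirac B HB LB M H L f \<longleftrightarrow>
     smooth_map B M f \<and>
     (\<forall>b\<in>points B. \<forall>u\<in>tangent_space B b. \<forall>v\<in>tangent_space B b. \<forall>w\<in>tangent_space B b.
        HB b u v w = form3_pullback B M f H b u v w) \<and>
     (\<forall>b\<in>points B. LB b = backward_image B M f L b)"


section \<open>Submanifolds and the normal bundle\<close>

text \<open>\<open>slice_chart M N c I\<close>: the submanifold \<open>N\<close> is given in the chart \<open>c\<close> by the vanishing of the
  coordinates with index in \<open>I\<close>. These are the coordinates \<open>x\<close> normal to \<open>N\<close>; the coordinates with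
  index outside \<open>I\<close> are the coordinates \<open>y\<close> along \<open>N\<close>.\<close>

definition slice_chart ::
  "('a, 'n::finite) chart set \<Rightarrow> 'a set \<Rightarrow> ('a, 'n) chart \<Rightarrow> 'n set \<Rightarrow> bool" where
  "slice_chart M N c I \<longleftrightarrow> c \<in> M \<and> fst c \<inter> N = {q \<in> fst c. \<forall>i\<in>I. snd c q $ i = 0}"

definition closed_embedded_submanifold :: "('a, 'n::finite) chart set \<Rightarrow> 'a set \<Rightarrow> bool" where
  "closed_embedded_submanifold M N \<longleftrightarrow>
     closedin (mtop M) N \<and>
     (\<exists>k. \<forall>q\<in>N. \<exists>c\<in>charts_at M q. \<exists>I. card I = k \<and> slice_chart M N c I)"

definition sub_tangent_space ::
  "('a, 'n::finite) chart set \<Rightarrow> 'a set \<Rightarrow> 'a \<Rightarrow> ('a, 'n) tvec set" where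
  "sub_tangent_space M N q =
     {v \<in> tangent_space M q. \<exists>c I. slice_chart M N c I \<and> q \<in> fst c \<and> (\<forall>i\<in>I. v c $ i = 0)}"

definition transversal_for ::
  "('a, 'n::finite) chart set \<Rightarrow> 'a set \<Rightarrow> ('a \<Rightarrow> ('a, 'n) gvec set) \<Rightarrow> bool" where
  "transversal_for M N L \<longleftrightarrow>
     (\<forall>q\<in>N. {tadd t w | t w. t \<in> sub_tangent_space M N q \<and> w \<in> fst ` L q} = tangent_space M q)"

text \<open>The class of \<open>v\<close> in \<open>T\<^sub>qM / T\<^sub>qN\<close>, as a coset, and the line it spans, as the set of the
  nonzero elements of that line.\<close>

definition normal_class ::
  "('a, 'n::finite) chart set \<Rightarrow> 'a set \<Rightarrow> 'a \<Rightarrow> ('a, 'n) tvec \<Rightarrow> ('a, 'n) tvec set" where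
  "normal_class M N q v = tadd v ` sub_tangent_space M N q"

definition proj_class ::
  "('a, 'n::finite) chart set \<Rightarrow> 'a set \<Rightarrow> 'a \<Rightarrow> ('a, 'n) tvec \<Rightarrow> ('a, 'n) tvec set set" where
  "proj_class M N q v = {normal_class M N q (tscale r v) | r. r \<noteq> 0}"


section \<open>The real projective blowup\<close>

datatype ('a, 'n) blup_point = Off 'a | Exc 'a "('a, 'n) tvec set set"

primrec blowdown :: "('a, 'n) blup_point \<Rightarrow> 'a" where
  "blowdown (Off q) = q"
| "blowdown (Exc q l) = q"

definition blup_domain ::
  "('a, 'n::finite) chart set \<Rightarrow> 'a set \<Rightarrow> ('a, 'n) chart \<Rightarrow> 'n \<Rightarrow> ('a, 'n) blup_point set" where
  "blup_domain M N c i =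
     {Off q | q. q \<in> fst c - N \<and> snd c q $ i \<noteq> 0} \<union>
     {Exc q (proj_class M N q v) | q v.
        q \<in> fst c \<inter> N \<and> v \<in> tangent_space M q - sub_tangent_space M N q \<and> v c $ i \<noteq> 0}"

text \<open>The coordinates of the exceptional point \<open>[v]\<close> are obtained from those of the points outside
  \<open>N\<close> by continuity: the coordinate \<open>x\<^sub>j / x\<^sub>i\<close> becomes \<open>dx\<^sub>j(v) / dx\<^sub>i(v)\<close>.\<close>

primrec blup_coord :: "('a, 'n::finite) chart \<Rightarrow> 'n set \<Rightarrow> 'n \<Rightarrow> ('a, 'n) blup_point \<Rightarrow> real ^ 'n" where
  "blup_coord c I i (Off q) =
     (\<chi> j. if j \<in> I - {i} then snd c q $ j / snd c q $ i else snd c q $ j)"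
| "blup_coord c I i (Exc q l) =
     (let v = (SOME v. v \<in> \<Union>l) in
       \<chi> j. if j = i then 0 else if j \<in> I then v c $ j / v c $ i else snd c q $ j)"

text \<open>The charts in the second set are those of \<open>M - N\<close>, on which \<open>p\<close> is the identity. They are
  compatible with the charts in the first set.\<close>

definition blup_charts ::
  "('a, 'n::finite) chart set \<Rightarrow> 'a set \<Rightarrow> (('a, 'n) blup_point, 'n) chart set" where
  "blup_charts M N =
     {(blup_domain M N c i, blup_coord c I i) | c I i. slice_chart M N c I \<and> i \<in> I} \<union>
     {(Off ` fst c, snd c \<circ> blowdown) | c. c \<in> M \<and> fst c \<inter> N = {}}"

definition blowup ::
  "('a, 'n::finite) chart set \<Rightarrow> 'a set \<Rightarrow> (('a, 'n) blup_point, 'n) chart set" where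
  "blowup M N = max_atlas (blup_charts M N)"

text \<open>The transport of \<open>L\<close> by the diffeomorphism \<open>p\<close> outside the exceptional divisor is the
  backward image.\<close>

definition is_lift ::
  "('a, 'n::finite) chart set \<Rightarrow> 'a set \<Rightarrow> ('a, 'n) form3 \<Rightarrow> ('a \<Rightarrow> ('a, 'n) gvec set) \<Rightarrow>
     (('a, 'n) blup_point \<Rightarrow> (('a, 'n) blup_point, 'n) gvec set) \<Rightarrow> bool" where
  "is_lift M N H L Lt \<longleftrightarrow>
     twisted_dirac (blowup M N) (form3_pullback (blowup M N) M blowdown H) Lt \<and>
     (\<forall>q\<in>points M - N. Lt (Off q) = backward_image (blowup M N) M blowdown L (Off q))"

definition lifts_to_blowup ::
  "('a, 'n::finite) chart set \<Rightarrow> 'a set \<Rightarrow> ('a, 'n) form3 \<Rightarrow> ('a \<Rightarrow> ('a, 'n) gvec set) \<Rightarrow> bool" where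
  "lifts_to_blowup M N H L \<longleftrightarrow> (\<exists>Lt. is_lift M N H L Lt)"

end

theory Submission
  imports Defs
begin

text \<open>
  The lift is the backward image of \<open>L\<close> under the blowdown map \<open>p\<close>, at all points. In coordinates the
  fibres of \<open>L\<close> are Lagrangian subspaces of \<open>\<real>\<^sup>n \<times> \<real>\<^sup>n\<close>. Since the image of \<open>T p\<close> contains \<open>T N\<close> along
  the exceptional divisor, \<open>p\<close> is transverse to \<open>L\<close>; hence the backward image is again Lagrangian, and
  each of its elements extends to a smooth local section by solving a linear system with invertible
  matrix. A Lagrangian subspace is its own orthogonal complement, so membership in the backward image
  amounts to the vanishing of continuous functions, the pairings with such local sections. The
  complement of the exceptional divisor is dense and \<open>p\<close> is a diffeomorphism there; involutivity of
  the backward image and uniqueness of the lift therefore extend from this complement to the whole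
  blowup.
\<close>

section \<open>Calculus of smooth maps\<close>

text \<open>The theorem claims the backward Dirac property for every lift, so uniqueness has to be
  proved along with existence. The pairing has signature (n, n), whence maximal isotropic means
  half-dimensional. The derivative of \<open>p\<close> may drop rank on the divisor; that the
  backward image keeps half dimension is exactly the surjectivity of
  \<open>(w, l) \<mapsto> A w + fst l\<close>, which transversality supplies. On the divisor a
  section of the lift need not be related to any section of \<open>L\<close>, so involutivity cannot
  be transported there; the detour through density needs the bracket as an expression in a chart
  that is continuous across the divisor. Several notions are defined through a chosen chart. Freeing
  them from the choice takes naturality of \<open>d\<close> and of the bracket, and this rests on
  the symmetry of second derivatives. A separate obstacle is the manifold structure of the blowup:
  transitions between its charts are quotients of functions divided by an equation of the divisor,
  smooth by Hadamard's lemma, and points of one projective fibre are separated by reciprocal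
  coordinates.\<close>

abbreviation fder :: "('a::real_normed_vector \<Rightarrow> 'b::real_normed_vector) \<Rightarrow> 'a \<Rightarrow> 'a \<Rightarrow> 'b" where
  "fder f x \<equiv> frechet_derivative f (at x)"

lemma fder_eqI: "(f has_derivative f') (at x) \<Longrightarrow> fder f x = f'"
  by (rule frechet_derivative_at[symmetric])

lemma fder_works: "f differentiable (at x) \<Longrightarrow> (f has_derivative fder f x) (at x)"
  by (simp add: frechet_derivative_works)

text \<open>\<open>Ck_on\<close> controls derivatives in fixed directions only. Expansion along a
  basis carries this over to directions that depend on the point; this is the reason for the sort
  \<open>euclidean_space\<close>.\<close>

lemma fder_expand:
  fixes f :: "'a::euclidean_space \<Rightarrow> 'b::real_normed_vector"
  assumes "f differentiable (at x)"
  shows "fder f x v = (\<Sum>b\<in>Basis. (v \<bullet> b) *\<^sub>R fder f x b)"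
proof -
  have l: "linear (fder f x)" using assms by (rule linear_frechet_derivative)
  have "fder f x v = fder f x (\<Sum>b\<in>Basis. (v \<bullet> b) *\<^sub>R b)" by (simp add: euclidean_representation)
  also have "\<dots> = (\<Sum>b\<in>Basis. (v \<bullet> b) *\<^sub>R fder f x b)"
    by (simp add: linear_sum[OF l] linear_cmul[OF l])
  finally show ?thesis .
qed

lemma fder_compose:
  assumes "f differentiable (at x)" "g differentiable (at (f x))"
  shows "fder (\<lambda>x. g (f x)) x v = fder g (f x) (fder f x v)"
  using frechet_derivative_compose[OF assms] by (simp add: o_def fun_eq_iff)

section \<open>Closure properties of functions of class \<open>C^k\<close>\<close>

lemma Ck_on_subset: "Ck_on k S f \<Longrightarrow> T \<subseteq> S \<Longrightarrow> Ck_on k T f"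
  by (induction k arbitrary: f) (auto intro: continuous_on_subset)

text \<open>Derivatives at a point of an open set depend only on the values in that set, so
  agreement on \<open>S\<close> passes to all orders.\<close>

lemma Ck_on_cong:
  assumes "open S" "\<And>x. x \<in> S \<Longrightarrow> f x = g x" "Ck_on k S f"
  shows "Ck_on k S g"
  using assms(2,3)
proof (induction k arbitrary: f g)
  case 0
  then show ?case by (simp cong: continuous_on_cong)
next
  case (Suc k)
  have d: "f differentiable (at x)" if "x \<in> S" for x using Suc.prems that by auto
  have g: "(g has_derivative fder f x) (at x)" if "x \<in> S" for x
    by (rule has_derivative_transform_within_open[OF fder_works[OF d[OF that]] assms(1) that])
      (use Suc.prems in auto)
  have e: "fder f x = fder g x" if "x \<in> S" for x using fder_eqI[OF g[OF that]] by simp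
  have "Ck_on k S (\<lambda>x. fder g x v)" for v
    by (rule Suc.IH[of "\<lambda>x. fder f x v"]) (use Suc.prems e in auto)
  then show ?case using g by (auto simp: differentiable_def)
qed

lemma Ck_on_local:
  assumes "\<And>x. x \<in> S \<Longrightarrow> \<exists>T. open T \<and> x \<in> T \<and> Ck_on k T f"
  shows "Ck_on k S f"
  using assms
proof (induction k arbitrary: f)
  case 0
  then have "continuous (at x) f" if "x \<in> S" for x
    using that continuous_on_eq_continuous_at by (metis Ck_on.simps(1))
  then show ?case by (simp add: continuous_at_imp_continuous_on)
next
  case (Suc k)
  have "Ck_on k S (\<lambda>x. fder f x v)" for v
    by (rule Suc.IH) (use Suc.prems in \<open>fastforce\<close>)
  then show ?case using Suc.prems by fastforce
qed

lemma Ck_on_Suc_D: "Ck_on (Suc k) S f \<Longrightarrow> Ck_on k S f"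
proof (induction k arbitrary: f)
  case 0
  then show ?case
    by (auto intro!: continuous_at_imp_continuous_on differentiable_imp_continuous_within)
next
  case (Suc k)
  show ?case unfolding Ck_on.simps(2)
  proof (intro conjI allI)
    show "\<forall>x\<in>S. f differentiable at x" using Suc.prems by simp
    show "Ck_on k S (\<lambda>x. fder f x v)" for v
      by (rule Suc.IH) (use Suc.prems in simp)
  qed
qed

lemma Ck_on_const: "Ck_on k S (\<lambda>x. c)"
  by (induction k arbitrary: c) auto

lemma Ck_on_bounded_linear:
  assumes "bounded_linear f" shows "Ck_on k S f"
proof (cases k)
  case 0
  then show ?thesis using assms by (simp add: linear_continuous_on)
next
  case (Suc j)
  have "(f has_derivative f) (at x)" for x using assms by (rule bounded_linear_imp_has_derivative)
  from fder_eqI[OF this] this show ?thesis using Suc by (auto simp: differentiable_def Ck_on_const)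
qed

lemma Ck_on_add:
  assumes "open S" "Ck_on k S f" "Ck_on k S g"
  shows "Ck_on k S (\<lambda>x. f x + g x)"
  using assms(2,3)
proof (induction k arbitrary: f g)
  case 0
  then show ?case by (simp add: continuous_on_add)
next
  case (Suc k)
  have d: "((\<lambda>x. f x + g x) has_derivative (\<lambda>v. fder f x v + fder g x v)) (at x)" if "x \<in> S" for x
    using Suc.prems that by (auto intro!: derivative_eq_intros fder_works)
  have "Ck_on k S (\<lambda>x. fder (\<lambda>x. f x + g x) x v)" for v
    by (rule Ck_on_cong[OF assms(1) _ Suc.IH[of "\<lambda>x. fder f x v" "\<lambda>x. fder g x v"]])
      (use Suc.prems in \<open>auto simp: fder_eqI[OF d]\<close>)
  then show ?case using d by (auto simp: differentiable_def)
qed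

lemma Ck_on_sum:
  assumes "open S" "\<And>i. i \<in> I \<Longrightarrow> Ck_on k S (f i)"
  shows "Ck_on k S (\<lambda>x. \<Sum>i\<in>I. f i x)"
  using assms(2)
  by (induction I rule: infinite_finite_induct) (auto simp: Ck_on_const intro: Ck_on_add[OF assms(1)])

text \<open>The Leibniz rule reproduces the claim one order lower; scaling, inner product and
  multiplication are instances.\<close>

lemma (in bounded_bilinear) Ck_on:
  assumes "open S" "Ck_on k S f" "Ck_on k S g"
  shows "Ck_on k S (\<lambda>x. prod (f x) (g x))"
  using assms(2,3)
proof (induction k arbitrary: f g)
  case 0
  then show ?case by (simp add: continuous_on)
next
  case (Suc k)
  have d: "((\<lambda>x. prod (f x) (g x)) has_derivative (\<lambda>v. prod (f x) (fder g x v) + prod (fder f x v) (g x))) (at x)"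
    if "x \<in> S" for x
    using Suc.prems that by (auto intro!: FDERIV fder_works)
  have 1: "Ck_on k S (\<lambda>x. prod (f x) (fder g x v) + prod (fder f x v) (g x))" for v
    using Suc.prems by (intro Ck_on_add[OF assms(1)] Suc.IH) (auto intro: Ck_on_Suc_D)
  have "Ck_on k S (\<lambda>x. fder (\<lambda>x. prod (f x) (g x)) x v)" for v
    by (rule Ck_on_cong[OF assms(1) _ 1[of v]]) (auto simp: fder_eqI[OF d])
  then show ?case using d by (auto simp: differentiable_def)
qed

text \<open>By the chain rule the direction \<open>fder f x v\<close> moves with \<open>x\<close>.
  Its expansion in a basis of the middle space leaves products of functions of class
  \<open>k\<close>.\<close>

lemma Ck_on_compose:
  fixes f :: "'a::real_normed_vector \<Rightarrow> 'b::euclidean_space" and g :: "'b \<Rightarrow> 'c::real_normed_vector"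
  assumes S: "open S" and f: "Ck_on k S f" and g: "Ck_on k T g" and sub: "f ` S \<subseteq> T"
  shows "Ck_on k S (\<lambda>x. g (f x))"
  using f g
proof (induction k arbitrary: g)
  case 0
  then show ?case using sub continuous_on_compose2 by (metis Ck_on.simps(1))
next
  case (Suc k)
  have df: "f differentiable (at x)" if "x \<in> S" for x using Suc.prems that by auto
  have dg: "g differentiable (at (f x))" if "x \<in> S" for x using Suc.prems that sub by auto
  have d: "((\<lambda>x. g (f x)) has_derivative (\<lambda>v. fder g (f x) (fder f x v))) (at x)" if "x \<in> S" for x
    using has_derivative_compose[OF fder_works[OF df[OF that]] fder_works[OF dg[OF that]]] .
  have 1: "Ck_on k S (\<lambda>x. \<Sum>b\<in>Basis. (fder f x v \<bullet> b) *\<^sub>R fder g (f x) b)" for v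
  proof (intro Ck_on_sum[OF S] bounded_bilinear.Ck_on[OF bounded_bilinear_scaleR S])
    fix b :: 'b
    show "Ck_on k S (\<lambda>x. fder f x v \<bullet> b)"
      using Suc.prems by (intro bounded_bilinear.Ck_on[OF bounded_bilinear_inner S] Ck_on_const) auto
    show "Ck_on k S (\<lambda>x. fder g (f x) b)"
      using Suc.IH[OF Ck_on_Suc_D[OF Suc.prems(1)], of "\<lambda>x. fder g x b"] Suc.prems(2) by simp
  qed
  have "Ck_on k S (\<lambda>x. fder (\<lambda>x. g (f x)) x v)" for v
    by (rule Ck_on_cong[OF S _ 1[of v]])
      (auto simp: fder_eqI[OF d] fder_expand[OF dg, symmetric])
  then show ?case using d by (auto simp: differentiable_def)
qed

text \<open>The derivative is a product of a derivative of \<open>f\<close> and two factors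
  \<open>inverse (f x)\<close>, so the claim at order \<open>k\<close> feeds the one at order
  \<open>Suc k\<close>.\<close>

lemma Ck_on_inverse:
  fixes f :: "'a::real_normed_vector \<Rightarrow> real"
  assumes S: "open S" and "Ck_on k S f" and nz: "\<And>x. x \<in> S \<Longrightarrow> f x \<noteq> 0"
  shows "Ck_on k S (\<lambda>x. inverse (f x))"
  using assms(2)
proof (induction k)
  case 0
  then show ?case using nz by (simp add: continuous_on_inverse)
next
  case (Suc k)
  have d: "((\<lambda>x. inverse (f x)) has_derivative (\<lambda>v. - (inverse (f x) * fder f x v * inverse (f x)))) (at x)"
    if "x \<in> S" for x
    by (rule Deriv.has_derivative_inverse[where f=f, OF nz[OF that] fder_works]) (use Suc.prems that in auto)
  have i: "Ck_on k S (\<lambda>x. inverse (f x))" using Suc Ck_on_Suc_D by blast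
  note m = bounded_bilinear.Ck_on[OF bounded_bilinear_mult S]
  have 1: "Ck_on k S (\<lambda>x. (- 1) * (inverse (f x) * fder f x v * inverse (f x)))" for v
    using Suc.prems by (intro m i Ck_on_const) auto
  have "Ck_on k S (\<lambda>x. fder (\<lambda>x. inverse (f x)) x v)" for v
    by (rule Ck_on_cong[OF S _ 1[of v]]) (auto simp: fder_eqI[OF d])
  then show ?case using d by (auto simp: differentiable_def)
qed

section \<open>Smooth functions and their closure rules\<close>

lemma smooth_on_subset: "smooth_on S f \<Longrightarrow> T \<subseteq> S \<Longrightarrow> smooth_on T f"
  unfolding smooth_on_def using Ck_on_subset by blast

lemma smooth_on_cong:
  "open S \<Longrightarrow> (\<And>x. x \<in> S \<Longrightarrow> f x = g x) \<Longrightarrow> smooth_on S f \<Longrightarrow> smooth_on S g"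
  unfolding smooth_on_def using Ck_on_cong by blast

lemma smooth_on_local:
  assumes "\<And>x. x \<in> S \<Longrightarrow> \<exists>T. open T \<and> x \<in> T \<and> smooth_on T f"
  shows "smooth_on S f"
  unfolding smooth_on_def
proof
  show "Ck_on k S f" for k
    by (rule Ck_on_local) (use assms in \<open>auto simp: smooth_on_def\<close>)
qed

lemma smooth_on_differentiable: "smooth_on S f \<Longrightarrow> x \<in> S \<Longrightarrow> f differentiable (at x)"
  unfolding smooth_on_def using Ck_on.simps(2) by blast

lemma smooth_on_has_derivative: "smooth_on S f \<Longrightarrow> x \<in> S \<Longrightarrow> (f has_derivative fder f x) (at x)"
  by (simp add: fder_works smooth_on_differentiable)

lemma smooth_on_continuous: "smooth_on S f \<Longrightarrow> continuous_on S f"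
  unfolding smooth_on_def using Ck_on.simps(1) by blast

lemma smooth_on_fder_const: "smooth_on S f \<Longrightarrow> smooth_on S (\<lambda>x. fder f x v)"
  unfolding smooth_on_def using Ck_on.simps(2) by blast

named_theorems smooth_intros

lemma smooth_on_const [smooth_intros]: "smooth_on S (\<lambda>x. c)"
  by (simp add: smooth_on_def Ck_on_const)

lemma smooth_on_bounded_linear: "bounded_linear f \<Longrightarrow> smooth_on S f"
  by (simp add: smooth_on_def Ck_on_bounded_linear)

lemma smooth_on_ident [smooth_intros]: "smooth_on S (\<lambda>x. x)"
  by (rule smooth_on_bounded_linear) (rule bounded_linear_ident)

lemma smooth_on_add [smooth_intros]:
  "open S \<Longrightarrow> smooth_on S f \<Longrightarrow> smooth_on S g \<Longrightarrow> smooth_on S (\<lambda>x. f x + g x)"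
  by (simp add: smooth_on_def Ck_on_add)

lemma smooth_on_sum [smooth_intros]:
  "open S \<Longrightarrow> (\<And>i. i \<in> I \<Longrightarrow> smooth_on S (f i)) \<Longrightarrow> smooth_on S (\<lambda>x. \<Sum>i\<in>I. f i x)"
  by (simp add: smooth_on_def Ck_on_sum)

lemma (in bounded_bilinear) smooth_on:
  "open S \<Longrightarrow> smooth_on S f \<Longrightarrow> smooth_on S g \<Longrightarrow> smooth_on S (\<lambda>x. prod (f x) (g x))"
  by (simp add: smooth_on_def Ck_on)

lemmas smooth_on_scaleR [smooth_intros] = bounded_bilinear.smooth_on[OF bounded_bilinear_scaleR]
lemmas smooth_on_inner [smooth_intros] = bounded_bilinear.smooth_on[OF bounded_bilinear_inner]

lemma smooth_on_mult [smooth_intros]: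
  fixes f g :: "'a::real_normed_vector \<Rightarrow> real"
  shows "open S \<Longrightarrow> smooth_on S f \<Longrightarrow> smooth_on S g \<Longrightarrow> smooth_on S (\<lambda>x. f x * g x)"
  by (rule bounded_bilinear.smooth_on[OF bounded_bilinear_mult])

lemma smooth_on_uminus [smooth_intros]:
  assumes "open S" "smooth_on S f" shows "smooth_on S (\<lambda>x. - f x)"
  using smooth_on_scaleR[OF assms(1) smooth_on_const[of S "-1"] assms(2)] by simp

lemma smooth_on_diff [smooth_intros]:
  assumes "open S" "smooth_on S f" "smooth_on S g" shows "smooth_on S (\<lambda>x. f x - g x)"
  using smooth_on_add[OF assms(1,2) smooth_on_uminus[OF assms(1,3)]] by simp

lemma smooth_on_prod [smooth_intros]:
  fixes f :: "'i \<Rightarrow> 'a::real_normed_vector \<Rightarrow> real"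
  assumes "open S" "\<And>i. i \<in> I \<Longrightarrow> smooth_on S (f i)"
  shows "smooth_on S (\<lambda>x. \<Prod>i\<in>I. f i x)"
  using assms(2)
  by (induction I rule: infinite_finite_induct)
    (auto simp: smooth_on_const intro!: smooth_on_mult[OF assms(1)])

lemma smooth_on_inverse [smooth_intros]:
  fixes f :: "'a::real_normed_vector \<Rightarrow> real"
  shows "open S \<Longrightarrow> smooth_on S f \<Longrightarrow> (\<And>x. x \<in> S \<Longrightarrow> f x \<noteq> 0) \<Longrightarrow> smooth_on S (\<lambda>x. inverse (f x))"
  by (simp add: smooth_on_def Ck_on_inverse)

lemma smooth_on_divide [smooth_intros]:
  fixes f :: "'a::real_normed_vector \<Rightarrow> real"
  shows "open S \<Longrightarrow> smooth_on S f \<Longrightarrow> smooth_on S g \<Longrightarrow> (\<And>x. x \<in> S \<Longrightarrow> g x \<noteq> 0) \<Longrightarrow>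
    smooth_on S (\<lambda>x. f x / g x)"
  unfolding divide_inverse by (intro smooth_intros)

lemma smooth_on_compose:
  fixes f :: "'a::real_normed_vector \<Rightarrow> 'b::euclidean_space" and g :: "'b \<Rightarrow> 'c::real_normed_vector"
  shows "open S \<Longrightarrow> smooth_on S f \<Longrightarrow> smooth_on T g \<Longrightarrow> f ` S \<subseteq> T \<Longrightarrow> smooth_on S (\<lambda>x. g (f x))"
  unfolding smooth_on_def using Ck_on_compose by blast

lemma smooth_on_linear_compose:
  fixes f :: "'a::real_normed_vector \<Rightarrow> 'b::euclidean_space"
  assumes "bounded_linear g" "open S" "smooth_on S f" shows "smooth_on S (\<lambda>x. g (f x))"
  by (rule smooth_on_compose[OF assms(2,3) smooth_on_bounded_linear[OF assms(1), of UNIV]]) simp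

lemma smooth_on_Pair [smooth_intros]:
  fixes f :: "'a::real_normed_vector \<Rightarrow> 'b::euclidean_space" and g :: "'a \<Rightarrow> 'c::euclidean_space"
  assumes "open S" "smooth_on S f" "smooth_on S g"
  shows "smooth_on S (\<lambda>x. (f x, g x))"
proof -
  have 1: "smooth_on S (\<lambda>x. (f x, 0::'c))" and 2: "smooth_on S (\<lambda>x. (0::'b, g x))"
    using smooth_on_linear_compose[OF bounded_linear_Pair[OF bounded_linear_ident bounded_linear_zero] assms(1,2)]
      smooth_on_linear_compose[OF bounded_linear_Pair[OF bounded_linear_zero bounded_linear_ident] assms(1,3)]
    by simp_all
  show ?thesis using smooth_on_add[OF assms(1) 1 2] by simp
qed

lemma smooth_on_fst [smooth_intros]:
  fixes f :: "'a::real_normed_vector \<Rightarrow> 'b::euclidean_space \<times> 'c::euclidean_space"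
  shows "open S \<Longrightarrow> smooth_on S f \<Longrightarrow> smooth_on S (\<lambda>x. fst (f x))"
  by (rule smooth_on_linear_compose[OF bounded_linear_fst])

lemma smooth_on_snd [smooth_intros]:
  fixes f :: "'a::real_normed_vector \<Rightarrow> 'b::euclidean_space \<times> 'c::euclidean_space"
  shows "open S \<Longrightarrow> smooth_on S f \<Longrightarrow> smooth_on S (\<lambda>x. snd (f x))"
  by (rule smooth_on_linear_compose[OF bounded_linear_snd])

lemma smooth_on_vec_nth [smooth_intros]:
  fixes f :: "'a::real_normed_vector \<Rightarrow> real ^ 'n"
  shows "open S \<Longrightarrow> smooth_on S f \<Longrightarrow> smooth_on S (\<lambda>x. f x $ i)"
  by (rule smooth_on_linear_compose[OF bounded_linear_vec_nth])

lemma vec_sum_axis: "(\<chi> i. f i) = (\<Sum>i\<in>UNIV. f i *\<^sub>R axis i (1::real))"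
  by (simp add: vec_eq_iff axis_def if_distrib sum.delta cong: if_cong)

lemma smooth_on_vec [smooth_intros]:
  fixes f :: "'n::finite \<Rightarrow> 'a::real_normed_vector \<Rightarrow> real"
  assumes "open S" "\<And>i. smooth_on S (f i)"
  shows "smooth_on S (\<lambda>x. \<chi> i. f i x)"
  unfolding vec_sum_axis using assms by (intro smooth_intros)

lemma smooth_on_fder [smooth_intros]:
  fixes f :: "'a::euclidean_space \<Rightarrow> 'b::real_normed_vector"
  assumes "open S" "smooth_on S f" "smooth_on S g"
  shows "smooth_on S (\<lambda>x. fder f x (g x))"
proof -
  have 1: "smooth_on S (\<lambda>x. \<Sum>b\<in>Basis. (g x \<bullet> b) *\<^sub>R fder f x b)"
    using assms by (intro smooth_intros smooth_on_fder_const)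
  show ?thesis
    by (rule smooth_on_cong[OF assms(1) _ 1])
      (simp add: fder_expand[OF smooth_on_differentiable[OF assms(2)], symmetric])
qed

lemma smooth_on_det [smooth_intros]:
  fixes A :: "'a::real_normed_vector \<Rightarrow> real ^ 'n ^ 'n"
  assumes "open S" "\<And>i j. smooth_on S (\<lambda>x. A x $ i $ j)"
  shows "smooth_on S (\<lambda>x. det (A x))"
  unfolding det_def by (intro smooth_on_sum smooth_on_mult smooth_on_prod smooth_on_const assms)

text \<open>Cramer's rule writes the solution through quotients of determinants, which are smooth.
  The equivalence includes uniqueness, by which the value of the solution at a given point is
  identified later.\<close>

lemma smooth_on_solution:
  fixes A :: "'a::real_normed_vector \<Rightarrow> real ^ 'n ^ 'n"
  assumes S: "open S" and A: "\<And>i j. smooth_on S (\<lambda>x. A x $ i $ j)" and b: "smooth_on S b"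
    and nz: "\<And>x. x \<in> S \<Longrightarrow> det (A x) \<noteq> 0"
  shows "\<exists>z. smooth_on S z \<and> (\<forall>x\<in>S. \<forall>w. A x *v w = b x \<longleftrightarrow> w = z x)"
proof (intro exI conjI ballI allI)
  let ?z = "\<lambda>x. \<chi> k. det (\<chi> i j. if j = k then b x $ i else A x $ i $ j) / det (A x)"
  have "smooth_on S (\<lambda>x. if j = k then b x $ i else A x $ i $ j)" for i j k
    using S A b by (cases "j = k") (auto intro: smooth_intros)
  then show "smooth_on S ?z" using S A nz by (intro smooth_on_vec smooth_on_divide smooth_on_det) auto
  show "A x *v w = b x \<longleftrightarrow> w = ?z x" if "x \<in> S" for x w
    by (rule cramer[OF nz[OF that]])
qed

subsection \<open>Symmetry of second derivatives\<close>

text \<open>The mean value theorem is applied twice: along \<open>u\<close> to the difference in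
  direction \<open>v\<close>, then along \<open>v\<close> to the derivative in direction
  \<open>u\<close>. The summand 1 in the radius keeps all sampled points strictly inside the ball,
  also when \<open>u\<close> and \<open>v\<close> vanish.\<close>

lemma second_difference:
  fixes f :: "'a::real_normed_vector \<Rightarrow> real"
  assumes f: "smooth_on (ball x (h * (norm u + norm v + 1))) f" and h: "h > 0"
  shows "\<exists>s t. 0 < s \<and> s < h \<and> 0 < t \<and> t < h \<and>
    f (x + h *\<^sub>R u + h *\<^sub>R v) - f (x + h *\<^sub>R u) - f (x + h *\<^sub>R v) + f x =
    h * h * fder (\<lambda>y. fder f y u) (x + s *\<^sub>R u + t *\<^sub>R v) v"
proof -
  let ?B = "ball x (h * (norm u + norm v + 1))"
  have B: "x + s *\<^sub>R u + t *\<^sub>R v \<in> ?B" if "0 \<le> s" "s \<le> h" "0 \<le> t" "t \<le> h" for s t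
  proof -
    have "norm (s *\<^sub>R u + t *\<^sub>R v) \<le> s * norm u + t * norm v"
      by (rule order_trans[OF norm_triangle_ineq]) (use that in simp)
    also have "\<dots> \<le> h * norm u + h * norm v" using that by (intro add_mono mult_right_mono) auto
    also have "\<dots> < h * (norm u + norm v + 1)" using h by (simp add: algebra_simps)
    finally have "dist (x + (s *\<^sub>R u + t *\<^sub>R v)) x < h * (norm u + norm v + 1)" by (simp add: dist_norm)
    then show ?thesis by (simp add: dist_commute add.assoc)
  qed
  \<comment> \<open>The term \<open>0 *\<^sub>R v\<close> is kept so that both summands are
    instances, \<open>t = h\<close> and \<open>t = 0\<close>, of one expression in
    \<open>t\<close>.\<close>
  define g where "g s = f (x + s *\<^sub>R u + h *\<^sub>R v) - f (x + s *\<^sub>R u + 0 *\<^sub>R v)" for s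
  have dg: "(g has_real_derivative
      fder f (x + s *\<^sub>R u + h *\<^sub>R v) u - fder f (x + s *\<^sub>R u + 0 *\<^sub>R v) u) (at s)"
    if "0 \<le> s" "s \<le> h" for s
  proof -
    have 1: "((\<lambda>s. f (x + s *\<^sub>R u + t *\<^sub>R v)) has_derivative (\<lambda>r. fder f (x + s *\<^sub>R u + t *\<^sub>R v) (r *\<^sub>R u))) (at s)"
      if "0 \<le> t" "t \<le> h" for t
      by (rule has_derivative_compose[where g=f])
        (use B[of s t] that \<open>0 \<le> s\<close> \<open>s \<le> h\<close> f in \<open>auto intro!: derivative_eq_intros smooth_on_has_derivative\<close>)
    have 2: "linear (fder f (x + s *\<^sub>R u + t *\<^sub>R v))" if "0 \<le> t" "t \<le> h" for t
      using B[of s t] that \<open>0 \<le> s\<close> \<open>s \<le> h\<close> f by (auto intro!: linear_frechet_derivative smooth_on_differentiable)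
    have 3: "fder f (x + s *\<^sub>R u + h *\<^sub>R v) (r *\<^sub>R u) - fder f (x + s *\<^sub>R u + 0 *\<^sub>R v) (r *\<^sub>R u) =
      (fder f (x + s *\<^sub>R u + h *\<^sub>R v) u - fder f (x + s *\<^sub>R u + 0 *\<^sub>R v) u) * r" for r
      unfolding linear_cmul[OF 2[OF order_refl less_imp_le[OF h]]] linear_cmul[OF 2[OF less_imp_le[OF h] order_refl]]
        left_diff_distrib real_scaleR_def by (simp only: mult.commute)
    show ?thesis unfolding g_def has_field_derivative_def
      using has_derivative_diff[OF 1[OF less_imp_le[OF h] order_refl] 1[OF order_refl less_imp_le[OF h]]]
      unfolding 3 .
  qed
  obtain s where s: "0 < s" "s < h" "g h - g 0 = (h - 0) * (fder f (x + s *\<^sub>R u + h *\<^sub>R v) u - fder f (x + s *\<^sub>R u + 0 *\<^sub>R v) u)"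
    using MVT2[OF h, of g, OF dg] by auto
  define k where "k t = fder f (x + s *\<^sub>R u + t *\<^sub>R v) u" for t
  let ?f' = "\<lambda>y. fder f y u"
  have f': "smooth_on ?B ?f'" using f by (rule smooth_on_fder_const)
  have dk: "(k has_real_derivative fder ?f' (x + s *\<^sub>R u + t *\<^sub>R v) v) (at t)" if "0 \<le> t" "t \<le> h" for t
  proof -
    have p: "x + s *\<^sub>R u + t *\<^sub>R v \<in> ?B" using B s that by simp
    have 1: "((\<lambda>t. ?f' (x + s *\<^sub>R u + t *\<^sub>R v)) has_derivative (\<lambda>r. fder ?f' (x + s *\<^sub>R u + t *\<^sub>R v) (r *\<^sub>R v))) (at t)"
      by (rule has_derivative_compose[where g="?f'"])
        (use p f' in \<open>auto intro!: derivative_eq_intros smooth_on_has_derivative\<close>)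
    have 2: "linear (fder ?f' (x + s *\<^sub>R u + t *\<^sub>R v))"
      using p f' by (auto intro!: linear_frechet_derivative smooth_on_differentiable)
    show ?thesis unfolding k_def has_field_derivative_def
      by (rule has_derivative_eq_rhs[OF 1]) (auto simp: linear_cmul[OF 2] mult.commute)
  qed
  obtain t where t: "0 < t" "t < h" "k h - k 0 = (h - 0) * fder ?f' (x + s *\<^sub>R u + t *\<^sub>R v) v"
    using MVT2[OF h, of k, OF dk] by auto
  have "g h - g 0 = h * (k h - k 0)" using s(3) by (simp add: k_def)
  then have "g h - g 0 = h * h * fder ?f' (x + s *\<^sub>R u + t *\<^sub>R v) v" using t(3) by simp
  then have "f (x + h *\<^sub>R u + h *\<^sub>R v) - f (x + h *\<^sub>R u) - f (x + h *\<^sub>R v) + f x =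
    h * h * fder ?f' (x + s *\<^sub>R u + t *\<^sub>R v) v" by (simp add: g_def)
  then show ?thesis using s t by blast
qed

text \<open>The second difference is symmetric in \<open>u\<close> and \<open>v\<close>. By
  \<open>second_difference\<close> it samples either mixed derivative near \<open>x\<close>, and
  continuity of both forces equality.\<close>

lemma fder_fder_commute_real:
  fixes f :: "'a::real_normed_vector \<Rightarrow> real"
  assumes S: "open S" "x \<in> S" and f: "smooth_on S f"
  shows "fder (\<lambda>y. fder f y u) x v = fder (\<lambda>y. fder f y v) x u"
proof (rule ccontr)
  assume ne: "\<not> ?thesis"
  define a where "a = (\<lambda>y. fder (\<lambda>y. fder f y u) y v)"
  define b where "b = (\<lambda>y. fder (\<lambda>y. fder f y v) y u)"
  \<comment> \<open>Half the gap: no common value can lie within less than this of both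
    \<open>a x\<close> and \<open>b x\<close>.\<close>
  define e where "e = \<bar>a x - b x\<bar> / 2"
  have e: "e > 0" using ne by (simp add: e_def a_def b_def)
  have "continuous_on S a" "continuous_on S b"
    unfolding a_def b_def using f by (auto intro!: smooth_on_continuous[OF smooth_on_fder_const] smooth_on_fder_const)
  then have "isCont a x" "isCont b x" using S continuous_on_eq_continuous_at by blast+
  then obtain d1 d2 where d1: "d1 > 0" "\<And>y. dist y x < d1 \<Longrightarrow> dist (a y) (a x) < e"
    and d2: "d2 > 0" "\<And>y. dist y x < d2 \<Longrightarrow> dist (b y) (b x) < e"
    unfolding continuous_at_eps_delta using e by blast
  obtain d3 where d3: "d3 > 0" "ball x d3 \<subseteq> S" using S openE by blast
  define n where "n = norm u + norm v + 1"
  have n: "n > 0" unfolding n_def by (simp add: add_nonneg_pos)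
  \<comment> \<open>With this step the parallelogram spanned by \<open>h u\<close> and
    \<open>h v\<close> at \<open>x\<close> stays in the domain and in the region where both
    continuity estimates hold.\<close>
  define h where "h = min d1 (min d2 d3) / n"
  have h: "h > 0" using d1 d2 d3 n by (simp add: h_def)
  have hn: "h * n = min d1 (min d2 d3)" using n by (simp add: h_def)
  have fB: "smooth_on (ball x (h * n)) f" by (rule smooth_on_subset[OF f]) (use d3 hn in auto)
  obtain s t where st: "0 < s" "s < h" "0 < t" "t < h"
    and e1: "f (x + h *\<^sub>R u + h *\<^sub>R v) - f (x + h *\<^sub>R u) - f (x + h *\<^sub>R v) + f x = h * h * a (x + s *\<^sub>R u + t *\<^sub>R v)"
    using second_difference[OF fB[unfolded n_def] h] unfolding a_def by blast
  have fB': "smooth_on (ball x (h * (norm v + norm u + 1))) f" using fB by (simp add: n_def add.commute)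
  obtain s' t' where st': "0 < s'" "s' < h" "0 < t'" "t' < h"
    and e2: "f (x + h *\<^sub>R v + h *\<^sub>R u) - f (x + h *\<^sub>R v) - f (x + h *\<^sub>R u) + f x = h * h * b (x + s' *\<^sub>R v + t' *\<^sub>R u)"
    using second_difference[OF fB' h] unfolding b_def by blast
  have "f (x + h *\<^sub>R u + h *\<^sub>R v) = f (x + h *\<^sub>R v + h *\<^sub>R u)" by (simp add: algebra_simps)
  then have "h * h * a (x + s *\<^sub>R u + t *\<^sub>R v) = h * h * b (x + s' *\<^sub>R v + t' *\<^sub>R u)"
    using e1 e2 by linarith
  then have eq: "a (x + s *\<^sub>R u + t *\<^sub>R v) = b (x + s' *\<^sub>R v + t' *\<^sub>R u)" using h by simp
  have dd: "dist (x + p *\<^sub>R w + q *\<^sub>R w') x < h * n"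
    if "0 < p" "p < h" "0 < q" "q < h" "norm w + norm w' + 1 = n" for p q w w'
  proof -
    have "norm (p *\<^sub>R w + q *\<^sub>R w') \<le> p * norm w + q * norm w'"
      by (rule order_trans[OF norm_triangle_ineq]) (use that in simp)
    also have "\<dots> \<le> h * norm w + h * norm w'" using that by (intro add_mono mult_right_mono) auto
    also have "\<dots> < h * n" using h that(5)[symmetric] by (simp add: algebra_simps)
    finally show ?thesis by (simp add: dist_norm add.assoc)
  qed
  have "dist (a (x + s *\<^sub>R u + t *\<^sub>R v)) (a x) < e"
    using d1(2) dd[of s t u v] st hn by (simp add: n_def)
  moreover have "dist (b (x + s' *\<^sub>R v + t' *\<^sub>R u)) (b x) < e"
    using d2(2) dd[of s' t' v u] st' hn by (simp add: n_def)
  ultimately show False using eq unfolding e_def dist_real_def by (auto simp: abs_if split: if_splits)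
qed

lemma fder_fder_commute:
  fixes f :: "'a::euclidean_space \<Rightarrow> 'b::euclidean_space"
  assumes S: "open S" "x \<in> S" and f: "smooth_on S f"
  shows "fder (\<lambda>y. fder f y u) x v = fder (\<lambda>y. fder f y v) x u"
proof (rule euclidean_eqI)
  fix b :: 'b assume "b \<in> Basis"
  have 1: "fder (\<lambda>y. g y \<bullet> b) y w = fder g y w \<bullet> b" if "g differentiable (at y)" for y w and g :: "'a \<Rightarrow> 'b"
    using fder_eqI[OF has_derivative_inner_left[OF fder_works[OF that]]] by simp
  have 2: "fder (\<lambda>y. fder f y u) x v \<bullet> b = fder (\<lambda>y. fder (\<lambda>y. f y \<bullet> b) y u) x v" for u v
  proof -
    have "fder (\<lambda>y. fder f y u) x v \<bullet> b = fder (\<lambda>y. fder f y u \<bullet> b) x v"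
      using S f by (intro 1[symmetric] smooth_on_differentiable smooth_on_fder_const)
    also have "\<dots> = fder (\<lambda>y. fder (\<lambda>y. f y \<bullet> b) y u) x v"
    proof (rule fun_cong[where x=v], rule frechet_derivative_transform_within_open[OF _ S])
      show "(\<lambda>y. fder f y u \<bullet> b) differentiable at x"
        using S f by (intro smooth_on_differentiable[OF _ S(2)] smooth_intros)
      show "fder f y u \<bullet> b = fder (\<lambda>y. f y \<bullet> b) y u" if "y \<in> S" for y
        using 1[OF smooth_on_differentiable[OF f that]] by simp
    qed
    finally show ?thesis .
  qed
  show "fder (\<lambda>y. fder f y u) x v \<bullet> b = fder (\<lambda>y. fder f y v) x u \<bullet> b"
    unfolding 2 by (rule fder_fder_commute_real[OF S]) (use S f in \<open>intro smooth_intros\<close>)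
qed

subsection \<open>Division by a coordinate\<close>

text \<open>Multiplication of the \<open>i\<close>-th coordinate by \<open>t\<close>. As
  \<open>t\<close> runs from 0 to 1 it joins the projection onto the coordinate hyperplane to the
  identity, which is the path of integration in Hadamard's lemma.\<close>

definition coord_scale :: "'n::finite \<Rightarrow> real \<Rightarrow> real ^ 'n \<Rightarrow> real ^ 'n" where
  "coord_scale i t x = x + ((t - 1) * x $ i) *\<^sub>R axis i 1"

lemma coord_scale_one [simp]: "coord_scale i 1 x = x"
  by (simp add: coord_scale_def)

lemma coord_scale_fixed: "x $ i = 0 \<Longrightarrow> coord_scale i t x = x"
  by (simp add: coord_scale_def)

lemma coord_scale_zero_nth [simp]: "coord_scale i 0 x $ i = 0"
  by (simp add: coord_scale_def axis_def)

text \<open>The centre lies on the hyperplane, so shrinking the \<open>i\<close>-th coordinate moves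
  no component farther from it.\<close>

lemma coord_scale_in_ball:
  assumes "x \<in> ball c r" "c $ i = 0" "0 \<le> t" "t \<le> 1"
  shows "coord_scale i t x \<in> ball c r"
proof -
  have "norm (coord_scale i t x - c) \<le> norm (x - c)"
  proof (rule norm_le_componentwise_cart)
    fix j show "norm ((coord_scale i t x - c) $ j) \<le> norm ((x - c) $ j)"
      using assms by (cases "j = i") (auto simp: coord_scale_def axis_def algebra_simps abs_mult mult_left_le_one_le)
  qed
  then show ?thesis using assms(1) by (simp add: dist_norm norm_minus_commute)
qed

lemma coord_scale_has_derivative: "(coord_scale i t has_derivative coord_scale i t) (at x)"
  unfolding coord_scale_def[abs_def] by (auto intro!: derivative_eq_intros bounded_linear_imp_has_derivative[OF bounded_linear_vec_nth])

text \<open>The factor \<open>t ^ m\<close>, with arbitrary \<open>m\<close>, makes the induction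
  close: differentiation under the integral in the \<open>i\<close>-th direction produces one more
  factor \<open>t\<close>.\<close>

lemma Ck_on_coord_scale_integral:
  fixes G :: "real ^ 'n \<Rightarrow> real"
  assumes c: "c $ i = 0" and G: "smooth_on (ball c r) G"
  shows "Ck_on k (ball c r) (\<lambda>x. integral {0..1} (\<lambda>t. t ^ m * G (coord_scale i t x)))"
  using G
proof (induction k arbitrary: G m)
  have cont: "continuous_on (ball c r \<times> {0..1}) (\<lambda>p. snd p ^ m * G (coord_scale i (snd p) (fst p)))"
    if "smooth_on (ball c r) G" for G :: "real ^ 'n \<Rightarrow> real" and m
  proof (intro continuous_on_mult continuous_on_compose2[OF smooth_on_continuous[OF that]])
    show "continuous_on (ball c r \<times> {0..1}) (\<lambda>p. snd p ^ m :: real)"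
      by (intro continuous_on_power continuous_on_snd continuous_on_id)
    show "continuous_on (ball c r \<times> {0..1}) (\<lambda>p. coord_scale i (snd p) (fst p))"
      unfolding coord_scale_def by (intro continuous_intros)
  qed (use c coord_scale_in_ball in auto)
  {
    case 0
    show ?case using integral_continuous_on_param[of "ball c r" 0 1 "\<lambda>x t. t ^ m * G (coord_scale i t x)"] cont[OF 0]
      by (simp add: case_prod_unfold)
  next
    case (Suc k)
    let ?e = "axis i 1 :: real ^ 'n"
    define I where "I v m x = integral {0..1} (\<lambda>t. t ^ m * fder G (coord_scale i t x) v)" for v m x
    have sG: "smooth_on (ball c r) (\<lambda>y. fder G y v)" for v using Suc.prems by (rule smooth_on_fder_const)
    have CI: "Ck_on k (ball c r) (I v m)" for v m unfolding I_def by (rule Suc.IH[OF sG])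
    have int: "(\<lambda>t. t ^ m * F (coord_scale i t x)) integrable_on {0..1}"
      if "x \<in> ball c r" "smooth_on (ball c r) F" for x F m
      by (intro integrable_continuous_interval continuous_on_compose2[OF cont[OF that(2)], where f="\<lambda>t. (x, t)", simplified])
        (use that in \<open>auto intro!: continuous_intros\<close>)
    \<comment> \<open>The Leibniz rule for integrals takes the derivative as a bounded linear map,
      jointly continuous in point and parameter.\<close>
    define D where "D x t = Blinfun (\<lambda>v. t ^ m * fder G (coord_scale i t x) (coord_scale i t v))" for x t
    have lin: "linear (fder G (coord_scale i t x))" if "x \<in> ball c r" "t \<in> {0..1}" for x t
      by (rule linear_frechet_derivative, rule smooth_on_differentiable[OF Suc.prems])
        (use that c coord_scale_in_ball in auto)
    have D: "blinfun_apply (D x t) v = t ^ m * fder G (coord_scale i t x) (coord_scale i t v)"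
      if "x \<in> ball c r" "t \<in> {0..1}" for x t v
      unfolding D_def
    proof (subst bounded_linear_Blinfun_apply)
      have "linear (coord_scale i t)" using coord_scale_has_derivative has_derivative_linear by blast
      then have "linear (\<lambda>v. t ^ m *\<^sub>R fder G (coord_scale i t x) (coord_scale i t v))"
        using linear_compose[OF _ lin[OF that]] by (intro linear_compose_scale_right) (auto simp: o_def)
      then show "bounded_linear (\<lambda>v. t ^ m * fder G (coord_scale i t x) (coord_scale i t v))"
        by (simp add: linear_conv_bounded_linear)
    qed simp
    \<comment> \<open>Expanding \<open>coord_scale i t v\<close> by linearity leaves integrands of
      the same type, with exponents \<open>m\<close> and \<open>Suc m\<close>.\<close>
    have D': "blinfun_apply (D x t) v = t ^ m * fder G (coord_scale i t x) v
        + v $ i * (t ^ Suc m * fder G (coord_scale i t x) ?e) - v $ i * (t ^ m * fder G (coord_scale i t x) ?e)"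
      if "x \<in> ball c r" "t \<in> {0..1}" for x t v
      unfolding D[OF that] coord_scale_def[of i t v] linear_add[OF lin[OF that]] linear_cmul[OF lin[OF that]]
      by (simp add: algebra_simps)
    have contD: "continuous_on (ball c r \<times> cbox 0 1) (\<lambda>(x, t). D x t)"
    proof (rule continuous_on_blinfun_componentwise)
      fix b :: "real ^ 'n"
      have "continuous_on (ball c r \<times> {0..1}) (\<lambda>p. snd p ^ m * fder G (coord_scale i (snd p) (fst p)) b
        + b $ i * (snd p ^ Suc m * fder G (coord_scale i (snd p) (fst p)) ?e) - b $ i * (snd p ^ m * fder G (coord_scale i (snd p) (fst p)) ?e))"
        by (intro continuous_on_add continuous_on_diff continuous_on_mult[OF continuous_on_const] cont sG)
      then show "continuous_on (ball c r \<times> cbox 0 1) (\<lambda>x. blinfun_apply (case x of (x, t) \<Rightarrow> D x t) b)"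
        unfolding cbox_interval by (rule continuous_on_eq) (auto simp: D')
    qed
    have der: "((\<lambda>x. integral {0..1} (\<lambda>t. t ^ m * G (coord_scale i t x))) has_derivative
        (\<lambda>v. I v m x + v $ i * I ?e (Suc m) x - v $ i * I ?e m x)) (at x)" if x: "x \<in> ball c r" for x
    proof -
      have 1: "((\<lambda>x. integral (cbox 0 1) (\<lambda>t. t ^ m * G (coord_scale i t x))) has_derivative
          blinfun_apply (integral (cbox 0 1) (D x))) (at x within ball c r)"
      proof (rule leibniz_rule[OF _ _ contD x])
        fix y t assume y: "y \<in> ball c r" and t: "t \<in> cbox 0 (1::real)"
        have t': "t \<in> {0..1}" using t by simp
        have p: "coord_scale i t y \<in> ball c r" using coord_scale_in_ball[OF y c] t by auto
        have "((\<lambda>x. t ^ m * G (coord_scale i t x)) has_derivative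
          (\<lambda>v. t ^ m * fder G (coord_scale i t y) (coord_scale i t v))) (at y)"
          by (intro has_derivative_mult_right has_derivative_compose[OF coord_scale_has_derivative]
              smooth_on_has_derivative[OF Suc.prems] p)
        then show "((\<lambda>x. t ^ m * G (coord_scale i t x)) has_derivative blinfun_apply (D y t)) (at y within ball c r)"
          unfolding D[OF y t', abs_def] by (rule has_derivative_at_withinI)
      next
        show "(\<lambda>t. t ^ m * G (coord_scale i t y)) integrable_on cbox 0 1" if "y \<in> ball c r" for y
          using int[OF that Suc.prems] by simp
      qed simp
      have Dint: "D x integrable_on {0..1}"
        by (intro integrable_continuous_interval continuous_on_compose2[OF contD, where f="\<lambda>t. (x, t)", simplified])
          (use x in \<open>auto intro!: continuous_intros\<close>)
      have "blinfun_apply (integral {0..1} (D x)) v = I v m x + v $ i * I ?e (Suc m) x - v $ i * I ?e m x" for v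
      proof -
        have "blinfun_apply (integral {0..1} (D x)) v = integral {0..1} (\<lambda>t. blinfun_apply (D x t) v)"
          by (rule blinfun_apply_integral[OF Dint])
        also have "\<dots> = integral {0..1} (\<lambda>t. t ^ m * fder G (coord_scale i t x) v
        + v $ i * (t ^ Suc m * fder G (coord_scale i t x) ?e) - v $ i * (t ^ m * fder G (coord_scale i t x) ?e))"
          by (rule integral_cong) (use D'[OF x] in simp)
        also have "\<dots> = I v m x + v $ i * I ?e (Suc m) x - v $ i * I ?e m x"
          unfolding I_def
          by (subst integral_diff integral_add integral_mult_right,
              (intro integrable_add integrable_on_mult_right int[OF x sG])+)+ simp
        finally show ?thesis .
      qed
      then have "blinfun_apply (integral {0..1} (D x)) = (\<lambda>v. I v m x + v $ i * I ?e (Suc m) x - v $ i * I ?e m x)"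
        by blast
      then show ?thesis using 1 at_within_open[OF x open_ball] by simp
    qed
    have C: "Ck_on k (ball c r) (\<lambda>x. I v m x + v $ i * I ?e (Suc m) x + - (v $ i) * I ?e m x)" for v
      by (intro Ck_on_add[OF open_ball] bounded_bilinear.Ck_on[OF bounded_bilinear_mult open_ball] Ck_on_const CI)
    have "Ck_on k (ball c r) (\<lambda>x. fder (\<lambda>x. integral {0..1} (\<lambda>t. t ^ m * G (coord_scale i t x))) x v)" for v
      by (rule Ck_on_cong[OF open_ball _ C[of v]]) (simp add: fder_eqI[OF der])
    then show ?case unfolding Ck_on.simps differentiable_def using der by blast
  }
qed

text \<open>Hadamard's lemma: near a zero of the coordinate the quotient is
  \<open>\<integral> t\<in>{0..1}. \<partial>\<^sub>i f (x with x\<^sub>i scaled by t)\<close>.\<close>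

lemma smooth_on_divide_coord:
  fixes f :: "real ^ 'n \<Rightarrow> real"
  assumes S: "open S" and f: "smooth_on S f" and z: "\<And>x. x \<in> S \<Longrightarrow> x $ i = 0 \<Longrightarrow> f x = 0"
  shows "smooth_on S (\<lambda>x. if x $ i = 0 then fder f x (axis i 1) else f x / x $ i)"
    (is "smooth_on S ?g")
proof (rule smooth_on_local)
  fix c assume c: "c \<in> S"
  show "\<exists>T. open T \<and> c \<in> T \<and> smooth_on T ?g"
  proof (cases "c $ i = 0")
    case False
    let ?T = "S \<inter> {x. x $ i \<noteq> 0}"
    have T: "open ?T" using S by (intro open_Int open_Collect_neq continuous_intros)
    have "smooth_on ?T (\<lambda>x. f x / x $ i)"
      using T smooth_on_subset[OF f] by (intro smooth_intros) auto
    then have "smooth_on ?T ?g" by (rule smooth_on_cong[OF T, rotated]) auto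
    then show ?thesis using T c False by blast
  next
    case True
    obtain r where r: "r > 0" "ball c r \<subseteq> S" using S c openE by blast
    \<comment> \<open>The exponent 0 only brings the integrand into the form of
      \<open>Ck_on_coord_scale_integral\<close>.\<close>
    let ?h = "\<lambda>x. integral {0..1} (\<lambda>t. t ^ 0 * fder f (coord_scale i t x) (axis i 1))"
    have sf: "smooth_on (ball c r) f" using smooth_on_subset[OF f r(2)] .
    have sh: "smooth_on (ball c r) ?h"
      unfolding smooth_on_def
      using Ck_on_coord_scale_integral[OF True smooth_on_fder_const[OF sf]] by blast
    have "?h x = ?g x" if x: "x \<in> ball c r" for x
    proof (cases "x $ i = 0")
      case True
      then show ?thesis by (simp add: coord_scale_fixed)
    next
      case False
      \<comment> \<open>Fundamental theorem of calculus along the path of scalings; its lower end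
        lies on the hyperplane, where \<open>f\<close> vanishes.\<close>
      have "((\<lambda>t. x $ i * fder f (coord_scale i t x) (axis i 1)) has_integral
        f (coord_scale i 1 x) - f (coord_scale i 0 x)) {0..1}"
      proof (rule fundamental_theorem_of_calculus)
        fix t :: real assume t: "t \<in> {0..1}"
        have p: "coord_scale i t x \<in> ball c r" using coord_scale_in_ball[OF x True] t by auto
        have l: "linear (fder f (coord_scale i t x))"
          by (rule linear_frechet_derivative[OF smooth_on_differentiable[OF sf p]])
        have "((\<lambda>t. coord_scale i t x) has_derivative (\<lambda>s. s *\<^sub>R (x $ i *\<^sub>R axis i 1))) (at t within {0..1})"
          unfolding coord_scale_def by (auto intro!: derivative_eq_intros)
        from has_derivative_compose[OF this smooth_on_has_derivative[OF sf p]]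
        show "((\<lambda>t. f (coord_scale i t x)) has_vector_derivative x $ i * fder f (coord_scale i t x) (axis i 1)) (at t within {0..1})"
          unfolding has_vector_derivative_def linear_cmul[OF l] by simp
      qed simp
      then have "integral {0..1} (\<lambda>t. x $ i * fder f (coord_scale i t x) (axis i 1)) =
          f (coord_scale i 1 x) - f (coord_scale i 0 x)"
        by (rule integral_unique)
      moreover have "f (coord_scale i 0 x) = 0"
        using coord_scale_in_ball[OF x True, of 0] r by (intro z) auto
      ultimately show ?thesis using False by (simp add: field_simps)
    qed
    then have "smooth_on (ball c r) ?g" by (rule smooth_on_cong[OF open_ball _ sh])
    then show ?thesis using r by (intro exI[of _ "ball c r"]) auto
  qed
qed

subsection \<open>Naturality of the exterior derivative and of the bracket\<close>

lemma linear_expand: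
  fixes g :: "'a::euclidean_space \<Rightarrow> 'b::real_vector"
  assumes "linear g" shows "g p = (\<Sum>b\<in>Basis. (p \<bullet> b) *\<^sub>R g b)"
proof -
  have "g p = g (\<Sum>b\<in>Basis. (p \<bullet> b) *\<^sub>R b)" by (simp add: euclidean_representation)
  then show ?thesis by (simp add: linear_sum[OF assms] linear_cmul[OF assms])
qed

text \<open>A basis expansion of \<open>P x\<close> reduces the moving argument to fixed vectors. In
  this way smoothness known on constant arguments only, as in \<open>smooth_form3\<close>, is
  exploited.\<close>

lemma smooth_on_linear_family:
  fixes P :: "'a::real_normed_vector \<Rightarrow> 'b::euclidean_space"
  assumes S: "open S" and P: "smooth_on S P" and g: "\<And>c. smooth_on S (\<lambda>x. g x c)"
    and l: "\<And>x. x \<in> S \<Longrightarrow> linear (g x)"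
  shows "smooth_on S (\<lambda>x. g x (P x))"
proof -
  have 1: "smooth_on S (\<lambda>x. \<Sum>b\<in>Basis. (P x \<bullet> b) *\<^sub>R g x b)"
    using S P g by (intro smooth_intros)
  show ?thesis by (rule smooth_on_cong[OF S _ 1]) (simp add: linear_expand[OF l, symmetric])
qed

text \<open>The product rule for evaluating a moving linear map at a moving vector.\<close>

lemma has_derivative_linear_family:
  fixes P :: "'a::real_normed_vector \<Rightarrow> 'b::euclidean_space"
    and g :: "'a \<Rightarrow> 'b \<Rightarrow> 'c::real_normed_vector"
  assumes S: "open S" "x \<in> S" and P: "(P has_derivative P') (at x)"
    and g: "\<And>c. ((\<lambda>y. g y c) has_derivative g' c) (at x)"
    and l: "\<And>y. y \<in> S \<Longrightarrow> linear (g y)"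
  shows "((\<lambda>y. g y (P y)) has_derivative (\<lambda>u. g' (P x) u + g x (P' u))) (at x)"
proof -
  have 1: "((\<lambda>y. g y p) has_derivative (\<lambda>u. \<Sum>b\<in>Basis. (p \<bullet> b) *\<^sub>R g' b u)) (at x)" for p
    by (rule has_derivative_transform_within_open[OF _ S, of "\<lambda>y. \<Sum>b\<in>Basis. (p \<bullet> b) *\<^sub>R g y b"])
      (auto intro!: derivative_eq_intros g linear_expand[OF l, symmetric])
  \<comment> \<open>Linearity of \<open>g'\<close> in the vector is not among the assumptions; it
    follows from uniqueness of derivatives.\<close>
  have 2: "g' p u = (\<Sum>b\<in>Basis. (p \<bullet> b) *\<^sub>R g' b u)" for p u
    using has_derivative_unique[OF g[of p] 1] by (rule fun_cong)
  have "((\<lambda>y. g y (P y)) has_derivative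
      (\<lambda>u. \<Sum>b\<in>Basis. (P x \<bullet> b) *\<^sub>R g' b u + (P' u \<bullet> b) *\<^sub>R g x b)) (at x)"
    by (rule has_derivative_transform_within_open[OF _ S, of "\<lambda>y. \<Sum>b\<in>Basis. (P y \<bullet> b) *\<^sub>R g y b"])
      (auto intro!: derivative_eq_intros P g linear_expand[OF l, symmetric])
  also have "(\<lambda>u. \<Sum>b\<in>Basis. (P x \<bullet> b) *\<^sub>R g' b u + (P' u \<bullet> b) *\<^sub>R g x b) = (\<lambda>u. g' (P x) u + g x (P' u))"
    by (simp add: sum.distrib 2[symmetric] linear_expand[OF l[OF S(2)], symmetric])
  finally show ?thesis .
qed

lemma linear_fder: "smooth_on S f \<Longrightarrow> x \<in> S \<Longrightarrow> linear (fder f x)"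
  by (intro linear_frechet_derivative smooth_on_differentiable)

lemma has_derivative_fder_apply:
  fixes f :: "'a::euclidean_space \<Rightarrow> 'b::real_normed_vector"
  assumes S: "open S" "x \<in> S" and f: "smooth_on S f" and P: "(P has_derivative P') (at x)"
  shows "((\<lambda>y. fder f y (P y)) has_derivative (\<lambda>u. fder (\<lambda>y. fder f y (P x)) x u + fder f x (P' u))) (at x)"
  using has_derivative_linear_family[OF S P smooth_on_has_derivative[OF smooth_on_fder_const[OF f] S(2)] linear_fder[OF f]]
  by simp

text \<open>Covectors are represented through the inner product.\<close>

definition dform1 :: "('a::real_inner \<Rightarrow> 'a) \<Rightarrow> 'a \<Rightarrow> 'a \<Rightarrow> 'a \<Rightarrow> real" where
  "dform1 a x u v = fder (\<lambda>y. a y \<bullet> v) x u - fder (\<lambda>y. a y \<bullet> u) x v"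

text \<open>Each half contributes a term with the second derivative of \<open>\<phi>\<close>; by
  symmetry these cancel in the difference.\<close>

lemma dform1_pullback:
  fixes \<phi> :: "'a::euclidean_space \<Rightarrow> 'b::euclidean_space"
  assumes S: "open S" "x \<in> S" and \<phi>: "smooth_on S \<phi>" and a: "a differentiable (at (\<phi> x))"
    and a': "\<And>y v. y \<in> S \<Longrightarrow> a' y \<bullet> v = a (\<phi> y) \<bullet> fder \<phi> y v"
  shows "dform1 a' x u v = dform1 a (\<phi> x) (fder \<phi> x u) (fder \<phi> x v)"
proof -
  have 1: "fder (\<lambda>y. a' y \<bullet> v) x u =
      fder a (\<phi> x) (fder \<phi> x u) \<bullet> fder \<phi> x v + a (\<phi> x) \<bullet> fder (\<lambda>y. fder \<phi> y v) x u" for u v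
  proof -
    have "((\<lambda>y. a (\<phi> y) \<bullet> fder \<phi> y v) has_derivative
      (\<lambda>u. a (\<phi> x) \<bullet> fder (\<lambda>y. fder \<phi> y v) x u + fder a (\<phi> x) (fder \<phi> x u) \<bullet> fder \<phi> x v)) (at x)"
      by (intro has_derivative_inner has_derivative_compose[where g=a and f=\<phi>, OF _ fder_works[OF a]]
          smooth_on_has_derivative[OF \<phi> S(2)] smooth_on_has_derivative[OF smooth_on_fder_const[OF \<phi>] S(2)])
    then have "((\<lambda>y. a' y \<bullet> v) has_derivative
      (\<lambda>u. a (\<phi> x) \<bullet> fder (\<lambda>y. fder \<phi> y v) x u + fder a (\<phi> x) (fder \<phi> x u) \<bullet> fder \<phi> x v)) (at x)"
      by (rule has_derivative_transform_within_open[OF _ S]) (simp add: a')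
    from fder_eqI[OF this] show ?thesis by simp
  qed
  have 2: "fder (\<lambda>y. a y \<bullet> w) (\<phi> x) z = fder a (\<phi> x) z \<bullet> w" for w z
    using fder_eqI[OF has_derivative_inner_left[OF fder_works[OF a]]] by simp
  show ?thesis unfolding dform1_def 1 2 using fder_fder_commute[OF S \<phi>] by simp
qed

definition alt3 :: "('a::real_vector \<Rightarrow> 'a \<Rightarrow> 'a \<Rightarrow> real) \<Rightarrow> bool" where
  "alt3 h \<longleftrightarrow> (\<forall>u v. linear (h u v)) \<and> (\<forall>u v. linear (\<lambda>w. h u w v)) \<and> (\<forall>u v. linear (\<lambda>w. h w u v)) \<and>
     (\<forall>u v. h u u v = 0 \<and> h u v u = 0 \<and> h v u u = 0)"

lemma alt3_linear:
  assumes "alt3 h"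
  shows "linear (h u v)" "linear (\<lambda>w. h u w v)" "linear (\<lambda>w. h w u v)"
  using assms by (auto simp: alt3_def)

text \<open>Polarisation: expand the vanishing values at the repeated arguments \<open>u + v\<close>
  and \<open>v + w\<close>.\<close>

lemma alt3_swap:
  assumes "alt3 h"
  shows "h v u w = - h u v w" "h u w v = - h u v w"
proof -
  note l = alt3_linear[OF assms, THEN linear_add]
  have "h (u + v) (u + v) w = 0" "h u u w = 0" "h v v w = 0" "h u (v + w) (v + w) = 0" "h u v v = 0" "h u w w = 0"
    using assms by (auto simp: alt3_def)
  then show "h v u w = - h u v w" "h u w v = - h u v w" by (simp_all add: l)
qed

text \<open>The invariant formula for the exterior derivative of a 3-form on constant vector fields,
  whose brackets vanish.\<close>

definition dform3 :: "('a::real_normed_vector \<Rightarrow> 'a \<Rightarrow> 'a \<Rightarrow> 'a \<Rightarrow> real) \<Rightarrow> 'a \<Rightarrow> 'a \<Rightarrow> 'a \<Rightarrow> 'a \<Rightarrow> 'a \<Rightarrow> real" where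
  "dform3 h x u0 u1 u2 u3 =
     fder (\<lambda>y. h y u1 u2 u3) x u0 - fder (\<lambda>y. h y u0 u2 u3) x u1
   + fder (\<lambda>y. h y u0 u1 u3) x u2 - fder (\<lambda>y. h y u0 u1 u2) x u3"

text \<open>The product rule gives twelve terms with second derivatives of \<open>\<phi>\<close>.
  They cancel in six pairs, because second derivatives are symmetric and \<open>h\<close>
  alternates.\<close>

lemma dform3_pullback:
  fixes \<phi> :: "'a::euclidean_space \<Rightarrow> 'b::euclidean_space"
  assumes S: "open S" "x \<in> S" and \<phi>: "smooth_on S \<phi>" and V: "\<And>y. y \<in> S \<Longrightarrow> \<phi> y \<in> V"
    and alt: "\<And>z. z \<in> V \<Longrightarrow> alt3 (h z)" and h: "\<And>u v w. smooth_on V (\<lambda>z. h z u v w)"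
    and h': "\<And>y u v w. y \<in> S \<Longrightarrow> h' y u v w = h (\<phi> y) (fder \<phi> y u) (fder \<phi> y v) (fder \<phi> y w)"
  shows "dform3 h' x u0 u1 u2 u3 = dform3 h (\<phi> x) (fder \<phi> x u0) (fder \<phi> x u1) (fder \<phi> x u2) (fder \<phi> x u3)"
proof -
  let ?D = "fder \<phi> x" and ?D2 = "\<lambda>u v. fder (\<lambda>y. fder \<phi> y u) x v"
  have dP: "((\<lambda>y. fder \<phi> y u) has_derivative ?D2 u) (at x)" for u
    by (rule smooth_on_has_derivative[OF smooth_on_fder_const[OF \<phi>] S(2)])
  have d0: "((\<lambda>y. h (\<phi> y) p q r) has_derivative (\<lambda>z. fder (\<lambda>z. h z p q r) (\<phi> x) (?D z))) (at x)" for p q r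
    by (rule has_derivative_compose[OF smooth_on_has_derivative[OF \<phi> S(2)]
          smooth_on_has_derivative[OF h V[OF S(2)], of p q r]])
  note l = alt3_linear[OF alt[OF V]]
  \<comment> \<open>Constant arguments are replaced by moving ones, one at a time, each time by the
    product rule for linear families.\<close>
  have d1: "((\<lambda>y. h (\<phi> y) (fder \<phi> y u) q r) has_derivative
      (\<lambda>z. fder (\<lambda>z. h z (?D u) q r) (\<phi> x) (?D z) + h (\<phi> x) (?D2 u z) q r)) (at x)" for u q r
    by (rule has_derivative_linear_family[where g = "\<lambda>y p. h (\<phi> y) p q r", OF S dP d0]) (rule l)
  have d2: "((\<lambda>y. h (\<phi> y) (fder \<phi> y u) (fder \<phi> y v) r) has_derivative
      (\<lambda>z. (fder (\<lambda>z. h z (?D u) (?D v) r) (\<phi> x) (?D z) + h (\<phi> x) (?D2 u z) (?D v) r)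
        + h (\<phi> x) (?D u) (?D2 v z) r)) (at x)" for u v r
    by (rule has_derivative_linear_family[where g = "\<lambda>y q. h (\<phi> y) (fder \<phi> y u) q r", OF S dP d1]) (rule l)
  have d3: "((\<lambda>y. h (\<phi> y) (fder \<phi> y u) (fder \<phi> y v) (fder \<phi> y w)) has_derivative
      (\<lambda>z. (fder (\<lambda>z. h z (?D u) (?D v) (?D w)) (\<phi> x) (?D z) + h (\<phi> x) (?D2 u z) (?D v) (?D w)
        + h (\<phi> x) (?D u) (?D2 v z) (?D w)) + h (\<phi> x) (?D u) (?D v) (?D2 w z))) (at x)" for u v w
    by (rule has_derivative_linear_family[where g = "\<lambda>y r. h (\<phi> y) (fder \<phi> y u) (fder \<phi> y v) r", OF S dP d2]) (rule l)
  have d4: "fder (\<lambda>y. h' y u v w) x z = fder (\<lambda>z. h z (?D u) (?D v) (?D w)) (\<phi> x) (?D z) + h (\<phi> x) (?D2 u z) (?D v) (?D w)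
        + h (\<phi> x) (?D u) (?D2 v z) (?D w) + h (\<phi> x) (?D u) (?D v) (?D2 w z)" for u v w z
    using fder_eqI[OF has_derivative_transform_within_open[OF d3 S h'[symmetric]]] by simp
  have sym: "?D2 u v = ?D2 v u" for u v by (rule fder_fder_commute[OF S \<phi>])
  note sw = alt3_swap[OF alt[OF V[OF S(2)]]]
  have 1: "h (\<phi> x) p s q = - h (\<phi> x) s p q" "h (\<phi> x) p q s = h (\<phi> x) s p q" for p q s
    by (rule sw(1), metis sw minus_minus)
  show ?thesis unfolding dform3_def d4
      sym[of u1 u0] sym[of u2 u0] sym[of u3 u0] sym[of u2 u1] sym[of u3 u1] sym[of u3 u2]
      1(1)[of "?D u1" "?D2 u0 u2" "?D u3"] 1(2)[of "?D u1" "?D u2" "?D2 u0 u3"]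
      sw(2)[of "?D u0" "?D u2" "?D2 u1 u3"] by linarith
qed

text \<open>Differentiating the relation between the fields produces second derivatives of
  \<open>\<phi>\<close> in the directions \<open>X x\<close> and \<open>Y x\<close>; they cancel in
  the commutator.\<close>

lemma lie_bracket_pushforward:
  fixes \<phi> :: "'a::euclidean_space \<Rightarrow> 'b::euclidean_space"
  assumes S: "open S" "x \<in> S" and \<phi>: "smooth_on S \<phi>"
    and d: "X differentiable (at x)" "Y differentiable (at x)"
      "X' differentiable (at (\<phi> x))" "Y' differentiable (at (\<phi> x))"
    and X: "\<And>y. y \<in> S \<Longrightarrow> X' (\<phi> y) = fder \<phi> y (X y)"
    and Y: "\<And>y. y \<in> S \<Longrightarrow> Y' (\<phi> y) = fder \<phi> y (Y y)"
  shows "fder Y' (\<phi> x) (X' (\<phi> x)) - fder X' (\<phi> x) (Y' (\<phi> x)) =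
    fder \<phi> x (fder Y x (X x) - fder X x (Y x))"
proof -
  have 1: "fder Z' (\<phi> x) (fder \<phi> x u) = fder (\<lambda>y. fder \<phi> y (Z x)) x u + fder \<phi> x (fder Z x u)"
    if Z: "Z differentiable (at x)" "Z' differentiable (at (\<phi> x))"
      and eq: "\<And>y. y \<in> S \<Longrightarrow> Z' (\<phi> y) = fder \<phi> y (Z y)" for Z Z' u
  proof -
    have "((\<lambda>y. Z' (\<phi> y)) has_derivative (\<lambda>u. fder (\<lambda>y. fder \<phi> y (Z x)) x u + fder \<phi> x (fder Z x u))) (at x)"
      by (rule has_derivative_transform_within_open[OF has_derivative_fder_apply[OF S \<phi> fder_works[OF Z(1)]] S])
        (simp add: eq)
    from has_derivative_unique[OF has_derivative_compose[OF smooth_on_has_derivative[OF \<phi> S(2)] fder_works[OF Z(2)]] this]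
    show ?thesis by (rule fun_cong)
  qed
  show ?thesis
    using 1[OF d(2,4) Y, of "X x"] 1[OF d(1,3) X, of "Y x"] fder_fder_commute[OF S \<phi>, of "X x" "Y x"]
    by (simp add: X[OF S(2)] Y[OF S(2)] linear_diff[OF linear_fder[OF \<phi> S(2)]])
qed

section \<open>The twisted Courant bracket in coordinates\<close>

definition bracket_vec :: "('a::real_inner \<Rightarrow> 'a \<times> 'a) \<Rightarrow> ('a \<Rightarrow> 'a \<times> 'a) \<Rightarrow> 'a \<Rightarrow> 'a" where
  "bracket_vec s t x = fder (\<lambda>y. fst (t y)) x (fst (s x)) - fder (\<lambda>y. fst (s y)) x (fst (t x))"

text \<open>The covector part evaluated on \<open>v\<close>: the first two terms form the Lie
  derivative by Cartan's formula, the last is the contraction \<open>i_Y i_X H\<close>.\<close>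

definition bracket_form :: "('a \<Rightarrow> 'a \<Rightarrow> 'a \<Rightarrow> 'a \<Rightarrow> real) \<Rightarrow> ('a::real_inner \<Rightarrow> 'a \<times> 'a) \<Rightarrow> ('a \<Rightarrow> 'a \<times> 'a) \<Rightarrow> 'a \<Rightarrow> 'a \<Rightarrow> real" where
  "bracket_form h s t x v = fder (\<lambda>y. snd (t y) \<bullet> fst (s y)) x v + dform1 (\<lambda>y. snd (t y)) x (fst (s x)) v
     - dform1 (\<lambda>y. snd (s y)) x (fst (t x)) v + h x (fst (s x)) (fst (t x)) v"

text \<open>Vectors are pushed forward and covectors pulled back. For a change of charts
  \<open>\<phi>\<close> this says that two representatives belong to one section.\<close>

definition related :: "('a \<Rightarrow> 'b) \<Rightarrow> 'a set \<Rightarrow> ('a::real_inner \<Rightarrow> 'a \<times> 'a) \<Rightarrow> ('b::real_inner \<Rightarrow> 'b \<times> 'b) \<Rightarrow> bool" where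
  "related \<phi> S s s' \<longleftrightarrow> (\<forall>y\<in>S. fst (s' (\<phi> y)) = fder \<phi> y (fst (s y)) \<and>
     (\<forall>v. snd (s y) \<bullet> v = snd (s' (\<phi> y)) \<bullet> fder \<phi> y v))"

lemma differentiable_fst: "f differentiable F \<Longrightarrow> (\<lambda>x. fst (f x)) differentiable F"
  unfolding differentiable_def using has_derivative_fst by blast

lemma differentiable_snd: "f differentiable F \<Longrightarrow> (\<lambda>x. snd (f x)) differentiable F"
  unfolding differentiable_def using has_derivative_snd by blast

text \<open>Naturality holds term by term: for the Lie bracket, the exterior derivatives, the
  differential of the contraction of form and vector, and the twist.\<close>

lemma bracket_related:
  fixes \<phi> :: "'a::euclidean_space \<Rightarrow> 'b::euclidean_space"
  assumes S: "open S" "x \<in> S" and \<phi>: "smooth_on S \<phi>"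
    and d: "s differentiable (at x)" "t differentiable (at x)"
      "s' differentiable (at (\<phi> x))" "t' differentiable (at (\<phi> x))"
    and rel: "related \<phi> S s s'" "related \<phi> S t t'"
    and h: "\<And>u v w. h x u v w = h' (\<phi> x) (fder \<phi> x u) (fder \<phi> x v) (fder \<phi> x w)"
  shows "bracket_vec s' t' (\<phi> x) = fder \<phi> x (bracket_vec s t x)"
    and "bracket_form h s t x v = bracket_form h' s' t' (\<phi> x) (fder \<phi> x v)"
proof -
  note d1 = d[THEN differentiable_fst] and d2 = d[THEN differentiable_snd]
  have f: "fst (s' (\<phi> y)) = fder \<phi> y (fst (s y))" "fst (t' (\<phi> y)) = fder \<phi> y (fst (t y))" if "y \<in> S" for y
    using rel that by (auto simp: related_def)
  have g: "snd (s y) \<bullet> v = snd (s' (\<phi> y)) \<bullet> fder \<phi> y v" "snd (t y) \<bullet> v = snd (t' (\<phi> y)) \<bullet> fder \<phi> y v"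
    if "y \<in> S" for y v
    using rel that by (auto simp: related_def)
  show "bracket_vec s' t' (\<phi> x) = fder \<phi> x (bracket_vec s t x)"
    unfolding bracket_vec_def by (rule lie_bracket_pushforward[OF S \<phi> d1 f])
  have 1: "dform1 (\<lambda>y. snd (t y)) x u v = dform1 (\<lambda>y. snd (t' y)) (\<phi> x) (fder \<phi> x u) (fder \<phi> x v)" for u v
    by (rule dform1_pullback[OF S \<phi> d2(4) g(2)])
  have 2: "dform1 (\<lambda>y. snd (s y)) x u v = dform1 (\<lambda>y. snd (s' y)) (\<phi> x) (fder \<phi> x u) (fder \<phi> x v)" for u v
    by (rule dform1_pullback[OF S \<phi> d2(3) g(1)])
  have dd: "(\<lambda>z. snd (t' z) \<bullet> fst (s' z)) differentiable (at (\<phi> x))"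
    using has_derivative_inner[OF fder_works[OF d2(4)] fder_works[OF d1(3)]] unfolding differentiable_def by blast
  have "((\<lambda>y. snd (t y) \<bullet> fst (s y)) has_derivative
      (\<lambda>v. fder (\<lambda>z. snd (t' z) \<bullet> fst (s' z)) (\<phi> x) (fder \<phi> x v))) (at x)"
    by (rule has_derivative_transform_within_open[OF has_derivative_compose[OF
            smooth_on_has_derivative[OF \<phi> S(2)] fder_works[OF dd]] S]) (simp add: f g)
  from fder_eqI[OF this] show "bracket_form h s t x v = bracket_form h' s' t' (\<phi> x) (fder \<phi> x v)"
    unfolding bracket_form_def 1 2 h f[OF S(2)] by simp
qed

lemma smooth_on_dform1 [smooth_intros]:
  fixes a :: "'a::euclidean_space \<Rightarrow> 'a"
  assumes "open S" "smooth_on S a" "smooth_on S X"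
  shows "smooth_on S (\<lambda>x. dform1 a x (X x) v)"
proof -
  have 1: "smooth_on S (\<lambda>y. a y \<bullet> v)" for v using assms by (intro smooth_intros)
  \<comment> \<open>The second half of \<open>dform1\<close> freezes the vector inside a derivative;
    once moved outside, it may vary smoothly with \<open>x\<close>.\<close>
  have 2: "dform1 a x w v = fder (\<lambda>y. a y \<bullet> v) x w - fder (\<lambda>y. a y) x v \<bullet> w" if "x \<in> S" for x w
    unfolding dform1_def
    using fder_eqI[OF has_derivative_inner_left[OF smooth_on_has_derivative[OF assms(2) that]]] by simp
  have 3: "smooth_on S (\<lambda>x. fder (\<lambda>y. a y \<bullet> v) x (X x) - fder (\<lambda>y. a y) x v \<bullet> X x)"
    using assms 1 by (intro smooth_intros smooth_on_fder_const) auto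
  show ?thesis by (rule smooth_on_cong[OF assms(1) _ 3]) (simp add: 2)
qed

text \<open>Smoothness is given for constant arguments; these are freed one at a time.\<close>

lemma smooth_on_alt3:
  fixes X Y Z :: "'a::real_normed_vector \<Rightarrow> 'b::euclidean_space"
  assumes S: "open S" and alt: "\<And>x. x \<in> S \<Longrightarrow> alt3 (h x)"
    and h: "\<And>u v w. smooth_on S (\<lambda>x. h x u v w)"
    and X: "smooth_on S X" "smooth_on S Y" "smooth_on S Z"
  shows "smooth_on S (\<lambda>x. h x (X x) (Y x) (Z x))"
proof -
  note l = alt3_linear[OF alt]
  have 1: "smooth_on S (\<lambda>x. h x (X x) v w)" for v w
    by (rule smooth_on_linear_family[OF S X(1), where g = "\<lambda>x u. h x u v w"]) (use h l in auto)
  have 2: "smooth_on S (\<lambda>x. h x (X x) (Y x) w)" for w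
    by (rule smooth_on_linear_family[OF S X(2), where g = "\<lambda>x v. h x (X x) v w"]) (use 1 l in auto)
  show ?thesis
    by (rule smooth_on_linear_family[OF S X(3), where g = "\<lambda>x w. h x (X x) (Y x) w"]) (use 2 l in auto)
qed

lemma smooth_on_bracket:
  fixes s t :: "'a::euclidean_space \<Rightarrow> 'a \<times> 'a"
  assumes S: "open S" and s: "smooth_on S s" "smooth_on S t" and alt: "\<And>x. x \<in> S \<Longrightarrow> alt3 (h x)"
    and h: "\<And>u v w. smooth_on S (\<lambda>x. h x u v w)"
  shows "smooth_on S (bracket_vec s t)" "smooth_on S (\<lambda>x. bracket_form h s t x v)"
proof -
  have f: "smooth_on S (\<lambda>x. fst (s x))" "smooth_on S (\<lambda>x. fst (t x))"
    "smooth_on S (\<lambda>x. snd (s x))" "smooth_on S (\<lambda>x. snd (t x))"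
    by (rule smooth_on_fst[OF S s(1)] smooth_on_fst[OF S s(2)] smooth_on_snd[OF S s(1)] smooth_on_snd[OF S s(2)])+
  show "smooth_on S (bracket_vec s t)" unfolding bracket_vec_def[abs_def] using S f s by (intro smooth_intros)
  have "smooth_on S (\<lambda>x. snd (t x) \<bullet> fst (s x))" using S s by (intro smooth_intros)
  then show "smooth_on S (\<lambda>x. bracket_form h s t x v)"
    unfolding bracket_form_def
    by (intro smooth_on_add[OF S] smooth_on_diff[OF S] smooth_on_dform1[OF S] smooth_on_fder_const f
        smooth_on_alt3[OF S alt h f(1,2) smooth_on_const])
qed

lemma linear_bracket_form:
  fixes s t :: "'a::euclidean_space \<Rightarrow> 'a \<times> 'a"
  assumes d: "s differentiable (at x)" "t differentiable (at x)" and h: "alt3 (h x)"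
  shows "linear (bracket_form h s t x)"
proof -
  note d1 = d[THEN differentiable_fst] and d2 = d[THEN differentiable_snd]
  have "(\<lambda>z. snd (t z) \<bullet> fst (s z)) differentiable (at x)"
    using has_derivative_inner[OF fder_works[OF d2(2)] fder_works[OF d1(1)]] unfolding differentiable_def by blast
  then have 1: "linear (\<lambda>v. fder (\<lambda>z. snd (t z) \<bullet> fst (s z)) x v)" by (rule linear_frechet_derivative)
  have 2: "linear (\<lambda>v. dform1 a x w v)" if "a differentiable (at x)" for a :: "'a \<Rightarrow> 'a" and w
  proof -
    have e: "fder (\<lambda>y. a y \<bullet> v) x w = fder a x w \<bullet> v" for v w
      using fder_eqI[OF has_derivative_inner_left[OF fder_works[OF that]]] by simp
    show ?thesis unfolding dform1_def e
      by (rule linearI) (simp_all add: linear_add[OF linear_frechet_derivative[OF that]]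
          linear_cmul[OF linear_frechet_derivative[OF that]] inner_add algebra_simps)
  qed
  show ?thesis unfolding bracket_form_def[abs_def]
    by (rule linear_compose_add[OF linear_compose_sub[OF linear_compose_add[OF 1 2[OF d2(2)]] 2[OF d2(1)]] alt3_linear(1)[OF h]])
qed

section \<open>Lagrangian subspaces\<close>

text \<open>Twice the pairing in the coordinates of a chart, a form of signature (n, n).\<close>

definition qform :: "(real ^ 'n) \<times> (real ^ 'n) \<Rightarrow> (real ^ 'n) \<times> (real ^ 'n) \<Rightarrow> real" where
  "qform s t = snd s \<bullet> fst t + snd t \<bullet> fst s"

text \<open>Being one's own orthogonal complement comprises linearity, isotropy and maximality, and
  it turns membership into equations.\<close>

definition lagrangian :: "((real ^ 'n) \<times> (real ^ 'n)) set \<Rightarrow> bool" where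
  "lagrangian K \<longleftrightarrow> (\<forall>s. s \<in> K \<longleftrightarrow> (\<forall>t\<in>K. qform s t = 0))"

lemma qform_add: "qform (s + s') t = qform s t + qform s' t" "qform t (s + s') = qform t s + qform t s'"
  by (simp_all add: qform_def inner_add)

lemma qform_scaleR: "qform (r *\<^sub>R s) t = r * qform s t" "qform t (r *\<^sub>R s) = r * qform t s"
  by (simp_all add: qform_def algebra_simps)

lemma qform_sym: "qform s t = qform t s"
  by (simp add: qform_def)

lemma qform_zero [simp]: "qform 0 t = 0" "qform t 0 = 0"
  by (simp_all add: qform_def)

lemma subspace_qform_perp: "subspace {s. \<forall>t\<in>K. qform s t = 0}"
  by (rule subspaceI) (auto simp: qform_add qform_scaleR)

lemma smooth_on_qform [smooth_intros]:
  fixes f g :: "'a::real_normed_vector \<Rightarrow> (real ^ 'n) \<times> (real ^ 'n)"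
  assumes "open S" "smooth_on S f" "smooth_on S g" shows "smooth_on S (\<lambda>x. qform (f x) (g x))"
  unfolding qform_def using assms by (intro smooth_intros)

lemma lagrangian_subspace: "lagrangian K \<Longrightarrow> subspace K"
proof -
  assume "lagrangian K"
  then have "{s. \<forall>t\<in>K. qform s t = 0} = K" unfolding lagrangian_def by blast
  then show ?thesis using subspace_qform_perp[of K] by simp
qed

lemma lagrangian_isotropic: "lagrangian K \<Longrightarrow> s \<in> K \<Longrightarrow> t \<in> K \<Longrightarrow> qform s t = 0"
  unfolding lagrangian_def by blast

text \<open>Up to swapping the two factors the form is the inner product, so its orthogonal
  complement is the Euclidean one of the swapped space.\<close>

lemma dim_qform_perp:
  fixes K :: "((real ^ 'n) \<times> (real ^ 'n)) set"
  assumes K: "subspace K"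
  shows "dim {s. \<forall>t\<in>K. qform s t = 0} + dim K = 2 * CARD('n)"
proof -
  let ?J = "\<lambda>s :: (real ^ 'n) \<times> (real ^ 'n). (snd s, fst s)"
  have J: "linear ?J" by (rule linearI) auto
  have "dim {y \<in> UNIV. \<forall>x\<in>?J ` K. orthogonal x y} + dim (?J ` K) = dim (UNIV :: ((real ^ 'n) \<times> (real ^ 'n)) set)"
    by (rule dim_subspace_orthogonal_to_vectors) (auto intro: linear_subspace_image[OF J K])
  moreover have "{y \<in> UNIV. \<forall>x\<in>?J ` K. orthogonal x y} = {s. \<forall>t\<in>K. qform s t = 0}"
    by (auto simp: orthogonal_def qform_def inner_commute add.commute)
  moreover have "dim (?J ` K) = dim K" by (rule dim_image_eq[OF J]) (auto intro: inj_onI)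
  ultimately show ?thesis by simp
qed

lemma lagrangian_dim:
  fixes K :: "((real ^ 'n) \<times> (real ^ 'n)) set"
  assumes "lagrangian K" shows "dim K = CARD('n)"
proof -
  have "{s. \<forall>t\<in>K. qform s t = 0} = K" using assms unfolding lagrangian_def by blast
  then show ?thesis using dim_qform_perp[OF lagrangian_subspace[OF assms]] by simp
qed

lemma lagrangian_maximal:
  assumes "lagrangian K" "K \<subseteq> K'" "\<And>s t. s \<in> K' \<Longrightarrow> t \<in> K' \<Longrightarrow> qform s t = 0"
  shows "K' = K"
  using assms unfolding lagrangian_def by blast

text \<open>The diagonal and the antidiagonal are \<open>n\<close>-dimensional subspaces on which the form is positive
  and negative definite. If the orthogonal complement of \<open>K\<close> is larger than \<open>K\<close>, it meets both of
  them, and a suitable combination of the two vectors found is isotropic.\<close>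

lemma maximal_isotropic_lagrangian:
  fixes K :: "((real ^ 'n) \<times> (real ^ 'n)) set"
  assumes iso: "\<And>s t. s \<in> K \<Longrightarrow> t \<in> K \<Longrightarrow> qform s t = 0"
    and max: "\<And>K'. K \<subseteq> K' \<Longrightarrow> (\<And>s t. s \<in> K' \<Longrightarrow> t \<in> K' \<Longrightarrow> qform s t = 0) \<Longrightarrow> K' = K"
  shows "lagrangian K"
proof -
  let ?P = "{s. \<forall>t\<in>K. qform s t = 0}"
  \<comment> \<open>Maximality is among sets, so it applies to \<open>K\<close> enlarged by a single
    null vector orthogonal to \<open>K\<close>; linearity of \<open>K\<close> is a
    consequence.\<close>
  have add: "s \<in> K" if "\<And>t. t \<in> K \<Longrightarrow> qform s t = 0" "qform s s = 0" for s
  proof -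
    have "insert s K = K"
    proof (rule max)
      fix a b assume "a \<in> insert s K" "b \<in> insert s K"
      then show "qform a b = 0" by (metis insertE that iso qform_sym)
    qed blast
    then show ?thesis by blast
  qed
  have sub: "subspace K"
  proof (rule subspaceI)
    show "0 \<in> K" by (rule add) auto
    show "x + y \<in> K" if "x \<in> K" "y \<in> K" for x y
      by (rule add) (use that iso in \<open>auto simp: qform_add\<close>)
    show "r *\<^sub>R x \<in> K" if "x \<in> K" for r x
      by (rule add) (use that iso in \<open>auto simp: qform_scaleR\<close>)
  qed
  note dims = dim_qform_perp[OF sub]
  have KP: "K \<subseteq> ?P" using iso by blast
  have "CARD('n) \<le> dim K"
  proof (rule ccontr)
    assume "\<not> CARD('n) \<le> dim K"
    then have big: "dim ?P > CARD('n)" using dims by linarith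
    \<comment> \<open>Dimension count with the graph of multiplication by \<open>c\<close>: more
      than n plus exactly n exceeds 2n. The diagonal is \<open>c = 1\<close>, the antidiagonal
      \<open>c = -1\<close>.\<close>
    have meet: "\<exists>u. u \<noteq> 0 \<and> (u, c *\<^sub>R u) \<in> ?P" for c :: real
    proof -
      let ?G = "(\<lambda>u :: real ^ 'n. (u, c *\<^sub>R u))"
      have lG: "linear ?G" by (rule linearI) (auto simp: algebra_simps)
      have sG: "subspace (range ?G)" by (rule linear_subspace_image[OF lG subspace_UNIV])
      have dG: "dim (range ?G) = CARD('n)"
        using dim_image_eq[OF lG, of UNIV] by (auto intro: inj_onI)
      have "dim {x + y |x y. x \<in> ?P \<and> y \<in> range ?G} \<le> 2 * CARD('n)"
        using dim_subset_UNIV[of "{x + y |x y. x \<in> ?P \<and> y \<in> range ?G}"] by simp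
      then have "dim (?P \<inter> range ?G) > 0"
        using dim_sums_Int[OF subspace_qform_perp sG, of K] big dG by linarith
      then have "\<not> ?P \<inter> range ?G \<subseteq> {0}" unfolding dim_eq_0[symmetric] by (rule gr_implies_not0)
      then obtain u where "(u, c *\<^sub>R u) \<in> ?P" "(u, c *\<^sub>R u) \<noteq> 0" by blast
      then show ?thesis by (intro exI[of _ u]) (auto simp: zero_prod_def)
    qed
    obtain u where u: "u \<noteq> 0" "(u, 1 *\<^sub>R u) \<in> ?P" using meet by blast
    obtain v where v: "v \<noteq> 0" "(v, (- 1) *\<^sub>R v) \<in> ?P" using meet by blast
    \<comment> \<open>The two vectors are orthogonal for \<open>qform\<close> and have squares of
      opposite sign; the ratio of norms makes the squares cancel.\<close>
    define s where "s = (u, u) + (norm u / norm v) *\<^sub>R (v, - v)"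
    have uP: "(u, u) \<in> ?P" using u by simp
    have vP: "(v, - v) \<in> ?P" using v by simp
    have "s \<in> ?P" unfolding s_def
      by (rule subspace_add[OF subspace_qform_perp uP subspace_scale[OF subspace_qform_perp vP]])
    moreover have "qform s s = 0"
    proof -
      have "qform s s = 2 * (u \<bullet> u) - 2 * ((norm u / norm v) * (norm u / norm v) * (v \<bullet> v))"
        unfolding s_def by (simp add: qform_def inner_commute algebra_simps)
      also have "(norm u / norm v) * (norm u / norm v) * (v \<bullet> v) = u \<bullet> u"
        using v by (simp add: dot_square_norm power2_eq_square)
      finally show ?thesis by simp
    qed
    ultimately have "s \<in> K" by (intro add) auto
    then have "qform (u, u) s = 0" using uP by blast
    moreover have "qform (u, u) s = 2 * (u \<bullet> u)"
      unfolding s_def by (simp add: qform_def inner_commute algebra_simps)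
    ultimately show False using u by simp
  qed
  then have "K = ?P" using subspace_dim_equal[OF sub subspace_qform_perp KP] dims by linarith
  then show ?thesis unfolding lagrangian_def by blast
qed

definition transpose_map :: "(real ^ 'm \<Rightarrow> real ^ 'n) \<Rightarrow> real ^ 'n \<Rightarrow> real ^ 'm" where
  "transpose_map A a = (\<chi> i. a \<bullet> A (axis i 1))"

lemma inner_transpose_map:
  assumes "linear A" shows "transpose_map A a \<bullet> w = a \<bullet> A w"
proof -
  have "A w = A (\<Sum>i\<in>UNIV. w $ i *\<^sub>R axis i 1)" by (simp add: vec_sum_axis[symmetric])
  also have "\<dots> = (\<Sum>i\<in>UNIV. w $ i *\<^sub>R A (axis i 1))"
    by (simp add: linear_sum[OF assms] linear_cmul[OF assms])
  finally show ?thesis by (simp add: transpose_map_def inner_vec_def[of "\<chi> i. _ i"] inner_sum_right mult.commute)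
qed

text \<open>The backward image of linear algebra; \<open>backward_image\<close> takes this form in
  charts, with a derivative for \<open>A\<close>.\<close>

definition pull :: "(real ^ 'm \<Rightarrow> real ^ 'n) \<Rightarrow> ((real ^ 'n) \<times> (real ^ 'n)) set \<Rightarrow> ((real ^ 'm) \<times> (real ^ 'm)) set" where
  "pull A K = {(w, transpose_map A a) | w a. (A w, a) \<in> K}"

text \<open>A functional vanishing on the kernel of the map \<open>(w, l) \<mapsto> A w + fst l\<close> factors through it.\<close>

lemma lagrangian_pull:
  fixes A :: "real ^ 'm \<Rightarrow> real ^ 'n"
  assumes A: "linear A" and K: "lagrangian K" and surj: "\<And>u. \<exists>w. \<exists>l\<in>K. u = A w + fst l"
  shows "lagrangian (pull A K)"
  unfolding lagrangian_def
proof (intro allI iffI ballI)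
  fix s t assume "s \<in> pull A K" "t \<in> pull A K"
  then obtain w a w' a' where "s = (w, transpose_map A a)" "t = (w', transpose_map A a')" "(A w, a) \<in> K" "(A w', a') \<in> K"
    by (auto simp: pull_def)
  then show "qform s t = 0"
    using lagrangian_isotropic[OF K, of "(A w, a)" "(A w', a')"] by (simp add: qform_def inner_transpose_map[OF A])
next
  fix s assume *: "\<forall>t\<in>pull A K. qform s t = 0"
  obtain w b where s: "s = (w, b)" by (cases s)
  \<comment> \<open>Preimages of the standard basis provide a linear right inverse of
    \<open>(w, l) \<mapsto> A w + fst l\<close>.\<close>
  have "\<exists>w. \<exists>l\<in>K. axis i 1 = A w + fst l" for i using surj by blast
  then obtain W l where Wl: "\<And>i. l i \<in> K" "\<And>i. axis i 1 = A (W i) + fst (l i)" by metis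
  \<comment> \<open>The functional
    \<open>(w', k) \<mapsto> b \<bullet> w' - snd k \<bullet> A w\<close> on the chosen preimages:
    these are the components of the covector to which it descends.\<close>
  define c :: "real ^ 'n" where "c = (\<chi> i. b \<bullet> W i - snd (l i) \<bullet> A w)"
  have key: "b \<bullet> w' - snd k \<bullet> A w = c \<bullet> (A w' + fst k)" if k: "k \<in> K" for w' k
  proof -
    let ?z = "A w' + fst k"
    \<comment> \<open>Subtracting the chosen preimage of \<open>?z\<close> leaves an element of the
      kernel. It yields an element of \<open>pull A K\<close>, on which the functional
      vanishes.\<close>
    define w0 where "w0 = w' - (\<Sum>i\<in>UNIV. ?z $ i *\<^sub>R W i)"
    define k0 where "k0 = k - (\<Sum>i\<in>UNIV. ?z $ i *\<^sub>R l i)"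
    have k0: "- k0 \<in> K" unfolding k0_def
      using lagrangian_subspace[OF K] k Wl(1)
      by (intro subspace_neg subspace_diff subspace_sum subspace_scale) auto
    have "(\<Sum>i\<in>UNIV. ?z $ i *\<^sub>R A (W i)) + (\<Sum>i\<in>UNIV. ?z $ i *\<^sub>R fst (l i)) = ?z"
      by (simp only: sum.distrib[symmetric] scaleR_add_right[symmetric] Wl(2)[symmetric] vec_sum_axis[symmetric] vec_lambda_eta)
    moreover have "A w0 = A w' - (\<Sum>i\<in>UNIV. ?z $ i *\<^sub>R A (W i))"
      by (simp only: w0_def linear_diff[OF A] linear_sum[OF A] linear_cmul[OF A])
    moreover have "fst k0 = fst k - (\<Sum>i\<in>UNIV. ?z $ i *\<^sub>R fst (l i))"
      by (simp add: k0_def fst_sum)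
    ultimately have "A w0 + fst k0 = 0" by (metis (no_types, lifting) add_diff_eq diff_add_eq diff_diff_add diff_self)
    then have "A w0 = fst (- k0)" by (simp add: eq_neg_iff_add_eq_0)
    then have "(w0, transpose_map A (- snd k0)) \<in> pull A K"
      using k0 unfolding pull_def by (cases k0) auto
    then have "b \<bullet> w0 - snd k0 \<bullet> A w = 0"
      using * unfolding s by (auto simp: qform_def inner_transpose_map[OF A])
    moreover have "b \<bullet> w0 = b \<bullet> w' - (\<Sum>i\<in>UNIV. ?z $ i * (b \<bullet> W i))"
      by (simp add: w0_def inner_diff_right inner_sum_right)
    moreover have "snd k0 \<bullet> A w = snd k \<bullet> A w - (\<Sum>i\<in>UNIV. ?z $ i * (snd (l i) \<bullet> A w))"
      by (simp add: k0_def snd_sum inner_diff_left inner_sum_left)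
    moreover have "c \<bullet> ?z = (\<Sum>i\<in>UNIV. ?z $ i * (b \<bullet> W i)) - (\<Sum>i\<in>UNIV. ?z $ i * (snd (l i) \<bullet> A w))"
    proof -
      have "c \<bullet> ?z = (\<Sum>i\<in>UNIV. c $ i * ?z $ i)" by (simp only: inner_vec_def inner_real_def)
      then show ?thesis
        by (simp only: c_def vec_lambda_beta left_diff_distrib sum_subtractf mult.commute[of "?z $ _"])
    qed
    ultimately show ?thesis by simp
  qed
  have K0: "0 \<in> K" using lagrangian_subspace[OF K] by (rule subspace_0)
  have "b \<bullet> w' = transpose_map A c \<bullet> w'" for w'
    using key[OF K0, of w'] by (simp add: inner_transpose_map[OF A])
  then have b: "b = transpose_map A c" by (metis vector_eq_rdot)
  have "qform (A w, c) k = 0" if "k \<in> K" for k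
    using key[OF that, of 0] by (simp add: qform_def linear_0[OF A])
  then have "(A w, c) \<in> K" using K unfolding lagrangian_def by blast
  then show "s \<in> pull A K" unfolding s b pull_def by blast
qed

section \<open>Smooth families of Lagrangian subspaces\<close>

text \<open>Smoothness of a family expressed without frames. It passes through backward images more
  easily than frames do, and \<open>smooth_frame\<close> recovers these.\<close>

definition has_sections :: "(real ^ 'n \<Rightarrow> ((real ^ 'm) \<times> (real ^ 'm)) set) \<Rightarrow> real ^ 'n \<Rightarrow> bool" where
  "has_sections K x \<longleftrightarrow> (\<forall>k\<in>K x. \<exists>S s. open S \<and> x \<in> S \<and> smooth_on S s \<and> s x = k \<and> (\<forall>y\<in>S. s y \<in> K y))"

text \<open>Non-vanishing of a determinant is an open condition, so independence certified in this
  way at one point persists nearby.\<close>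

lemma independent_by_matrix:
  fixes e :: "'n::finite \<Rightarrow> 'b::real_vector" and T :: "'b \<Rightarrow> real ^ 'n"
  assumes T: "linear T" and d: "det (\<chi> i j. T (e j) $ i) \<noteq> 0"
  shows "inj e" "independent (range e)"
proof -
  let ?A = "(\<chi> i j. T (e j) $ i) :: real ^ 'n ^ 'n"
  have zero: "c = 0" if "(\<Sum>j\<in>UNIV. c $ j *\<^sub>R e j) = 0" for c :: "real ^ 'n"
  proof -
    have "T (\<Sum>j\<in>UNIV. c $ j *\<^sub>R e j) = ?A *v c"
      by (simp add: linear_sum[OF T] linear_cmul[OF T] vec_eq_iff matrix_vector_mult_def mult.commute)
    then have "?A *v c = 0" using that by (simp add: linear_0[OF T])
    then show ?thesis using d by (metis invertible_det_nz invertible_left_inverse matrix_left_invertible_ker)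
  qed
  show inj: "inj e"
  proof (rule injI, rule ccontr)
    fix i j assume ij: "e i = e j" "i \<noteq> j"
    have "(\<Sum>k\<in>UNIV. (axis i 1 - axis j 1 :: real ^ 'n) $ k *\<^sub>R e k) = e i - e j"
      by (simp add: axis_def algebra_simps sum_subtractf if_distrib[of "\<lambda>r. r *\<^sub>R _"] cong: if_cong)
    then have "axis i 1 = (axis j 1 :: real ^ 'n)" using zero[of "axis i 1 - axis j 1"] ij by simp
    then show False using ij(2) by (simp add: axis_eq_axis)
  qed
  show "independent (range e)"
  proof (rule independent_if_scalars_zero)
    fix f x assume f: "(\<Sum>x\<in>range e. f x *\<^sub>R x) = 0" and x: "x \<in> range e"
    have "(\<Sum>j\<in>UNIV. (\<chi> j. f (e j)) $ j *\<^sub>R e j) = 0"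
      using f by (simp add: sum.reindex[OF inj])
    from zero[OF this] show "f x = 0" using x by (auto simp: vec_eq_iff)
  qed simp
qed

text \<open>A basis of the fibre at \<open>x\<close> is extended vector by vector. It stays
  independent near \<open>x\<close>, and it spans because all Lagrangian fibres have dimension
  n.\<close>

lemma smooth_frame:
  fixes K :: "real ^ 'n \<Rightarrow> ((real ^ 'n) \<times> (real ^ 'n)) set"
  assumes S: "open S" "x \<in> S" and K: "\<And>y. y \<in> S \<Longrightarrow> lagrangian (K y)" and sec: "has_sections K x"
  shows "\<exists>U e. open U \<and> x \<in> U \<and> U \<subseteq> S \<and> (\<forall>j<CARD('n). smooth_on U (e j) \<and> (\<forall>y\<in>U. e j y \<in> K y)) \<and>
    (\<forall>y\<in>U. inj_on (\<lambda>j. e j y) {..<CARD('n)} \<and> independent ((\<lambda>j. e j y) ` {..<CARD('n)}) \<and>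
       K y = span ((\<lambda>j. e j y) ` {..<CARD('n)}))"
proof -
  obtain B where B: "B \<subseteq> K x" "independent B" "K x \<subseteq> span B" "card B = dim (K x)"
    using basis_exists by blast
  have cB: "card B = CARD('n)" using B(4) lagrangian_dim[OF K[OF S(2)]] by simp
  have fB: "finite B" using B(2) by (rule independent_imp_finite)
  obtain k :: "'n \<Rightarrow> _" where k: "bij_betw k UNIV B"
    using finite_same_card_bij[OF _ fB, of "UNIV :: 'n set"] cB by auto
  have "\<exists>S s. open S \<and> x \<in> S \<and> smooth_on S s \<and> s x = k i \<and> (\<forall>y\<in>S. s y \<in> K y)" for i
    using sec B(1) bij_betwE[OF k] unfolding has_sections_def by blast
  then obtain R s where Rs: "\<And>i. open (R i)" "\<And>i. x \<in> R i" "\<And>i. smooth_on (R i) (s i)"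
      "\<And>i. s i x = k i" "\<And>i y. y \<in> R i \<Longrightarrow> s i y \<in> K y"
    by metis
  \<comment> \<open>\<open>T\<close> maps the basis at \<open>x\<close> to the standard basis, so
    the determinant below equals 1 at \<open>x\<close>.\<close>
  obtain T :: "(real ^ 'n) \<times> (real ^ 'n) \<Rightarrow> real ^ 'n" where T: "linear T" "\<And>b. b \<in> B \<Longrightarrow> T b = axis (inv k b) 1"
    using linear_independent_extend[OF B(2), of "\<lambda>b. axis (inv k b) 1"] by blast
  have Tk: "T (k j) = axis j 1" for j
    using T(2)[of "k j"] bij_betwE[OF k] bij_betw_imp_inj_on[OF k] by (simp add: inv_f_f)
  let ?d = "\<lambda>y. det (\<chi> i j. T (s j y) $ i)"
  define V where "V = S \<inter> (\<Inter>i. R i)"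
  have V: "open V" unfolding V_def using S Rs by (intro open_Int open_INT) auto
  have sV: "smooth_on V (s i)" for i by (rule smooth_on_subset[OF Rs(3)]) (auto simp: V_def)
  have bT: "bounded_linear T" using T(1) by (simp add: linear_conv_bounded_linear)
  have "smooth_on V ?d"
  proof (rule smooth_on_det[OF V])
    show "smooth_on V (\<lambda>y. (\<chi> i j. T (s j y) $ i) $ i $ j)" for i j
      using smooth_on_vec_nth[OF V smooth_on_linear_compose[OF bT V sV[of j]], of i] by simp
  qed
  then have "continuous_on V ?d" by (rule smooth_on_continuous)
  then have U: "open {y \<in> V. ?d y \<noteq> 0}" (is "open ?U")
    using continuous_open_preimage[OF _ V, of ?d "- {0}"] by (simp add: vimage_def Int_def open_Compl)
  have dx: "?d x = 1"
  proof -
    have "(\<chi> i j. T (s j x) $ i) = (mat 1 :: real ^ 'n ^ 'n)"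
      by (simp add: vec_eq_iff mat_def Rs Tk axis_def)
    then show ?thesis by simp
  qed
  \<comment> \<open>The frame is renumbered by natural numbers, the form that
    \<open>smooth_subbundle\<close> asks for.\<close>
  obtain g where g: "bij_betw g {..<CARD('n)} (UNIV :: 'n set)"
    using ex_bij_betw_nat_finite[of "UNIV :: 'n set"] by (auto simp: atLeast0LessThan)
  define e where "e j = s (g j)" for j
  have im: "(\<lambda>j. e j y) ` {..<CARD('n)} = range (\<lambda>i. s i y)" for y
  proof -
    have "range (\<lambda>i. s i y) = (\<lambda>i. s i y) ` (g ` {..<CARD('n)})" by (simp only: bij_betw_imp_surj_on[OF g])
    then show ?thesis by (simp only: e_def image_image)
  qed
  show ?thesis
  proof (intro exI[of _ ?U] exI[of _ e] conjI allI impI ballI)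
    show "open ?U" by (rule U)
    show "x \<in> ?U" using dx S Rs by (auto simp: V_def)
    show "?U \<subseteq> S" by (auto simp: V_def)
    show "smooth_on ?U (e j)" for j unfolding e_def by (rule smooth_on_subset[OF sV]) auto
    show "e j y \<in> K y" if "y \<in> ?U" for j y unfolding e_def using that Rs(5) by (auto simp: V_def)
    fix y assume y: "y \<in> ?U"
    then have "?d y \<noteq> 0" by simp
    from independent_by_matrix[OF T(1) this]
    have inj: "inj (\<lambda>i. s i y)" and ind: "independent (range (\<lambda>i. s i y))" .
    show "inj_on (\<lambda>j. e j y) {..<CARD('n)}"
    proof (rule inj_onI)
      fix a b assume ab: "a \<in> {..<CARD('n)}" "b \<in> {..<CARD('n)}" "e a y = e b y"
      have "g a = g b" by (rule injD[OF inj]) (use ab(3) in \<open>simp add: e_def\<close>)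
      then show "a = b" by (rule inj_onD[OF bij_betw_imp_inj_on[OF g] _ ab(1,2)])
    qed
    show "independent ((\<lambda>j. e j y) ` {..<CARD('n)})" unfolding im by (rule ind)
    have Ky: "lagrangian (K y)" using y K by (auto simp: V_def)
    have sub: "range (\<lambda>i. s i y) \<subseteq> K y" using y Rs(5) by (auto simp: V_def)
    have "card (range (\<lambda>i. s i y)) = dim (K y)"
      using card_image[OF inj] lagrangian_dim[OF Ky] by simp
    then have "K y \<subseteq> span (range (\<lambda>i. s i y))" using card_eq_dim[OF sub] ind by simp
    then show "K y = span ((\<lambda>j. e j y) ` {..<CARD('n)})"
      unfolding im using span_minimal[OF sub lagrangian_subspace[OF Ky]] by blast
  qed
qed

text \<open>Transversality allows to correct the constant extension of \<open>w\<close> and any extension of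
  \<open>(A w, a)\<close> to a solution of the incidence equation, by Cramer's rule.\<close>

lemma has_sections_pull:
  fixes F :: "real ^ 'm \<Rightarrow> real ^ 'n"
  assumes S: "open S" "x \<in> S" and F: "smooth_on S F"
    and V: "open V" "F x \<in> V" and K: "\<And>z. z \<in> V \<Longrightarrow> subspace (K z)" and sec: "has_sections K (F x)"
    and surj: "\<And>u. \<exists>w. \<exists>l\<in>K (F x). u = fder F x w + fst l"
  shows "has_sections (\<lambda>y. pull (fder F y) (K (F y))) x"
  unfolding has_sections_def
proof
  fix k assume "k \<in> pull (fder F x) (K (F x))"
  then obtain w0 a0 where k: "k = (w0, transpose_map (fder F x) a0)" "(fder F x w0, a0) \<in> K (F x)"
    by (auto simp: pull_def)
  have "\<exists>w. \<exists>l\<in>K (F x). axis i 1 = fder F x w + fst l" for i using surj by blast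
  then obtain W l where Wl: "\<And>i. l i \<in> K (F x)" "\<And>i. axis i 1 = fder F x (W i) + fst (l i)" by metis
  have "\<exists>S s. open S \<and> F x \<in> S \<and> smooth_on S s \<and> s (F x) = l i \<and> (\<forall>y\<in>S. s y \<in> K y)" for i
    using sec Wl(1) unfolding has_sections_def by blast
  then obtain R s where Rs: "\<And>i. open (R i)" "\<And>i. F x \<in> R i" "\<And>i. smooth_on (R i) (s i)"
      "\<And>i. s i (F x) = l i" "\<And>i y. y \<in> R i \<Longrightarrow> s i y \<in> K y"
    by metis
  obtain R0 s0 where R0: "open R0" "F x \<in> R0" "smooth_on R0 s0" "s0 (F x) = (fder F x w0, a0)" "\<And>y. y \<in> R0 \<Longrightarrow> s0 y \<in> K y"
    using bspec[OF sec[unfolded has_sections_def] k(2)] by (elim exE conjE) (rule that, assumption+, erule (1) bspec)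
  define Q where "Q = V \<inter> R0 \<inter> (\<Inter>i. R i)"
  have Q: "open Q" "F x \<in> Q" unfolding Q_def using V Rs R0 by (auto intro!: open_Int open_INT)
  define P where "P = {y \<in> S. F y \<in> Q}"
  have P: "open P"
    using continuous_open_preimage[OF smooth_on_continuous[OF F] S(1) Q(1)] unfolding P_def by (simp add: vimage_def Int_def)
  have xP: "x \<in> P" using S Q by (simp add: P_def)
  have FP: "smooth_on P F" by (rule smooth_on_subset[OF F]) (auto simp: P_def)
  have sF: "smooth_on P (\<lambda>y. s i (F y))" for i
    by (rule smooth_on_compose[OF P FP Rs(3)]) (auto simp: P_def Q_def)
  have s0F: "smooth_on P (\<lambda>y. s0 (F y))"
    by (rule smooth_on_compose[OF P FP R0(3)]) (auto simp: P_def Q_def)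
  have DW: "smooth_on P (\<lambda>y. fder F y w)" for w by (rule smooth_on_fder_const[OF FP])
  \<comment> \<open>The columns express the standard basis at \<open>F x\<close> and move with
    \<open>y\<close>; the matrix is the identity at \<open>x\<close>, hence invertible
    nearby.\<close>
  define M where "M y = (\<chi> j i. (fder F y (W i) + fst (s i (F y))) $ j)" for y
  have sM: "smooth_on P (\<lambda>y. M y $ j $ i)" for j i
    unfolding M_def using P sF FP by (simp, intro smooth_intros)
  \<comment> \<open>The defect of the naive extensions in the incidence equation. It vanishes at
    \<open>x\<close>, hence so does the correction \<open>z\<close>, and the section keeps its value
    \<open>k\<close> there.\<close>
  define b where "b y = fder F y w0 - fst (s0 (F y))" for y
  have sb: "smooth_on P b" unfolding b_def[abs_def] using P s0F FP by (intro smooth_intros)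
  have "continuous_on P (\<lambda>y. det (M y))"
    by (rule smooth_on_continuous, rule smooth_on_det[OF P sM])
  then have U: "open {y \<in> P. det (M y) \<noteq> 0}" (is "open ?U")
    using continuous_open_preimage[OF _ P, of "\<lambda>y. det (M y)" "- {0}"] by (simp add: vimage_def Int_def open_Compl)
  have "M x = mat 1"
    unfolding M_def Rs(4) Wl(2)[symmetric] by (simp add: vec_eq_iff mat_def axis_def)
  then have xU: "x \<in> ?U" using xP by simp
  have US: "?U \<subseteq> P" by auto
  obtain z where z: "smooth_on ?U z" "\<And>y w. y \<in> ?U \<Longrightarrow> M y *v w = b y \<longleftrightarrow> w = z y"
    using smooth_on_solution[OF U smooth_on_subset[OF sM US] smooth_on_subset[OF sb US]] by auto
  have zx: "z x = 0"
    using z(2)[OF xU, of 0] by (simp add: b_def R0)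
  have Mz: "M y *v z y = (\<Sum>i\<in>UNIV. z y $ i *\<^sub>R (fder F y (W i) + fst (s i (F y))))" for y
    by (simp add: vec_eq_iff matrix_vector_mult_def M_def mult.commute)
  define w where "w y = w0 - (\<Sum>i\<in>UNIV. z y $ i *\<^sub>R W i)" for y
  define t where "t y = s0 (F y) + (\<Sum>i\<in>UNIV. z y $ i *\<^sub>R s i (F y))" for y
  have eq: "fder F y (w y) = fst (t y)" if y: "y \<in> ?U" for y
  proof -
    have l: "linear (fder F y)" using y by (intro linear_fder[OF FP]) auto
    have m1: "(\<Sum>i\<in>UNIV. z y $ i *\<^sub>R fder F y (W i)) + (\<Sum>i\<in>UNIV. z y $ i *\<^sub>R fst (s i (F y))) = b y"
      using z(2)[OF y, of "z y"] Mz[of y] by (simp add: scaleR_add_right sum.distrib)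
    have m2: "fder F y (w y) = fder F y w0 - (\<Sum>i\<in>UNIV. z y $ i *\<^sub>R fder F y (W i))"
      by (simp only: w_def linear_diff[OF l] linear_sum[OF l] linear_cmul[OF l])
    have m3: "fst (t y) = fst (s0 (F y)) + (\<Sum>i\<in>UNIV. z y $ i *\<^sub>R fst (s i (F y)))"
      by (simp add: t_def fst_sum)
    have m4: "fder F y w0 = fst (s0 (F y)) + b y" by (simp add: b_def)
    show ?thesis unfolding m2 m3 m4 m1[symmetric] by (simp add: algebra_simps)
  qed
  have tK: "t y \<in> K (F y)" if y: "y \<in> ?U" for y
  proof -
    have "F y \<in> Q" using y by (simp add: P_def)
    then show ?thesis unfolding t_def
      by (intro subspace_add subspace_sum subspace_scale K Rs R0) (auto simp: Q_def)
  qed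
  let ?s = "\<lambda>y. (w y, transpose_map (fder F y) (snd (t y)))"
  have st: "smooth_on ?U t" unfolding t_def[abs_def]
    using U z(1) smooth_on_subset[OF sF US] smooth_on_subset[OF s0F US] by (intro smooth_intros)
  have sw: "smooth_on ?U w" unfolding w_def[abs_def]
    using U z(1) by (intro smooth_intros)
  have ss: "smooth_on ?U ?s" unfolding transpose_map_def
    using U st sw smooth_on_subset[OF DW US] by (intro smooth_on_Pair smooth_on_vec smooth_on_inner smooth_on_snd)
  have sx: "?s x = k"
    by (simp add: w_def t_def zx R0 k)
  have sp: "?s y \<in> pull (fder F y) (K (F y))" if "y \<in> ?U" for y
    using tK[OF that] eq[OF that] unfolding pull_def by (auto simp: prod_eq_iff) 
  show "\<exists>S s. open S \<and> x \<in> S \<and> smooth_on S s \<and> s x = k \<and> (\<forall>y\<in>S. s y \<in> pull (fder F y) (K (F y)))"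
    by (intro exI[of _ ?U] exI[of _ ?s] conjI ballI U xU ss sx sp)
qed

section \<open>Charts and atlases\<close>

lemma chart_inv_snd: "is_chart c \<Longrightarrow> p \<in> fst c \<Longrightarrow> chart_inv c (snd c p) = p"
  by (simp add: is_chart_def chart_inv_def)

lemma snd_chart_inv: "x \<in> snd c ` fst c \<Longrightarrow> snd c (chart_inv c x) = x"
  by (simp add: chart_inv_def f_inv_into_f)

lemma chart_inv_in: "x \<in> snd c ` fst c \<Longrightarrow> chart_inv c x \<in> fst c"
  by (simp add: chart_inv_def inv_into_into)

lemma chart_image_iff: "is_chart c \<Longrightarrow> p \<in> fst c \<Longrightarrow> V \<subseteq> fst c \<Longrightarrow> snd c p \<in> snd c ` V \<longleftrightarrow> p \<in> V"
  unfolding is_chart_def by (auto dest: inj_onD)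

lemma chart_image_Int:
  "is_chart c \<Longrightarrow> V \<subseteq> fst c \<Longrightarrow> W \<subseteq> fst c \<Longrightarrow> snd c ` (V \<inter> W) = snd c ` V \<inter> snd c ` W"
  unfolding is_chart_def by (auto dest: inj_onD)

lemma compatible_sym: "compatible c d \<Longrightarrow> compatible d c"
  by (auto simp: compatible_def Int_commute)

text \<open>The image in the second chart is the preimage of an open set under the transition
  map.\<close>

lemma compatible_open_image:
  assumes c: "is_chart c" "is_chart d" "compatible c d" and V: "V \<subseteq> fst c \<inter> fst d" "open (snd c ` V)"
  shows "open (snd d ` V)"
proof -
  have "snd d ` V = snd d ` (fst c \<inter> fst d) \<inter> (snd c \<circ> chart_inv d) -` (snd c ` V)"
  proof (intro equalityI subsetI)
    fix x assume "x \<in> snd d ` V"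
    then show "x \<in> snd d ` (fst c \<inter> fst d) \<inter> (snd c \<circ> chart_inv d) -` (snd c ` V)"
      using V c by (auto simp: chart_inv_snd subset_iff)
  next
    fix x assume "x \<in> snd d ` (fst c \<inter> fst d) \<inter> (snd c \<circ> chart_inv d) -` (snd c ` V)"
    then obtain q where q: "q \<in> fst c" "q \<in> fst d" "x = snd d q" "snd c q \<in> snd c ` V"
      using c by (auto simp: chart_inv_snd)
    then show "x \<in> snd d ` V" using chart_image_iff[OF c(1) q(1), of V] V by auto
  qed
  moreover have "open (snd d ` (fst c \<inter> fst d) \<inter> (snd c \<circ> chart_inv d) -` (snd c ` V))"
    using c(3) V(2) unfolding compatible_def by (intro continuous_open_preimage smooth_on_continuous) auto
  ultimately show ?thesis by simp
qed

text \<open>Through a middle chart \<open>e\<close> nothing can be said outside its domain, hence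
  the triple intersection.\<close>

lemma compatible_trans:
  assumes ch: "is_chart c" "is_chart e" "is_chart d" and co: "compatible c e" "compatible e d"
  shows "open (snd c ` (fst c \<inter> fst e \<inter> fst d))"
    and "smooth_on (snd c ` (fst c \<inter> fst e \<inter> fst d)) (snd d \<circ> chart_inv c)"
    and "\<And>x. x \<in> snd c ` (fst c \<inter> fst e \<inter> fst d) \<Longrightarrow>
      (snd d \<circ> chart_inv c) x = (snd d \<circ> chart_inv e) ((snd e \<circ> chart_inv c) x)"
proof -
  let ?W = "fst c \<inter> fst e \<inter> fst d"
  have "open (snd e ` ?W)"
  proof -
    have "snd e ` ?W = snd e ` (fst c \<inter> fst e) \<inter> snd e ` (fst e \<inter> fst d)"
      using chart_image_Int[OF ch(2), of "fst c \<inter> fst e" "fst e \<inter> fst d"] by (simp add: Int_ac)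
    then show ?thesis using co unfolding compatible_def by auto
  qed
  then show W: "open (snd c ` ?W)"
    by (intro compatible_open_image[OF ch(2,1) compatible_sym[OF co(1)]]) auto
  show eq: "(snd d \<circ> chart_inv c) x = (snd d \<circ> chart_inv e) ((snd e \<circ> chart_inv c) x)" if "x \<in> snd c ` ?W" for x
    using that ch by (auto simp: chart_inv_snd)
  have sm: "smooth_on (snd c ` ?W) (\<lambda>x. (snd d \<circ> chart_inv e) ((snd e \<circ> chart_inv c) x))"
  proof (rule smooth_on_compose[where f = "snd e \<circ> chart_inv c" and g = "snd d \<circ> chart_inv e", OF W])
    show "smooth_on (snd c ` ?W) (snd e \<circ> chart_inv c)"
      using co(1) unfolding compatible_def by (elim conjE) (rule smooth_on_subset[of "snd c ` (fst c \<inter> fst e)"], auto)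
    show "smooth_on (snd e ` (fst e \<inter> fst d)) (snd d \<circ> chart_inv e)"
      using co(2) unfolding compatible_def by blast
    show "(snd e \<circ> chart_inv c) ` snd c ` ?W \<subseteq> snd e ` (fst e \<inter> fst d)"
      using ch by (auto simp: chart_inv_snd)
  qed
  show "smooth_on (snd c ` ?W) (snd d \<circ> chart_inv c)"
    by (rule smooth_on_cong[OF W _ sm]) (rule eq[symmetric])
qed

text \<open>Members of the atlas around points of the overlap serve as middle charts; openness and
  smoothness are local.\<close>

lemma compatible_via_atlas:
  assumes ch: "is_chart c" "is_chart d" and A: "\<And>e. e \<in> A \<Longrightarrow> is_chart e"
    and co: "\<And>e. e \<in> A \<Longrightarrow> compatible c e" "\<And>e. e \<in> A \<Longrightarrow> compatible d e" and cov: "fst c \<subseteq> points A"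
  shows "compatible c d"
proof -
  \<comment> \<open>One direction of compatibility, stated for arbitrary charts so that it can be
    used with the roles exchanged.\<close>
  have half: "open (snd c ` (fst c \<inter> fst d)) \<and> smooth_on (snd c ` (fst c \<inter> fst d)) (snd d \<circ> chart_inv c)"
    if ch: "is_chart c" "is_chart d" and co: "\<And>e. e \<in> A \<Longrightarrow> compatible c e" "\<And>e. e \<in> A \<Longrightarrow> compatible d e"
      and cov: "fst c \<inter> fst d \<subseteq> points A" for c d
  proof -
    have loc: "\<exists>T. open T \<and> x \<in> T \<and> T \<subseteq> snd c ` (fst c \<inter> fst d) \<and> smooth_on T (snd d \<circ> chart_inv c)"
      if "x \<in> snd c ` (fst c \<inter> fst d)" for x
    proof -
      obtain q e where q: "q \<in> fst c" "q \<in> fst d" "x = snd c q" "e \<in> A" "q \<in> fst e"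
        using \<open>x \<in> _\<close> cov unfolding points_def by blast
      note t = compatible_trans[OF ch(1) A[OF q(4)] ch(2) co(1)[OF q(4)] compatible_sym[OF co(2)[OF q(4)]]]
      show ?thesis
        by (rule exI[of _ "snd c ` (fst c \<inter> fst e \<inter> fst d)"]) (use t(1,2) q in auto)
    qed
    have "open (snd c ` (fst c \<inter> fst d))" by (subst open_subopen) (use loc in blast)
    moreover have "smooth_on (snd c ` (fst c \<inter> fst d)) (snd d \<circ> chart_inv c)"
      by (rule smooth_on_local) (use loc in blast)
    ultimately show ?thesis ..
  qed
  have "fst c \<inter> fst d \<subseteq> points A" "fst d \<inter> fst c \<subseteq> points A" using cov by auto
  with half[OF ch co] half[OF ch(2,1) co(2,1)] show ?thesis
    by (simp add: compatible_def Int_commute)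
qed

lemma atlasD: "smooth_atlas A \<Longrightarrow> c \<in> A \<Longrightarrow> is_chart c" "smooth_atlas A \<Longrightarrow> c \<in> A \<Longrightarrow> d \<in> A \<Longrightarrow> compatible c d"
  by (auto simp: smooth_atlas_def)

lemma max_atlas_superset: "smooth_atlas A \<Longrightarrow> A \<subseteq> max_atlas A"
  by (auto simp: max_atlas_def smooth_atlas_def points_def)

lemma points_max_atlas: "smooth_atlas A \<Longrightarrow> points (max_atlas A) = points A"
  using max_atlas_superset by (fastforce simp: max_atlas_def points_def)

lemma smooth_atlas_max_atlas:
  assumes A: "smooth_atlas A" shows "smooth_atlas (max_atlas A)"
  unfolding smooth_atlas_def
proof (intro conjI ballI)
  show "is_chart c" if "c \<in> max_atlas A" for c using that by (simp add: max_atlas_def)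
  show "compatible c d" if "c \<in> max_atlas A" "d \<in> max_atlas A" for c d
    by (rule compatible_via_atlas[where A=A]) (use that A in \<open>auto simp: max_atlas_def smooth_atlas_def\<close>)
qed

lemma max_atlas_idem:
  assumes A: "smooth_atlas A" shows "max_atlas (max_atlas A) = max_atlas A"
proof
  show "max_atlas A \<subseteq> max_atlas (max_atlas A)" by (rule max_atlas_superset[OF smooth_atlas_max_atlas[OF A]])
  show "max_atlas (max_atlas A) \<subseteq> max_atlas A"
    unfolding max_atlas_def[of "max_atlas A"] points_max_atlas[OF A]
    using max_atlas_superset[OF A] by (auto simp: max_atlas_def[of A])
qed

text \<open>Maximality puts open restrictions of charts into the atlas. They serve to avoid the
  closed set \<open>N\<close> and to fit charts to the domains of frames.\<close>

lemma restrict_chart: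
  assumes M: "smooth_atlas M" "max_atlas M = M" and c: "c \<in> M" and V: "V \<subseteq> fst c" "open (snd c ` V)"
  shows "(V, snd c) \<in> M"
proof -
  let ?r = "(V, snd c)"
  have ch: "is_chart c" using atlasD(1)[OF M(1) c] .
  have r: "is_chart ?r" using ch V by (auto simp: is_chart_def intro: inj_on_subset)
  have inv: "chart_inv ?r x = chart_inv c x" if "x \<in> snd c ` V" for x
    using that chart_inv_snd[OF r] chart_inv_snd[OF ch] V(1) by auto
  have "compatible ?r d" if d: "d \<in> M" for d
  proof -
    have dc: "is_chart d" "compatible c d" using atlasD[OF M(1)] c d by auto
    have sub: "V \<inter> fst d \<subseteq> fst c \<inter> fst d" using V by auto
    have "snd c ` (V \<inter> fst d) = snd c ` V \<inter> snd c ` (fst c \<inter> fst d)"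
      using chart_image_Int[OF ch V(1), of "fst c \<inter> fst d"] V(1) by (simp add: Int_absorb2 Int_assoc[symmetric])
    then have o1: "open (snd c ` (V \<inter> fst d))" using V(2) dc(2) unfolding compatible_def by auto
    have o2: "open (snd d ` (V \<inter> fst d))" by (rule compatible_open_image[OF ch dc sub o1])
    have "smooth_on (snd c ` (V \<inter> fst d)) (snd d \<circ> chart_inv c)"
      using dc(2) sub unfolding compatible_def by (elim conjE) (rule smooth_on_subset[of "snd c ` (fst c \<inter> fst d)"], auto)
    then have s1: "smooth_on (snd c ` (V \<inter> fst d)) (snd d \<circ> chart_inv ?r)"
      by (rule smooth_on_cong[OF o1, rotated]) (auto simp: inv)
    have s2: "smooth_on (snd d ` (V \<inter> fst d)) (snd c \<circ> chart_inv d)"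
      using dc(2) sub unfolding compatible_def by (elim conjE) (rule smooth_on_subset[of "snd d ` (fst c \<inter> fst d)"], auto)
    show ?thesis unfolding compatible_def using o1 o2 s1 s2 by simp
  qed
  then have "?r \<in> max_atlas M" using r V(1) c by (auto simp: max_atlas_def points_def)
  then show ?thesis using M(2) by simp
qed

subsection \<open>The manifold topology\<close>

lemma istopology_mtop:
  assumes "\<And>c. c \<in> A \<Longrightarrow> is_chart c"
  shows "istopology (\<lambda>V. V \<subseteq> points A \<and> (\<forall>c\<in>A. open (snd c ` (fst c \<inter> V))))"
  unfolding istopology_def
proof (intro conjI allI impI)
  fix S T assume S: "S \<subseteq> points A \<and> (\<forall>c\<in>A. open (snd c ` (fst c \<inter> S)))"
    and T: "T \<subseteq> points A \<and> (\<forall>c\<in>A. open (snd c ` (fst c \<inter> T)))"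
  show "S \<inter> T \<subseteq> points A" using S by auto
  show "\<forall>c\<in>A. open (snd c ` (fst c \<inter> (S \<inter> T)))"
  proof
    fix c assume c: "c \<in> A"
    have "snd c ` (fst c \<inter> (S \<inter> T)) = snd c ` (fst c \<inter> S) \<inter> snd c ` (fst c \<inter> T)"
      using chart_image_Int[OF assms[OF c], of "fst c \<inter> S" "fst c \<inter> T"] by (simp add: Int_ac)
    then show "open (snd c ` (fst c \<inter> (S \<inter> T)))" using S T c by auto
  qed
next
  fix K assume K: "\<forall>S\<in>K. S \<subseteq> points A \<and> (\<forall>c\<in>A. open (snd c ` (fst c \<inter> S)))"
  then show "\<Union> K \<subseteq> points A" by blast
  show "\<forall>c\<in>A. open (snd c ` (fst c \<inter> \<Union> K))"
  proof
    fix c assume c: "c \<in> A"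
    have "snd c ` (fst c \<inter> \<Union> K) = (\<Union>S\<in>K. snd c ` (fst c \<inter> S))" by auto
    then show "open (snd c ` (fst c \<inter> \<Union> K))" using K c by auto
  qed
qed

lemma openin_mtop:
  assumes "smooth_atlas A"
  shows "openin (mtop A) V \<longleftrightarrow> V \<subseteq> points A \<and> (\<forall>c\<in>A. open (snd c ` (fst c \<inter> V)))"
  unfolding mtop_def using topology_inverse'[OF istopology_mtop[of A]] atlasD(1)[OF assms] by simp

text \<open>Openness seen in a single chart near each point carries over to all charts through the
  transitions.\<close>

lemma openin_mtopI:
  assumes A: "smooth_atlas A"
    and V: "\<And>p. p \<in> V \<Longrightarrow> \<exists>c\<in>A. p \<in> fst c \<and> open (snd c ` (fst c \<inter> V))"
  shows "openin (mtop A) V"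
  unfolding openin_mtop[OF A]
proof (intro conjI ballI)
  show "V \<subseteq> points A" using V unfolding points_def by blast
  fix d assume d: "d \<in> A"
  show "open (snd d ` (fst d \<inter> V))"
  proof (subst open_subopen, intro ballI)
    fix x assume "x \<in> snd d ` (fst d \<inter> V)"
    then obtain q where q: "q \<in> fst d" "q \<in> V" "x = snd d q" by blast
    obtain c where c: "c \<in> A" "q \<in> fst c" "open (snd c ` (fst c \<inter> V))" using V q(2) by blast
    note ch = atlasD(1)[OF A c(1)] atlasD(1)[OF A d] atlasD(2)[OF A c(1) d]
    have "snd c ` (fst c \<inter> fst d \<inter> V) = snd c ` (fst c \<inter> V) \<inter> snd c ` (fst c \<inter> fst d)"
      using chart_image_Int[OF ch(1), of "fst c \<inter> V" "fst c \<inter> fst d"] by (simp add: Int_ac)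
    then have "open (snd c ` (fst c \<inter> fst d \<inter> V))" using c(3) ch(3) unfolding compatible_def by auto
    then have "open (snd d ` (fst c \<inter> fst d \<inter> V))" by (intro compatible_open_image[OF ch]) auto
    then show "\<exists>T. open T \<and> x \<in> T \<and> T \<subseteq> snd d ` (fst d \<inter> V)"
      using q c(2) by (intro exI[of _ "snd d ` (fst c \<inter> fst d \<inter> V)"]) auto
  qed
qed

lemma openin_chart_preimage:
  assumes A: "smooth_atlas A" and c: "c \<in> A" and S: "open S"
  shows "openin (mtop A) {q \<in> fst c. snd c q \<in> S}"
proof (rule openin_mtopI[OF A])
  have "snd c ` (fst c \<inter> {q \<in> fst c. snd c q \<in> S}) = snd c ` fst c \<inter> S" by auto
  then have "open (snd c ` (fst c \<inter> {q \<in> fst c. snd c q \<in> S}))"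
    using atlasD(1)[OF A c] S unfolding is_chart_def by auto
  then show "\<exists>c'\<in>A. p \<in> fst c' \<and> open (snd c' ` (fst c' \<inter> {q \<in> fst c. snd c q \<in> S}))"
    if "p \<in> {q \<in> fst c. snd c q \<in> S}" for p
    using that c by blast
qed

lemma openin_chart: "smooth_atlas A \<Longrightarrow> c \<in> A \<Longrightarrow> openin (mtop A) (fst c)"
  using openin_chart_preimage[of A c UNIV] by simp

lemma topspace_mtop: "smooth_atlas A \<Longrightarrow> topspace (mtop A) = points A"
proof (rule equalityI)
  assume A: "smooth_atlas A"
  show "topspace (mtop A) \<subseteq> points A" using openin_mtop[OF A] openin_topspace by blast
  show "points A \<subseteq> topspace (mtop A)"
    using openin_chart[OF A] openin_subset unfolding points_def by blast
qed

section \<open>Tangent and generalized tangent vectors in coordinates\<close>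

definition tr_deriv :: "('a, 'n::finite) chart \<Rightarrow> ('a, 'n) chart \<Rightarrow> 'a \<Rightarrow> real ^ 'n \<Rightarrow> real ^ 'n" where
  "tr_deriv c d p = fder (snd d \<circ> chart_inv c) (snd c p)"

lemma charts_atD: "c \<in> charts_at A p \<Longrightarrow> c \<in> A" "c \<in> charts_at A p \<Longrightarrow> p \<in> fst c"
  by (auto simp: charts_at_def)

lemma charts_atI: "c \<in> A \<Longrightarrow> p \<in> fst c \<Longrightarrow> c \<in> charts_at A p"
  by (auto simp: charts_at_def)

lemma ex_chart_at: "p \<in> points A \<Longrightarrow> \<exists>c. c \<in> charts_at A p"
  by (auto simp: charts_at_def points_def)

lemma chart_at_in: "p \<in> points A \<Longrightarrow> chart_at A p \<in> charts_at A p"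
  unfolding chart_at_def using ex_chart_at by (rule someI_ex)

lemma charts_at_points: "c \<in> charts_at A p \<Longrightarrow> p \<in> points A"
  by (auto simp: charts_at_def points_def)

lemma transition_smooth:
  assumes "smooth_atlas A" "c \<in> A" "d \<in> A"
  shows "smooth_on (snd c ` (fst c \<inter> fst d)) (snd d \<circ> chart_inv c)" "open (snd c ` (fst c \<inter> fst d))"
  using atlasD(2)[OF assms] by (auto simp: compatible_def)

lemma linear_tr_deriv:
  assumes "smooth_atlas A" "c \<in> charts_at A p" "d \<in> charts_at A p"
  shows "linear (tr_deriv c d p)"
  unfolding tr_deriv_def
  by (rule linear_fder[OF transition_smooth(1)[OF assms(1)]]) (use assms(2,3) in \<open>auto dest: charts_atD\<close>)

text \<open>The chain rule on the triple overlap. This cocycle identity makes the family built from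
  one coordinate vector a tangent vector.\<close>

lemma tr_deriv_compose:
  assumes A: "smooth_atlas A" and c: "c \<in> charts_at A p" "d \<in> charts_at A p" "e \<in> charts_at A p"
  shows "tr_deriv d e p (tr_deriv c d p v) = tr_deriv c e p v"
proof -
  note cs = c[THEN charts_atD(1)] and ps = c[THEN charts_atD(2)]
  note ch = cs[THEN atlasD(1)[OF A]]
  note t = compatible_trans[OF ch(1,2,3) atlasD(2)[OF A cs(1,2)] atlasD(2)[OF A cs(2,3)]]
  let ?x = "snd c p"
  have x: "?x \<in> snd c ` (fst c \<inter> fst d \<inter> fst e)" "?x \<in> snd c ` (fst c \<inter> fst d)" using ps by auto
  have eq: "(snd d \<circ> chart_inv c) ?x = snd d p" using chart_inv_snd[OF ch(1) ps(1)] by simp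
  have d1: "(snd d \<circ> chart_inv c) differentiable (at ?x)"
    using smooth_on_differentiable[OF transition_smooth(1)[OF A cs(1,2)] x(2)] .
  have d2: "(snd e \<circ> chart_inv d) differentiable (at ((snd d \<circ> chart_inv c) ?x))"
    unfolding eq using smooth_on_differentiable[OF transition_smooth(1)[OF A cs(2,3)]] ps by auto
  have d3: "(snd e \<circ> chart_inv c) differentiable (at ?x)" using smooth_on_differentiable[OF t(2) x(1)] .
  have "fder (snd e \<circ> chart_inv c) ?x = fder (\<lambda>x. (snd e \<circ> chart_inv d) ((snd d \<circ> chart_inv c) x)) ?x"
    by (rule frechet_derivative_transform_within_open[OF d3 t(1) x(1) t(3)])
  then show ?thesis unfolding tr_deriv_def fder_compose[OF d1 d2, unfolded eq, symmetric] by simp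
qed

lemma tr_deriv_same:
  assumes "is_chart c" "p \<in> fst c" "fst d \<subseteq> fst c" "p \<in> fst d" "snd d = snd c" "open (snd c ` fst d)"
  shows "tr_deriv c d p = (\<lambda>v. v)"
proof -
  have "fder (snd d \<circ> chart_inv c) (snd c p) = fder (\<lambda>x. x) (snd c p)"
    by (rule frechet_derivative_transform_within_open[OF _ assms(6), symmetric])
      (use assms chart_inv_snd[OF assms(1)] in auto)
  then show ?thesis by (simp add: tr_deriv_def)
qed

lemma tr_deriv_id: "smooth_atlas A \<Longrightarrow> c \<in> charts_at A p \<Longrightarrow> tr_deriv c c p = (\<lambda>v. v)"
  using tr_deriv_same[of c p c] atlasD(1)[of A c] by (auto simp: charts_at_def is_chart_def)

lemma tangent_spaceD:
  "v \<in> tangent_space A p \<Longrightarrow> c \<in> charts_at A p \<Longrightarrow> d \<in> charts_at A p \<Longrightarrow> v d = tr_deriv c d p (v c)"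
  unfolding tangent_space_def tr_deriv_def by blast

lemma tangent_space_zero: "v \<in> tangent_space A p \<Longrightarrow> c \<notin> charts_at A p \<Longrightarrow> v c = 0"
  unfolding tangent_space_def by blast

lemma tangent_spaceI:
  assumes "\<And>c d. c \<in> charts_at A p \<Longrightarrow> d \<in> charts_at A p \<Longrightarrow> v d = tr_deriv c d p (v c)"
    "\<And>c. c \<notin> charts_at A p \<Longrightarrow> v c = 0"
  shows "v \<in> tangent_space A p"
  unfolding tangent_space_def tr_deriv_def[symmetric] mem_Collect_eq using assms by blast

lemma tvec_of_eq: "tvec_of A c p u = (\<lambda>d. if d \<in> charts_at A p then tr_deriv c d p u else 0)"
  unfolding tvec_of_def tr_deriv_def ..

lemma tvec_of_in: "smooth_atlas A \<Longrightarrow> c \<in> charts_at A p \<Longrightarrow> tvec_of A c p u \<in> tangent_space A p"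
  by (rule tangent_spaceI) (auto simp: tvec_of_eq tr_deriv_compose)

lemma tvec_of_same [simp]: "smooth_atlas A \<Longrightarrow> c \<in> charts_at A p \<Longrightarrow> tvec_of A c p u c = u"
  by (simp add: tvec_of_eq tr_deriv_id)

lemma tvec_of_coord: "d \<in> charts_at A p \<Longrightarrow> tvec_of A c p u d = tr_deriv c d p u"
  by (simp add: tvec_of_eq)

text \<open>A tangent vector is a family over all charts, but one member of the family determines
  it.\<close>

lemma tangent_eq_tvec_of: "v \<in> tangent_space A p \<Longrightarrow> c \<in> charts_at A p \<Longrightarrow> v = tvec_of A c p (v c)"
proof
  fix d assume v: "v \<in> tangent_space A p" and c: "c \<in> charts_at A p"
  show "v d = tvec_of A c p (v c) d"
    by (cases "d \<in> charts_at A p") (simp_all add: tvec_of_eq tangent_spaceD[OF v c] tangent_space_zero[OF v])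
qed

lemma tangent_eqI:
  "v \<in> tangent_space A p \<Longrightarrow> w \<in> tangent_space A p \<Longrightarrow> c \<in> charts_at A p \<Longrightarrow> v c = w c \<Longrightarrow> v = w"
  using tangent_eq_tvec_of by metis

lemma tvec_of_change:
  assumes "smooth_atlas A" "c \<in> charts_at A p" "d \<in> charts_at A p"
  shows "tvec_of A c p u = tvec_of A d p (tr_deriv c d p u)"
  using tr_deriv_compose[OF assms(1) assms(2,3)] by (auto simp: tvec_of_eq fun_eq_iff)

lemma tvec_of_add:
  "smooth_atlas A \<Longrightarrow> c \<in> charts_at A p \<Longrightarrow> tvec_of A c p (u + v) = tadd (tvec_of A c p u) (tvec_of A c p v)"
  using linear_add[OF linear_tr_deriv] by (fastforce simp: tvec_of_eq tadd_def)

lemma tvec_of_scale: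
  "smooth_atlas A \<Longrightarrow> c \<in> charts_at A p \<Longrightarrow> tvec_of A c p (r *\<^sub>R u) = tscale r (tvec_of A c p u)"
  using linear_cmul[OF linear_tr_deriv] by (fastforce simp: tvec_of_eq tscale_def)

lemma tadd_in:
  assumes A: "smooth_atlas A" and v: "v \<in> tangent_space A p" "w \<in> tangent_space A p"
  shows "tadd v w \<in> tangent_space A p"
proof (rule tangent_spaceI)
  fix c d assume c: "c \<in> charts_at A p" "d \<in> charts_at A p"
  show "tadd v w d = tr_deriv c d p (tadd v w c)"
    by (simp add: tadd_def linear_add[OF linear_tr_deriv[OF A c]] tangent_spaceD[OF v(1) c, symmetric]
        tangent_spaceD[OF v(2) c, symmetric])
qed (simp add: tadd_def tangent_space_zero[OF v(1)] tangent_space_zero[OF v(2)])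

lemma tscale_in:
  assumes A: "smooth_atlas A" and v: "v \<in> tangent_space A p"
  shows "tscale r v \<in> tangent_space A p"
proof (rule tangent_spaceI)
  fix c d assume c: "c \<in> charts_at A p" "d \<in> charts_at A p"
  show "tscale r v d = tr_deriv c d p (tscale r v c)"
    by (simp add: tscale_def linear_cmul[OF linear_tr_deriv[OF A c]] tangent_spaceD[OF v c, symmetric])
qed (simp add: tscale_def tangent_space_zero[OF v])

lemma tlinear_linear:
  assumes A: "smooth_atlas A" and c: "c \<in> charts_at A p" and \<xi>: "tlinear A p \<xi>"
  shows "linear (\<lambda>u. \<xi> (tvec_of A c p u))"
  using \<xi> tvec_of_in[OF A c] unfolding tlinear_def
  by (intro linearI) (auto simp: tvec_of_add[OF A c] tvec_of_scale[OF A c])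

lemma linear_vec_inner:
  fixes f :: "real ^ 'n \<Rightarrow> real"
  assumes "linear f" shows "(\<chi> i. f (axis i 1)) \<bullet> v = f v"
proof -
  have "f v = f (\<Sum>i\<in>UNIV. v $ i *\<^sub>R axis i 1)" by (simp add: vec_sum_axis[symmetric])
  also have "\<dots> = (\<Sum>i\<in>UNIV. v $ i * f (axis i 1))" by (simp add: linear_sum[OF assms] linear_cmul[OF assms])
  finally show ?thesis by (simp add: inner_vec_def mult.commute)
qed

lemma covec_coords:
  assumes A: "smooth_atlas A" and c: "c \<in> charts_at A p" and s: "s \<in> gtangent_space A p" and v: "v \<in> tangent_space A p"
  shows "snd s v = snd (gcoords A c p s) \<bullet> v c"
proof -
  have "tlinear A p (snd s)" using s by (auto simp: gtangent_space_def cotangent_space_def)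
  from linear_vec_inner[OF tlinear_linear[OF A c this], of "v c"] tangent_eq_tvec_of[OF v c]
  show ?thesis by (simp add: gcoords_def)
qed

text \<open>The inverse of \<open>gcoords\<close> on a fibre. The cut-off outside the tangent space
  matches the convention of \<open>cotangent_space\<close>.\<close>

definition gvec_of :: "('a, 'n::finite) chart set \<Rightarrow> ('a, 'n) chart \<Rightarrow> 'a \<Rightarrow> (real ^ 'n) \<times> (real ^ 'n) \<Rightarrow> ('a, 'n) gvec" where
  "gvec_of A c p s = (tvec_of A c p (fst s), \<lambda>v. if v \<in> tangent_space A p then snd s \<bullet> v c else 0)"

lemma gvec_of_in:
  assumes A: "smooth_atlas A" and c: "c \<in> charts_at A p"
  shows "gvec_of A c p s \<in> gtangent_space A p"
  using tvec_of_in[OF A c] tadd_in[OF A] tscale_in[OF A]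
  by (auto simp: gvec_of_def gtangent_space_def cotangent_space_def tlinear_def)
    (auto simp: tadd_def tscale_def inner_add_right)

lemma gcoords_gvec_of:
  assumes A: "smooth_atlas A" and c: "c \<in> charts_at A p"
  shows "gcoords A c p (gvec_of A c p s) = s"
  using tvec_of_in[OF A c] A c
  by (auto simp: gcoords_def gvec_of_def prod_eq_iff vec_eq_iff inner_axis)

lemma gvec_of_gcoords:
  assumes A: "smooth_atlas A" and c: "c \<in> charts_at A p" and s: "s \<in> gtangent_space A p"
  shows "gvec_of A c p (gcoords A c p s) = s"
proof (rule prod_eqI)
  have f: "fst s \<in> tangent_space A p" using s by (auto simp: gtangent_space_def)
  show "fst (gvec_of A c p (gcoords A c p s)) = fst s"
    using tangent_eq_tvec_of[OF f c] by (simp add: gvec_of_def gcoords_def)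
  show "snd (gvec_of A c p (gcoords A c p s)) = snd s"
    using covec_coords[OF A c s] s
    by (auto simp: gvec_of_def fun_eq_iff) (auto simp: gtangent_space_def cotangent_space_def)
qed

lemma gcoords_inj:
  "smooth_atlas A \<Longrightarrow> c \<in> charts_at A p \<Longrightarrow> s \<in> gtangent_space A p \<Longrightarrow> t \<in> gtangent_space A p \<Longrightarrow>
    gcoords A c p s = gcoords A c p t \<Longrightarrow> s = t"
  by (metis gvec_of_gcoords)

lemma gcoords_mem_iff:
  assumes "smooth_atlas A" "c \<in> charts_at A p" "K \<subseteq> gtangent_space A p" "s \<in> gtangent_space A p"
  shows "gcoords A c p s \<in> gcoords A c p ` K \<longleftrightarrow> s \<in> K"
proof
  assume "gcoords A c p s \<in> gcoords A c p ` K"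
  then obtain t where t: "t \<in> K" "gcoords A c p s = gcoords A c p t" by (rule imageE)
  then have "s = t" using assms by (intro gcoords_inj[OF assms(1,2)]) auto
  then show "s \<in> K" using t by simp
qed (rule imageI)

lemma gvec_of_mem_iff:
  assumes "smooth_atlas A" "c \<in> charts_at A p" "K \<subseteq> gtangent_space A p"
  shows "gvec_of A c p s \<in> K \<longleftrightarrow> s \<in> gcoords A c p ` K"
  using gcoords_mem_iff[OF assms gvec_of_in[OF assms(1,2)]] gcoords_gvec_of[OF assms(1,2)] by metis

lemma pairing_coords:
  assumes "smooth_atlas A" "c \<in> charts_at A p" "s \<in> gtangent_space A p" "t \<in> gtangent_space A p"
  shows "pairing s t = qform (gcoords A c p s) (gcoords A c p t) / 2"
proof -
  have "fst s \<in> tangent_space A p" "fst t \<in> tangent_space A p" using assms by (auto simp: gtangent_space_def)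
  then show ?thesis
    using covec_coords[OF assms(1,2)] assms(3,4) by (simp add: pairing_def qform_def gcoords_def)
qed

lemma gcoords_change:
  assumes A: "smooth_atlas A" and c: "c \<in> charts_at A p" "d \<in> charts_at A p" and s: "s \<in> gtangent_space A p"
  shows "fst (gcoords A d p s) = tr_deriv c d p (fst (gcoords A c p s))"
    and "snd (gcoords A c p s) \<bullet> v = snd (gcoords A d p s) \<bullet> tr_deriv c d p v"
proof -
  have f: "fst s \<in> tangent_space A p" using s by (auto simp: gtangent_space_def)
  show "fst (gcoords A d p s) = tr_deriv c d p (fst (gcoords A c p s))"
    unfolding gcoords_def fst_conv by (rule tangent_spaceD[OF f c])
  show "snd (gcoords A c p s) \<bullet> v = snd (gcoords A d p s) \<bullet> tr_deriv c d p v"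
    using covec_coords[OF A c(1) s tvec_of_in[OF A c(1), of v]] covec_coords[OF A c(2) s tvec_of_in[OF A c(1), of v]] A c
    by (simp add: tvec_of_coord tr_deriv_id)
qed

lemma isotropic_coords:
  assumes "smooth_atlas A" "c \<in> charts_at A p"
  shows "isotropic_at A p K \<longleftrightarrow> K \<subseteq> gtangent_space A p \<and>
    (\<forall>s\<in>gcoords A c p ` K. \<forall>t\<in>gcoords A c p ` K. qform s t = 0)"
proof (cases "K \<subseteq> gtangent_space A p")
  case True
  have "pairing s t = 0 \<longleftrightarrow> qform (gcoords A c p s) (gcoords A c p t) = 0" if "s \<in> K" "t \<in> K" for s t
    unfolding pairing_coords[OF assms subsetD[OF True that(1)] subsetD[OF True that(2)]] by simp
  then show ?thesis using True unfolding isotropic_at_def by simp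
qed (simp add: isotropic_at_def)

text \<open>\<open>gcoords\<close> maps the fibre bijectively onto coordinate pairs and carries the
  pairing to half of \<open>qform\<close>, so competitors for maximality can be moved back and
  forth.\<close>

lemma maximally_isotropic_iff_lagrangian:
  assumes A: "smooth_atlas A" and c: "c \<in> charts_at A p"
  shows "isotropic_at A p K \<and> (\<forall>K'. isotropic_at A p K' \<and> K \<subseteq> K' \<longrightarrow> K' = K) \<longleftrightarrow>
    K \<subseteq> gtangent_space A p \<and> lagrangian (gcoords A c p ` K)" (is "?l \<longleftrightarrow> ?r")
proof
  let ?g = "gcoords A c p"
  note iso = isotropic_coords[OF A c]
  assume l: ?l
  note i = conjunct1[OF l, unfolded iso]
  note K = conjunct1[OF i]
  have "lagrangian (?g ` K)"
  proof (rule maximal_isotropic_lagrangian)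
    show "qform s t = 0" if "s \<in> ?g ` K" "t \<in> ?g ` K" for s t
      by (rule bspec[OF bspec[OF conjunct2[OF i] that(1)] that(2)])
    fix K' assume K': "?g ` K \<subseteq> K'" "\<And>s t. s \<in> K' \<Longrightarrow> t \<in> K' \<Longrightarrow> qform s t = 0"
    let ?K = "gvec_of A c p ` K'"
    have im: "?g ` ?K = K'" using gcoords_gvec_of[OF A c] by (simp add: image_image)
    have isoK: "isotropic_at A p ?K" unfolding iso im
    proof (intro conjI ballI K'(2))
      show "?K \<subseteq> gtangent_space A p" using gvec_of_in[OF A c] by (rule image_subsetI)
    qed
    have KK: "K \<subseteq> ?K"
    proof
      fix s assume s: "s \<in> K"
      then have g: "?g s \<in> K'" using K'(1) by blast
      show "s \<in> ?K" by (rule image_eqI[OF _ g]) (simp add: gvec_of_gcoords[OF A c subsetD[OF K s]])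
    qed
    have "?K = K" by (rule mp[OF spec[OF conjunct2[OF l]]]) (rule conjI[OF isoK KK])
    then show "K' = ?g ` K" using im by simp
  qed
  then show ?r using K by (intro conjI)
next
  let ?g = "gcoords A c p"
  note iso = isotropic_coords[OF A c]
  assume r: ?r
  show ?l
  proof (intro conjI allI impI)
    note K = conjunct1[OF r] and lag = conjunct2[OF r]
    show "isotropic_at A p K" unfolding iso
      by (intro conjI ballI K) (rule lagrangian_isotropic[OF lag])
    fix K' assume K': "isotropic_at A p K' \<and> K \<subseteq> K'"
    note i = conjunct1[OF K', unfolded iso]
    have eq: "?g ` K' = ?g ` K"
      by (rule lagrangian_maximal[OF lag image_mono[OF conjunct2[OF K']]])
        (rule bspec[OF bspec[OF conjunct2[OF i]]])
    have "s \<in> K" if s: "s \<in> K'" for s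
      using gcoords_mem_iff[OF A c K subsetD[OF conjunct1[OF i] s]] imageI[OF s, of ?g] eq by simp
    then show "K' = K" using conjunct2[OF K'] by blast
  qed
qed

text \<open>\<open>gcoords\<close> refers to a chart, and \<open>smooth_subbundle\<close> wants its
  frame on the whole domain of the chart; frames found on a smaller set are read in a restricted
  chart.\<close>

lemma restricted_chart_coords:
  assumes A: "smooth_atlas A" "max_atlas A = A" and c: "c \<in> A" and d: "d = (V, snd c)" "V \<subseteq> fst c" "open (snd c ` V)"
    and q: "q \<in> V" and s: "s \<in> gtangent_space A q"
  shows "gcoords A d q s = gcoords A c q s"
proof -
  have dA: "d \<in> A" using restrict_chart[OF A c d(2,3)] d(1) by simp
  have cq: "c \<in> charts_at A q" "d \<in> charts_at A q" using c dA d q by (auto simp: charts_at_def)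
  have "tr_deriv c d q = (\<lambda>v. v)" using tr_deriv_same[OF atlasD(1)[OF A(1) c], of q d] d q by auto
  then have "fst (gcoords A d q s) = fst (gcoords A c q s)" "snd (gcoords A c q s) \<bullet> v = snd (gcoords A d q s) \<bullet> v" for v
    using gcoords_change[OF A(1) cq s] by simp_all
  then show ?thesis by (metis prod_eqI vector_eq_rdot)
qed

section \<open>Sections, forms and the bracket in coordinates\<close>

definition sec_rep :: "('a, 'n::finite) chart set \<Rightarrow> ('a, 'n) chart \<Rightarrow> ('a \<Rightarrow> ('a, 'n) gvec) \<Rightarrow> real ^ 'n \<Rightarrow> (real ^ 'n) \<times> (real ^ 'n)" where
  "sec_rep A c \<sigma> x = gcoords A c (chart_inv c x) (\<sigma> (chart_inv c x))"

definition bundle_rep :: "('a, 'n::finite) chart set \<Rightarrow> ('a, 'n) chart \<Rightarrow> ('a \<Rightarrow> ('a, 'n) gvec set) \<Rightarrow> real ^ 'n \<Rightarrow> ((real ^ 'n) \<times> (real ^ 'n)) set" where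
  "bundle_rep A c L x = gcoords A c (chart_inv c x) ` L (chart_inv c x)"

definition form_rep :: "('a, 'n::finite) chart set \<Rightarrow> ('a, 'n) chart \<Rightarrow> ('a, 'n) form3 \<Rightarrow> real ^ 'n \<Rightarrow> real ^ 'n \<Rightarrow> real ^ 'n \<Rightarrow> real ^ 'n \<Rightarrow> real" where
  "form_rep A c H x u v w = H (chart_inv c x) (tvec_of A c (chart_inv c x) u) (tvec_of A c (chart_inv c x) v) (tvec_of A c (chart_inv c x) w)"

text \<open>Vectors transform by the Jacobian, covectors by its transpose in the opposite direction;
  hence the naturality of the bracket applies to changes of charts.\<close>

lemma related_sec_rep:
  assumes A: "smooth_atlas A" and c: "c \<in> A" "d \<in> A"
    and \<sigma>: "\<And>q. q \<in> U \<Longrightarrow> \<sigma> q \<in> gtangent_space A q"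
  shows "related (snd d \<circ> chart_inv c) (snd c ` (fst c \<inter> fst d \<inter> U)) (sec_rep A c \<sigma>) (sec_rep A d \<sigma>)"
  unfolding related_def
proof (intro ballI conjI allI)
  fix x assume "x \<in> snd c ` (fst c \<inter> fst d \<inter> U)"
  then obtain q where q: "q \<in> fst c" "q \<in> fst d" "q \<in> U" "x = snd c q" by blast
  note ch = c[THEN atlasD(1)[OF A]]
  have cq: "c \<in> charts_at A q" "d \<in> charts_at A q" using c q by (auto intro: charts_atI)
  have e: "chart_inv c x = q" "(snd d \<circ> chart_inv c) x = snd d q" "chart_inv d (snd d q) = q"
    using q chart_inv_snd[OF ch(1)] chart_inv_snd[OF ch(2)] by auto
  note g = gcoords_change[OF A cq \<sigma>[OF q(3)]]
  show "fst (sec_rep A d \<sigma> ((snd d \<circ> chart_inv c) x)) = fder (snd d \<circ> chart_inv c) x (fst (sec_rep A c \<sigma> x))"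
    unfolding sec_rep_def e using g(1) by (simp add: tr_deriv_def q(4))
  show "snd (sec_rep A c \<sigma> x) \<bullet> v = snd (sec_rep A d \<sigma> ((snd d \<circ> chart_inv c) x)) \<bullet> fder (snd d \<circ> chart_inv c) x v" for v
    unfolding sec_rep_def e using g(2)[of v] by (simp add: tr_deriv_def q(4))
qed

lemma smooth_sectionD:
  assumes "smooth_section A U \<sigma>"
  shows "q \<in> U \<Longrightarrow> \<sigma> q \<in> gtangent_space A q"
    and "c \<in> A \<Longrightarrow> smooth_on (snd c ` (fst c \<inter> U)) (sec_rep A c \<sigma>)"
  using assms by (auto simp: smooth_section_def sec_rep_def[abs_def])

lemma inner_vec_axis: "(\<chi> i. a \<bullet> f (axis i 1)) \<bullet> v = a \<bullet> f v" if "linear f" for f :: "real ^ 'n \<Rightarrow> real ^ 'm"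
  using inner_transpose_map[OF that, of a v] by (simp add: transpose_map_def)

text \<open>In another chart the vector part is multiplied by the Jacobian of the transition, the
  covector part by the transposed Jacobian of the inverse transition; both are smooth.\<close>

lemma smooth_section_of_chart:
  assumes A: "smooth_atlas A" and c: "c \<in> A" and U: "U \<subseteq> fst c" "open (snd c ` U)"
    and \<sigma>: "\<And>q. q \<in> U \<Longrightarrow> \<sigma> q \<in> gtangent_space A q" and s: "smooth_on (snd c ` U) (sec_rep A c \<sigma>)"
  shows "smooth_section A U \<sigma>"
  unfolding smooth_section_def
proof (intro conjI ballI \<sigma>)
  fix d assume d: "d \<in> A"
  note ch = atlasD(1)[OF A c] atlasD(1)[OF A d]
  let ?\<phi> = "snd c \<circ> chart_inv d" and ?\<psi> = "snd d \<circ> chart_inv c"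
  let ?W = "snd d ` (fst d \<inter> U)"
  have "snd c ` (fst d \<inter> U) = snd c ` U \<inter> snd c ` (fst c \<inter> fst d)"
    using chart_image_Int[OF ch(1) U(1), of "fst c \<inter> fst d"] U(1) by (simp add: Int_absorb2 Int_assoc[symmetric] Int_commute)
  then have "open (snd c ` (fst d \<inter> U))" using U(2) transition_smooth(2)[OF A c d] by auto
  then have W: "open ?W" by (intro compatible_open_image[OF ch atlasD(2)[OF A c d]]) (use U in auto)
  have \<phi>: "smooth_on ?W ?\<phi>"
    by (rule smooth_on_subset[OF transition_smooth(1)[OF A d c]]) (use U in auto)
  have \<phi>W: "?\<phi> ` ?W \<subseteq> snd c ` (fst c \<inter> fst d)" "?\<phi> ` ?W \<subseteq> snd c ` U"
    using U chart_inv_snd[OF ch(2)] by auto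
  have s\<phi>: "smooth_on ?W (\<lambda>x. sec_rep A c \<sigma> (?\<phi> x))"
    by (rule smooth_on_compose[OF W \<phi> s \<phi>W(2)])
  have \<psi>: "smooth_on (snd c ` (fst c \<inter> fst d)) ?\<psi>" by (rule transition_smooth(1)[OF A c d])
  have "smooth_on ?W (\<lambda>x. fder ?\<psi> (?\<phi> x) (fst (sec_rep A c \<sigma> (?\<phi> x))))"
  proof (rule smooth_on_linear_family[where g = "\<lambda>x. fder ?\<psi> (?\<phi> x)", OF W smooth_on_fst[OF W s\<phi>]])
    show "smooth_on ?W (\<lambda>x. fder ?\<psi> (?\<phi> x) v)" for v
      by (rule smooth_on_compose[where g = "\<lambda>y. fder ?\<psi> y v", OF W \<phi> smooth_on_fder_const[OF \<psi>] \<phi>W(1)])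
    show "linear (fder ?\<psi> (?\<phi> x))" if "x \<in> ?W" for x
      by (rule linear_fder[OF \<psi>]) (use that \<phi>W in blast)
  qed
  moreover have "smooth_on ?W (\<lambda>x. \<chi> i. snd (sec_rep A c \<sigma> (?\<phi> x)) \<bullet> fder ?\<phi> x (axis i 1))"
    by (intro smooth_on_vec[OF W] smooth_on_inner[OF W] smooth_on_snd[OF W] s\<phi> smooth_on_fder_const \<phi>)
  ultimately have sm: "smooth_on ?W (\<lambda>x. (fder ?\<psi> (?\<phi> x) (fst (sec_rep A c \<sigma> (?\<phi> x))),
      \<chi> i. snd (sec_rep A c \<sigma> (?\<phi> x)) \<bullet> fder ?\<phi> x (axis i 1)))"
    by (rule smooth_on_Pair[OF W])
  have "smooth_on ?W (sec_rep A d \<sigma>)"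
  proof (rule smooth_on_cong[OF W _ sm])
    fix x assume "x \<in> ?W"
    then obtain q where q: "q \<in> fst d" "q \<in> U" "x = snd d q" by blast
    have qc: "q \<in> fst c" using q U by auto
    have e: "chart_inv d x = q" "?\<phi> x = snd c q" "chart_inv c (snd c q) = q"
      using q qc chart_inv_snd[OF ch(1)] chart_inv_snd[OF ch(2)] by auto
    have cq: "c \<in> charts_at A q" "d \<in> charts_at A q" using c d q qc by (auto intro: charts_atI)
    have "snd (gcoords A d q (\<sigma> q)) = (\<chi> i. snd (gcoords A c q (\<sigma> q)) \<bullet> tr_deriv d c q (axis i 1))"
      by (rule vector_eq_rdot[THEN iffD1], rule allI)
       (use gcoords_change(2)[OF A cq(2,1) \<sigma>[OF q(2)]] inner_vec_axis[OF linear_tr_deriv[OF A cq(2,1)]] in simp)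
    then show "(fder ?\<psi> (?\<phi> x) (fst (sec_rep A c \<sigma> (?\<phi> x))),
        \<chi> i. snd (sec_rep A c \<sigma> (?\<phi> x)) \<bullet> fder ?\<phi> x (axis i 1)) = sec_rep A d \<sigma> x"
      unfolding sec_rep_def e using gcoords_change(1)[OF A cq \<sigma>[OF q(2)]]
      by (auto simp: prod_eq_iff tr_deriv_def q(3))
  qed
  then show "smooth_on ?W (\<lambda>x. gcoords A d (chart_inv d x) (\<sigma> (chart_inv d x)))"
    by (simp add: sec_rep_def[abs_def])
qed

section \<open>Three-forms and their exterior derivative in charts\<close>

lemma smooth_form3D:
  assumes "smooth_form3 A H" "p \<in> points A" "u \<in> tangent_space A p" "v \<in> tangent_space A p"
  shows "tlinear A p (H p u v)" "tlinear A p (\<lambda>w. H p u w v)" "tlinear A p (\<lambda>w. H p w u v)"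
    "H p u u v = 0" "H p u v u = 0" "H p v u u = 0"
  using assms unfolding smooth_form3_def by blast+

lemma alt3_form_rep:
  assumes A: "smooth_atlas A" and H: "smooth_form3 A H" and c: "c \<in> A" and x: "x \<in> snd c ` fst c"
  shows "alt3 (form_rep A c H x)"
proof -
  let ?q = "chart_inv c x"
  have cq: "c \<in> charts_at A ?q" using c chart_inv_in[OF x] by (rule charts_atI)
  note t = tvec_of_in[OF A cq]
  note H' = smooth_form3D[OF H charts_at_points[OF cq] t t]
  show ?thesis unfolding alt3_def form_rep_def using tlinear_linear[OF A cq H'(1)] tlinear_linear[OF A cq H'(2)]
      tlinear_linear[OF A cq H'(3)] H'(4-6) by blast
qed

lemma smooth_form_rep:
  "smooth_form3 A H \<Longrightarrow> c \<in> A \<Longrightarrow> smooth_on (snd c ` fst c) (\<lambda>x. form_rep A c H x u v w)"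
  unfolding smooth_form3_def form_rep_def Let_def by blast

lemma form_rep_change:
  assumes A: "smooth_atlas A" and c: "c \<in> A" "d \<in> A" and x: "x \<in> snd c ` (fst c \<inter> fst d)"
  shows "form_rep A c H x u v w = form_rep A d H ((snd d \<circ> chart_inv c) x)
    (fder (snd d \<circ> chart_inv c) x u) (fder (snd d \<circ> chart_inv c) x v) (fder (snd d \<circ> chart_inv c) x w)"
proof -
  obtain q where q: "q \<in> fst c" "q \<in> fst d" "x = snd c q" using x by blast
  note ch = c[THEN atlasD(1)[OF A]]
  have e: "chart_inv c x = q" "(snd d \<circ> chart_inv c) x = snd d q" "chart_inv d (snd d q) = q"
    using q chart_inv_snd[OF ch(1)] chart_inv_snd[OF ch(2)] by auto
  have cq: "c \<in> charts_at A q" "d \<in> charts_at A q" using c q by (auto intro: charts_atI)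
  show ?thesis unfolding form_rep_def e tvec_of_change[OF A cq] by (simp add: tr_deriv_def q(3))
qed

lemma form_eq_rep:
  assumes A: "smooth_atlas A" and c: "c \<in> charts_at A p"
    and u: "u \<in> tangent_space A p" "v \<in> tangent_space A p" "w \<in> tangent_space A p"
  shows "H p u v w = form_rep A c H (snd c p) (u c) (v c) (w c)"
  using chart_inv_snd[OF atlasD(1)[OF A charts_atD(1)[OF c]] charts_atD(2)[OF c]]
    tangent_eq_tvec_of[OF u(1) c] tangent_eq_tvec_of[OF u(2) c] tangent_eq_tvec_of[OF u(3) c]
  by (simp add: form_rep_def)

lemma smooth_form3I:
  assumes A: "smooth_atlas A"
    and alt: "\<And>p. p \<in> points A \<Longrightarrow> \<exists>c\<in>charts_at A p. alt3 (form_rep A c H (snd c p))"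
    and sm: "\<And>c u v w. c \<in> A \<Longrightarrow> smooth_on (snd c ` fst c) (\<lambda>x. form_rep A c H x u v w)"
  shows "smooth_form3 A H"
  unfolding smooth_form3_def
proof (intro conjI ballI allI)
  fix p u v assume p: "p \<in> points A" and u: "u \<in> tangent_space A p" and v: "v \<in> tangent_space A p"
  obtain c where c: "c \<in> charts_at A p" and al: "alt3 (form_rep A c H (snd c p))" using alt[OF p] by blast
  note l = alt3_linear[OF al] note f = form_eq_rep[OF A c, of _ _ _ H]
  note tt = tadd_in[OF A] tscale_in[OF A]
  show "tlinear A p (H p u v)" "tlinear A p (\<lambda>w. H p u w v)" "tlinear A p (\<lambda>w. H p w u v)"
    unfolding tlinear_def using u v tt
    by (simp_all add: f, simp_all add: tadd_def tscale_def linear_add[OF l(1)] linear_add[OF l(2)] linear_add[OF l(3)]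
       linear_cmul[OF l(1)] linear_cmul[OF l(2)] linear_cmul[OF l(3)])
  show "H p u u v = 0" "H p u v u = 0" "H p v u u = 0"
    using al u v by (simp_all add: f alt3_def)
qed (use sm in \<open>simp add: form_rep_def Let_def\<close>)

text \<open>\<open>ext_deriv3\<close> is computed in the chart picked by \<open>chart_at\<close>;
  naturality under the transition frees it from this choice.\<close>

lemma ext_deriv3_rep:
  assumes A: "smooth_atlas A" and H: "smooth_form3 A H" and c: "c \<in> charts_at A p"
    and u: "u0 \<in> tangent_space A p" "u1 \<in> tangent_space A p" "u2 \<in> tangent_space A p" "u3 \<in> tangent_space A p"
  shows "ext_deriv3 A H p u0 u1 u2 u3 = dform3 (form_rep A c H) (snd c p) (u0 c) (u1 c) (u2 c) (u3 c)"
proof -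
  let ?d = "chart_at A p"
  have d: "?d \<in> charts_at A p" by (rule chart_at_in[OF charts_at_points[OF c]])
  note cA = charts_atD(1)[OF c] and dA = charts_atD(1)[OF d]
  let ?\<phi> = "snd ?d \<circ> chart_inv c"
  have 1: "ext_deriv3 A H p u0 u1 u2 u3 = dform3 (form_rep A ?d H) (snd ?d p) (u0 ?d) (u1 ?d) (u2 ?d) (u3 ?d)"
    by (simp add: ext_deriv3_def Let_def differential_def const_ext_def dform3_def form_rep_def o_def)
  have x: "snd c p \<in> snd c ` (fst c \<inter> fst ?d)" using charts_atD(2)[OF c] charts_atD(2)[OF d] by blast
  have e: "?\<phi> (snd c p) = snd ?d p"
    using chart_inv_snd[OF atlasD(1)[OF A cA] charts_atD(2)[OF c]] by simp
  have "dform3 (form_rep A c H) (snd c p) (u0 c) (u1 c) (u2 c) (u3 c) =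
      dform3 (form_rep A ?d H) (?\<phi> (snd c p)) (fder ?\<phi> (snd c p) (u0 c)) (fder ?\<phi> (snd c p) (u1 c))
        (fder ?\<phi> (snd c p) (u2 c)) (fder ?\<phi> (snd c p) (u3 c))"
    by (rule dform3_pullback[OF transition_smooth(2)[OF A cA dA] x transition_smooth(1)[OF A cA dA] _
          alt3_form_rep[OF A H dA] smooth_form_rep[OF H dA] form_rep_change[OF A cA dA]])
      (use atlasD(1)[OF A cA] chart_inv_snd in fastforce)
  then show ?thesis unfolding 1 e
    using tangent_spaceD[OF u(1) c d] tangent_spaceD[OF u(2) c d] tangent_spaceD[OF u(3) c d] tangent_spaceD[OF u(4) c d]
    by (simp add: tr_deriv_def)
qed

lemma closed_form3_rep:
  assumes A: "smooth_atlas A" and H: "closed_form3 A H" and c: "c \<in> charts_at A p"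
  shows "dform3 (form_rep A c H) (snd c p) u0 u1 u2 u3 = 0"
proof -
  note t = tvec_of_in[OF A c]
  have "ext_deriv3 A H p (tvec_of A c p u0) (tvec_of A c p u1) (tvec_of A c p u2) (tvec_of A c p u3) = 0"
    using H t charts_at_points[OF c] unfolding closed_form3_def by blast
  then show ?thesis
    using ext_deriv3_rep[OF A _ c t t t t, of H u0 u1 u2 u3] H A c by (simp add: closed_form3_def)
qed

lemma open_chart_Int:
  assumes A: "smooth_atlas A" and c: "c \<in> A" and U: "openin (mtop A) U"
  shows "open (snd c ` (fst c \<inter> U))"
  using U c unfolding openin_mtop[OF A] by blast

lemma covec_tvec_of:
  assumes "smooth_atlas A" "c \<in> charts_at A p" "s \<in> gtangent_space A p"
  shows "snd s (tvec_of A c p u) = snd (gcoords A c p s) \<bullet> u"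
  using covec_coords[OF assms tvec_of_in[OF assms(1,2)]] assms by simp

text \<open>The Lie bracket is defined chart by chart, the covector part in the chosen chart only.
  Naturality shows that the former is a tangent vector and that the latter has the same formula in
  every chart.\<close>

lemma courant_bracket_rep:
  assumes A: "smooth_atlas A" and H: "smooth_form3 A H" and U: "openin (mtop A) U" "p \<in> U"
    and \<sigma>: "smooth_section A U \<sigma>" and \<tau>: "smooth_section A U \<tau>" and c: "c \<in> charts_at A p"
  shows "courant_bracket A H \<sigma> \<tau> p \<in> gtangent_space A p"
    and "fst (gcoords A c p (courant_bracket A H \<sigma> \<tau> p)) = bracket_vec (sec_rep A c \<sigma>) (sec_rep A c \<tau>) (snd c p)"
    and "snd (gcoords A c p (courant_bracket A H \<sigma> \<tau> p)) \<bullet> v =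
      bracket_form (form_rep A c H) (sec_rep A c \<sigma>) (sec_rep A c \<tau>) (snd c p) v"
proof -
  let ?b = "courant_bracket A H \<sigma> \<tau> p"
  let ?d = "chart_at A p"
  have d: "?d \<in> charts_at A p" by (rule chart_at_in[OF charts_at_points[OF c]])
  have gt: "\<sigma> q \<in> gtangent_space A q" "\<tau> q \<in> gtangent_space A q" if "q \<in> U" for q
    using smooth_sectionD(1)[OF \<sigma> that] smooth_sectionD(1)[OF \<tau> that] .
  have sm: "smooth_on (snd e ` (fst e \<inter> U)) (sec_rep A e \<sigma>)" "smooth_on (snd e ` (fst e \<inter> U)) (sec_rep A e \<tau>)"
    if "e \<in> A" for e using smooth_sectionD(2)[OF \<sigma> that] smooth_sectionD(2)[OF \<tau> that] .
  have pin: "snd e p \<in> snd e ` (fst e \<inter> U)" if "e \<in> charts_at A p" for e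
    using charts_atD(2)[OF that] U by blast
  have diff: "sec_rep A e \<sigma> differentiable (at (snd e p))" "sec_rep A e \<tau> differentiable (at (snd e p))"
    if "e \<in> charts_at A p" for e
    using smooth_on_differentiable[OF sm(1)[OF charts_atD(1)[OF that]] pin[OF that]]
      smooth_on_differentiable[OF sm(2)[OF charts_atD(1)[OF that]] pin[OF that]] .
  have inv: "chart_inv e (snd e p) = p" if "e \<in> charts_at A p" for e
    using chart_inv_snd[OF atlasD(1)[OF A charts_atD(1)[OF that]] charts_atD(2)[OF that]] .
  have change: "bracket_vec (sec_rep A e' \<sigma>) (sec_rep A e' \<tau>) (snd e' p) =
        tr_deriv e e' p (bracket_vec (sec_rep A e \<sigma>) (sec_rep A e \<tau>) (snd e p))"
      "bracket_form (form_rep A e H) (sec_rep A e \<sigma>) (sec_rep A e \<tau>) (snd e p) v =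
        bracket_form (form_rep A e' H) (sec_rep A e' \<sigma>) (sec_rep A e' \<tau>) (snd e' p) (tr_deriv e e' p v)"
    if e: "e \<in> charts_at A p" "e' \<in> charts_at A p" for e e' v
  proof -
    note eA = charts_atD(1)[OF e(1)] charts_atD(1)[OF e(2)]
    let ?\<phi> = "snd e' \<circ> chart_inv e" and ?W = "snd e ` (fst e \<inter> fst e' \<inter> U)"
    have W: "open ?W"
      using open_chart_Int[OF A eA(1), of "fst e' \<inter> U"] openin_Int[OF openin_chart[OF A eA(2)] U(1)] by (simp add: Int_assoc)
    have x: "snd e p \<in> ?W" "snd e p \<in> snd e ` (fst e \<inter> fst e')" using charts_atD(2)[OF e(1)] charts_atD(2)[OF e(2)] U(2) by auto
    have \<phi>: "smooth_on ?W ?\<phi>" by (rule smooth_on_subset[OF transition_smooth(1)[OF A eA]]) auto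
    have ee: "?\<phi> (snd e p) = snd e' p" using inv[OF e(1)] by simp
    have rel: "related ?\<phi> ?W (sec_rep A e \<sigma>) (sec_rep A e' \<sigma>)" "related ?\<phi> ?W (sec_rep A e \<tau>) (sec_rep A e' \<tau>)"
      by (rule related_sec_rep[OF A eA gt(1)], assumption, rule related_sec_rep[OF A eA gt(2)])
    note br = bracket_related[where h = "form_rep A e H" and h' = "form_rep A e' H",
        OF W x(1) \<phi> diff[OF e(1)] diff[OF e(2), folded ee] rel form_rep_change[OF A eA x(2)]]
    show "bracket_vec (sec_rep A e' \<sigma>) (sec_rep A e' \<tau>) (snd e' p) =
        tr_deriv e e' p (bracket_vec (sec_rep A e \<sigma>) (sec_rep A e \<tau>) (snd e p))"
      using br(1) unfolding ee tr_deriv_def .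
    show "bracket_form (form_rep A e H) (sec_rep A e \<sigma>) (sec_rep A e \<tau>) (snd e p) v =
        bracket_form (form_rep A e' H) (sec_rep A e' \<sigma>) (sec_rep A e' \<tau>) (snd e' p) (tr_deriv e e' p v)"
      using br(2) unfolding ee tr_deriv_def .
  qed
  have vec: "fst ?b e = bracket_vec (sec_rep A e \<sigma>) (sec_rep A e \<tau>) (snd e p)" if e: "e \<in> charts_at A p" for e
    using e inv[OF e] by (simp add: courant_bracket_def Let_def lie_bracket_def bracket_vec_def sec_rep_def gcoords_def)
  have vin: "fst ?b \<in> tangent_space A p"
  proof (rule tangent_spaceI)
    show "fst ?b e' = tr_deriv e e' p (fst ?b e)" if "e \<in> charts_at A p" "e' \<in> charts_at A p" for e e'
      unfolding vec[OF that(1)] vec[OF that(2)] by (rule change(1)[OF that])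
  qed (simp add: courant_bracket_def Let_def lie_bracket_def)
  have al: "alt3 (form_rep A e H (snd e p))" if "e \<in> charts_at A p" for e
    by (rule alt3_form_rep[OF A H charts_atD(1)[OF that]]) (use charts_atD(2)[OF that] in blast)
  \<comment> \<open>The definition evaluates the covector part in \<open>chart_at A p\<close>, so it
    is identified there and carried to \<open>c\<close> at the end by \<open>change\<close>.\<close>
  have form: "snd ?b v = bracket_form (form_rep A ?d H) (sec_rep A ?d \<sigma>) (sec_rep A ?d \<tau>) (snd ?d p) (v ?d)"
    if v: "v \<in> tangent_space A p" for v
  proof -
    let ?s = "sec_rep A ?d \<sigma>" and ?t = "sec_rep A ?d \<tau>" and ?x = "snd ?d p"
    note dA = charts_atD(1)[OF d]
    let ?W = "snd ?d ` (fst ?d \<inter> U)"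
    have W: "open ?W" by (rule open_chart_Int[OF A dA U(1)])
    have in': "chart_inv ?d y \<in> U \<and> ?d \<in> charts_at A (chart_inv ?d y)" if "y \<in> ?W" for y
      using that chart_inv_snd[OF atlasD(1)[OF A dA]] dA by (auto simp: charts_at_def)
    have cov: "snd (\<rho> (chart_inv ?d y)) (tvec_of A ?d (chart_inv ?d y) u) = snd (sec_rep A ?d \<rho> y) \<bullet> u"
      if "y \<in> ?W" and r: "\<And>q. q \<in> U \<Longrightarrow> \<rho> q \<in> gtangent_space A q" for y u \<rho>
      unfolding sec_rep_def using covec_tvec_of[OF A] in'[OF that(1)] r by blast
    \<comment> \<open>Covector coordinates agree with values on constant fields only over
      \<open>U\<close>; agreement on an open set suffices for equal derivatives.\<close>
    have ext: "ext_deriv1 A (\<lambda>q. snd (\<rho> q)) p u w = dform1 (\<lambda>y. snd (sec_rep A ?d \<rho> y)) ?x (u ?d) (w ?d)"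
      if \<rho>: "smooth_section A U \<rho>" for \<rho> u w
    proof -
      have 1: "fder (\<lambda>y. snd (sec_rep A ?d \<rho> y) \<bullet> z) ?x = fder (\<lambda>y. snd (\<rho> (chart_inv ?d y)) (tvec_of A ?d (chart_inv ?d y) z)) ?x" for z
      proof (rule frechet_derivative_transform_within_open[OF _ W pin[OF d]])
        show "(\<lambda>y. snd (sec_rep A ?d \<rho> y) \<bullet> z) differentiable at ?x"
          by (rule smooth_on_differentiable[OF _ pin[OF d]])
            (intro smooth_on_inner[OF W] smooth_on_snd[OF W] smooth_sectionD(2)[OF \<rho> dA] smooth_on_const)
      qed (simp add: cov[OF _ smooth_sectionD(1)[OF \<rho>]])
      show ?thesis unfolding ext_deriv1_def differential_def const_ext_def dform1_def 1 by (simp add: o_def)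
    qed
    have lie: "fder (\<lambda>y. snd (?t y) \<bullet> fst (?s y)) ?x = fder ((\<lambda>q. snd (\<tau> q) (fst (\<sigma> q))) \<circ> chart_inv ?d) ?x"
    proof (rule frechet_derivative_transform_within_open[OF _ W pin[OF d]])
      show "(\<lambda>y. snd (?t y) \<bullet> fst (?s y)) differentiable at ?x"
        by (rule smooth_on_differentiable[OF _ pin[OF d]])
          (intro smooth_on_inner[OF W] smooth_on_snd[OF W] smooth_on_fst[OF W] sm[OF dA])
      fix y assume y: "y \<in> ?W"
      let ?q = "chart_inv ?d y"
      have q: "?q \<in> U" "?d \<in> charts_at A ?q" using in'[OF y] by auto
      have "fst (\<sigma> ?q) \<in> tangent_space A ?q" using gt(1)[OF q(1)] by (auto simp: gtangent_space_def)
      from covec_coords[OF A q(2) gt(2)[OF q(1)] this]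
      show "snd (?t y) \<bullet> fst (?s y) = ((\<lambda>q. snd (\<tau> q) (fst (\<sigma> q))) \<circ> chart_inv ?d) y"
        by (simp add: sec_rep_def gcoords_def)
    qed
    have f: "fst (\<sigma> p) \<in> tangent_space A p" "fst (\<tau> p) \<in> tangent_space A p"
      using gt[OF U(2)] by (auto simp: gtangent_space_def)
    have fs: "fst (?s ?x) = fst (\<sigma> p) ?d" "fst (?t ?x) = fst (\<tau> p) ?d"
      using inv[OF d] by (simp_all add: sec_rep_def gcoords_def)
    show ?thesis
      using v unfolding courant_bracket_def Let_def snd_conv lie_deriv1_def differential_def bracket_form_def
        ext[OF \<sigma>] ext[OF \<tau>] lie fs form_eq_rep[OF A d f v] by simp
  qed
  have tr_lin: "linear (bracket_form (form_rep A ?d H) (sec_rep A ?d \<sigma>) (sec_rep A ?d \<tau>) (snd ?d p))"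
    by (rule linear_bracket_form[where h = "form_rep A ?d H", OF diff[OF d] al[OF d]])
  have "snd ?b \<in> cotangent_space A p"
    unfolding cotangent_space_def mem_Collect_eq tlinear_def
  proof (intro conjI ballI allI impI)
    show "snd ?b (tadd v w) = snd ?b v + snd ?b w" if "v \<in> tangent_space A p" "w \<in> tangent_space A p" for v w
      unfolding form[OF tadd_in[OF A that]] form[OF that(1)] form[OF that(2)]
      by (simp add: tadd_def linear_add[OF tr_lin])
    show "snd ?b (tscale r v) = r * snd ?b v" if "v \<in> tangent_space A p" for r v
      unfolding form[OF tscale_in[OF A that]] form[OF that(1)]
      by (simp add: tscale_def linear_cmul[OF tr_lin])
  qed (simp add: courant_bracket_def Let_def)
  with vin show bin: "?b \<in> gtangent_space A p"
    unfolding gtangent_space_def by (cases ?b) auto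
  show "fst (gcoords A c p ?b) = bracket_vec (sec_rep A c \<sigma>) (sec_rep A c \<tau>) (snd c p)"
    using vec[OF c] by (simp add: gcoords_def)
  have "snd (gcoords A c p ?b) \<bullet> v = snd ?b (tvec_of A c p v)"
    by (rule covec_tvec_of[OF A c bin, symmetric])
  also have "\<dots> = bracket_form (form_rep A ?d H) (sec_rep A ?d \<sigma>) (sec_rep A ?d \<tau>) (snd ?d p) (tr_deriv c ?d p v)"
    using form[OF tvec_of_in[OF A c, of v]] tvec_of_coord[OF d, of c v] by simp
  also have "\<dots> = bracket_form (form_rep A c H) (sec_rep A c \<sigma>) (sec_rep A c \<tau>) (snd c p) v"
    by (rule change(2)[OF c d, symmetric])
  finally show "snd (gcoords A c p ?b) \<bullet> v = bracket_form (form_rep A c H) (sec_rep A c \<sigma>) (sec_rep A c \<tau>) (snd c p) v" .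
qed

section \<open>Smooth maps and backward images in coordinates\<close>

definition map_rep :: "('b, 'm::finite) chart \<Rightarrow> ('a, 'n::finite) chart \<Rightarrow> ('b \<Rightarrow> 'a) \<Rightarrow> real ^ 'm \<Rightarrow> real ^ 'n" where
  "map_rep C D f = snd D \<circ> f \<circ> chart_inv C"

text \<open>\<open>smooth_map\<close> provides one pair of charts; composition with transitions and
  a smaller domain give the same for any pair.\<close>

lemma smooth_map_rep:
  assumes B: "smooth_atlas B" and M: "smooth_atlas M" and f: "smooth_map B M f"
    and C: "C \<in> charts_at B b" and D: "D \<in> charts_at M (f b)"
  obtains W where "open W" "snd C b \<in> W" "W \<subseteq> snd C ` fst C" "\<And>x. x \<in> W \<Longrightarrow> f (chart_inv C x) \<in> fst D"
    "smooth_on W (map_rep C D f)"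
proof -
  obtain c d where c: "c \<in> charts_at B b" and d: "d \<in> charts_at M (f b)" and fc: "f ` fst c \<subseteq> fst d"
    and sm: "smooth_on (snd c ` fst c) (snd d \<circ> f \<circ> chart_inv c)"
    using f charts_at_points[OF C] unfolding smooth_map_def by blast
  note CA = charts_atD(1)[OF C] charts_atD(1)[OF c] and DA = charts_atD(1)[OF D] charts_atD(1)[OF d]
  note ch = CA[THEN atlasD(1)[OF B]] DA[THEN atlasD(1)[OF M]]
  note ps = charts_atD(2)[OF C] charts_atD(2)[OF c] charts_atD(2)[OF D] charts_atD(2)[OF d]
  let ?W = "snd C ` (fst C \<inter> fst c)" and ?\<phi> = "snd c \<circ> chart_inv C" and ?g = "snd d \<circ> f \<circ> chart_inv c"
  let ?Q = "snd d ` (fst d \<inter> fst D)" and ?\<psi> = "snd D \<circ> chart_inv d"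
  have W: "open ?W" and Q: "open ?Q" using transition_smooth(2)[OF B CA] transition_smooth(2)[OF M DA(2,1)] .
  have \<phi>: "smooth_on ?W ?\<phi>" and \<psi>: "smooth_on ?Q ?\<psi>"
    using transition_smooth(1)[OF B CA] transition_smooth(1)[OF M DA(2,1)] .
  have g\<phi>: "smooth_on ?W (\<lambda>x. ?g (?\<phi> x))"
    by (rule smooth_on_compose[where f = "?\<phi>" and g = "?g", OF W \<phi> sm]) (use chart_inv_snd[OF ch(1)] in auto)
  let ?V = "?W \<inter> (\<lambda>x. ?g (?\<phi> x)) -` ?Q"
  have V: "open ?V" by (rule continuous_open_preimage[OF smooth_on_continuous[OF g\<phi>] W Q])
  have pt: "\<exists>q. q \<in> fst C \<and> q \<in> fst c \<and> x = snd C q \<and> f q \<in> fst D \<and> f q \<in> fst d \<and> ?g (?\<phi> x) = snd d (f q)" if "x \<in> ?V" for x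
  proof -
    obtain q where q: "q \<in> fst C" "q \<in> fst c" "x = snd C q" "?g (?\<phi> x) \<in> ?Q" using \<open>x \<in> ?V\<close> by blast
    have e: "?g (?\<phi> x) = snd d (f q)" using q chart_inv_snd[OF ch(1)] chart_inv_snd[OF ch(2)] by simp
    have "f q \<in> fst d" using q fc by blast
    moreover have "f q \<in> fst D"
      using q(4) chart_image_iff[OF ch(4) \<open>f q \<in> fst d\<close>, of "fst d \<inter> fst D"] unfolding e by auto
    ultimately show ?thesis using q e by blast
  qed
  show thesis
  proof (rule that)
    show "open ?V" by (rule V)
    show "snd C b \<in> ?V" using ps chart_inv_snd[OF ch(1)] chart_inv_snd[OF ch(2)] by auto
    show "?V \<subseteq> snd C ` fst C" by auto
    show "f (chart_inv C x) \<in> fst D" if "x \<in> ?V" for x using pt[OF that] chart_inv_snd[OF ch(1)] by auto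
    have "smooth_on ?V (\<lambda>x. ?\<psi> (?g (?\<phi> x)))"
      by (rule smooth_on_compose[where f = "\<lambda>x. ?g (?\<phi> x)" and g = "?\<psi>", OF V smooth_on_subset[OF g\<phi>] \<psi>]) auto
    then show "smooth_on ?V (map_rep C D f)"
    proof (rule smooth_on_cong[OF V, rotated])
      fix x assume "x \<in> ?V"
      from pt[OF this] show "?\<psi> (?g (?\<phi> x)) = map_rep C D f x"
        using chart_inv_snd[OF ch(1)] chart_inv_snd[OF ch(4)] by (auto simp: map_rep_def)
    qed
  qed
qed

lemma map_rep_differentiable:
  assumes "smooth_atlas B" "smooth_atlas M" "smooth_map B M f" "C \<in> charts_at B b" "D \<in> charts_at M (f b)"
  shows "map_rep C D f differentiable (at (snd C b))"
  using smooth_map_rep[OF assms] smooth_on_differentiable by metis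

lemma smooth_map_points: "smooth_map B M f \<Longrightarrow> b \<in> points B \<Longrightarrow> f b \<in> points M"
  by (auto simp: smooth_map_def)

text \<open>\<open>tangent_map\<close> is defined with the chosen chart of the source; the chain
  rule replaces it by any other.\<close>

lemma tangent_map_coord:
  assumes B: "smooth_atlas B" and M: "smooth_atlas M" and f: "smooth_map B M f"
    and C: "C \<in> charts_at B b" and D: "D \<in> charts_at M (f b)" and w: "w \<in> tangent_space B b"
  shows "tangent_map B M f b w D = fder (map_rep C D f) (snd C b) (w C)"
proof -
  let ?C = "chart_at B b"
  have C0: "?C \<in> charts_at B b" by (rule chart_at_in[OF charts_at_points[OF C]])
  note CA = charts_atD(1)[OF C] charts_atD(1)[OF C0] and ps = charts_atD(2)[OF C] charts_atD(2)[OF C0]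
  note ch = CA[THEN atlasD(1)[OF B]]
  let ?\<phi> = "snd ?C \<circ> chart_inv C" and ?W = "snd C ` (fst C \<inter> fst ?C)"
  have e: "?\<phi> (snd C b) = snd ?C b" using chart_inv_snd[OF ch(1) ps(1)] by simp
  have x: "snd C b \<in> ?W" using ps by auto
  have "fder (map_rep C D f) (snd C b) (w C) = fder (\<lambda>x. map_rep ?C D f (?\<phi> x)) (snd C b) (w C)"
    by (rule fun_cong[OF frechet_derivative_transform_within_open[OF map_rep_differentiable[OF B M f C D] transition_smooth(2)[OF B CA] x]])
      (auto simp: map_rep_def chart_inv_snd[OF ch(1)] chart_inv_snd[OF ch(2)])
  also have "\<dots> = fder (map_rep ?C D f) (?\<phi> (snd C b)) (fder ?\<phi> (snd C b) (w C))"
    by (rule fder_compose[OF smooth_on_differentiable[OF transition_smooth(1)[OF B CA] x]])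
      (simp only: e map_rep_differentiable[OF B M f C0 D])
  also have "\<dots> = tangent_map B M f b w D"
    unfolding e using D tangent_spaceD[OF w C C0] by (simp add: tangent_map_def map_rep_def tr_deriv_def)
  finally show ?thesis ..
qed

lemma tangent_map_in:
  assumes B: "smooth_atlas B" and M: "smooth_atlas M" and f: "smooth_map B M f"
    and b: "b \<in> points B" and w: "w \<in> tangent_space B b"
  shows "tangent_map B M f b w \<in> tangent_space M (f b)"
proof (rule tangent_spaceI)
  obtain C where C: "C \<in> charts_at B b" using ex_chart_at[OF b] by blast
  fix d e assume d: "d \<in> charts_at M (f b)" and e: "e \<in> charts_at M (f b)"
  note dA = charts_atD(1)[OF d] charts_atD(1)[OF e] and ps = charts_atD(2)[OF d] charts_atD(2)[OF e]
  note ch = dA[THEN atlasD(1)[OF M]]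
  have inv: "chart_inv C (snd C b) = b" by (rule chart_inv_snd[OF atlasD(1)[OF B charts_atD(1)[OF C]] charts_atD(2)[OF C]])
  obtain W where W: "open W" "snd C b \<in> W" "\<And>x. x \<in> W \<Longrightarrow> f (chart_inv C x) \<in> fst d"
    using smooth_map_rep[OF B M f C d] by metis
  let ?\<psi> = "snd e \<circ> chart_inv d"
  have ee: "map_rep C d f (snd C b) = snd d (f b)" by (simp add: map_rep_def inv)
  have "fder (map_rep C e f) (snd C b) (w C) = fder (\<lambda>x. ?\<psi> (map_rep C d f x)) (snd C b) (w C)"
    by (rule fun_cong[OF frechet_derivative_transform_within_open[OF map_rep_differentiable[OF B M f C e] W(1,2)]])
      (use W(3) chart_inv_snd[OF ch(1)] in \<open>simp add: map_rep_def\<close>)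
  also have "\<dots> = fder ?\<psi> (map_rep C d f (snd C b)) (fder (map_rep C d f) (snd C b) (w C))"
    by (rule fder_compose[OF map_rep_differentiable[OF B M f C d]], unfold ee,
        rule smooth_on_differentiable[OF transition_smooth(1)[OF M dA]]) (use ps in auto)
  finally show "tangent_map B M f b w e = tr_deriv d e (f b) (tangent_map B M f b w d)"
    unfolding tangent_map_coord[OF B M f C d w] tangent_map_coord[OF B M f C e w] ee tr_deriv_def .
qed (simp add: tangent_map_def)

lemma tangent_map_tvec_of:
  assumes B: "smooth_atlas B" and M: "smooth_atlas M" and f: "smooth_map B M f"
    and C: "C \<in> charts_at B b" and D: "D \<in> charts_at M (f b)"
  shows "tangent_map B M f b (tvec_of B C b u) = tvec_of M D (f b) (fder (map_rep C D f) (snd C b) u)"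
proof -
  note t = tvec_of_in[OF B C]
  show ?thesis
    by (rule tangent_eqI[OF tangent_map_in[OF B M f charts_at_points[OF C] t] tvec_of_in[OF M D] D])
      (simp add: tangent_map_coord[OF B M f C D t] tvec_of_same[OF B C] tvec_of_same[OF M D])
qed

lemma form_rep_pullback:
  assumes B: "smooth_atlas B" and M: "smooth_atlas M" and f: "smooth_map B M f"
    and C: "C \<in> charts_at B b" and D: "D \<in> charts_at M (f b)"
  shows "form_rep B C (form3_pullback B M f H) (snd C b) u v w =
    form_rep M D H (map_rep C D f (snd C b)) (fder (map_rep C D f) (snd C b) u)
      (fder (map_rep C D f) (snd C b) v) (fder (map_rep C D f) (snd C b) w)"
proof -
  have 1: "chart_inv C (snd C b) = b" by (rule chart_inv_snd[OF atlasD(1)[OF B charts_atD(1)[OF C]] charts_atD(2)[OF C]])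
  have 2: "chart_inv D (snd D (f b)) = f b" by (rule chart_inv_snd[OF atlasD(1)[OF M charts_atD(1)[OF D]] charts_atD(2)[OF D]])
  have 3: "map_rep C D f (snd C b) = snd D (f b)" by (simp add: map_rep_def 1)
  show ?thesis unfolding form_rep_def form3_pullback_def 1 3 2 tangent_map_tvec_of[OF B M f C D] ..
qed

lemma closed_form3_pullback:
  assumes B: "smooth_atlas B" and M: "smooth_atlas M" and f: "smooth_map B M f" and H: "closed_form3 M H"
  shows "closed_form3 B (form3_pullback B M f H)"
proof -
  let ?H = "form3_pullback B M f H"
  have sH: "smooth_form3 M H" using H by (simp add: closed_form3_def)
  \<comment> \<open>Near each point the coordinate expression of the pulled-back form is that of
    \<open>H\<close> composed with a smooth map and its derivative. Alternation, smoothness and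
    closedness are all read off from this.\<close>
  have loc: "\<exists>W D. open W \<and> snd C b \<in> W \<and> D \<in> M \<and> D \<in> charts_at M (f b) \<and> smooth_on W (map_rep C D f) \<and>
      (\<forall>y\<in>W. map_rep C D f y \<in> snd D ` fst D \<and> (\<forall>u v w. form_rep B C ?H y u v w = form_rep M D H (map_rep C D f y)
        (fder (map_rep C D f) y u) (fder (map_rep C D f) y v) (fder (map_rep C D f) y w)))"
    if C: "C \<in> charts_at B b" for C b
  proof -
    obtain D where D: "D \<in> charts_at M (f b)" using ex_chart_at[OF smooth_map_points[OF f charts_at_points[OF C]]] ..
    obtain W where W: "open W" "snd C b \<in> W" "W \<subseteq> snd C ` fst C" "\<And>x. x \<in> W \<Longrightarrow> f (chart_inv C x) \<in> fst D"
      "smooth_on W (map_rep C D f)" by (rule smooth_map_rep[OF B M f C D]) (rule that; (assumption | blast))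
    have "map_rep C D f y \<in> snd D ` fst D \<and> (\<forall>u v w. form_rep B C ?H y u v w = form_rep M D H (map_rep C D f y)
        (fder (map_rep C D f) y u) (fder (map_rep C D f) y v) (fder (map_rep C D f) y w))" if y: "y \<in> W" for y
    proof (intro conjI allI)
      have yC: "y \<in> snd C ` fst C" using W(3) y by blast
      have e: "snd C (chart_inv C y) = y" by (rule snd_chart_inv[OF yC])
      have 1: "C \<in> charts_at B (chart_inv C y)" by (rule charts_atI[OF charts_atD(1)[OF C] chart_inv_in[OF yC]])
      have 2: "D \<in> charts_at M (f (chart_inv C y))" by (rule charts_atI[OF charts_atD(1)[OF D] W(4)[OF y]])
      show "map_rep C D f y \<in> snd D ` fst D" using W(4)[OF y] by (simp add: map_rep_def)
      show "form_rep B C ?H y u v w = form_rep M D H (map_rep C D f y)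
        (fder (map_rep C D f) y u) (fder (map_rep C D f) y v) (fder (map_rep C D f) y w)" for u v w
        using form_rep_pullback[OF B M f 1 2, unfolded e] .
    qed
    then show ?thesis using W(1,2,5) D charts_atD(1)[OF D] by blast
  qed
  have alt: "alt3 (form_rep B C ?H (snd C b))" if C: "C \<in> charts_at B b" for C b
  proof -
    obtain W D where W: "open W" "snd C b \<in> W" "D \<in> M" "D \<in> charts_at M (f b)" "smooth_on W (map_rep C D f)"
      "\<forall>y\<in>W. map_rep C D f y \<in> snd D ` fst D \<and> (\<forall>u v w. form_rep B C ?H y u v w = form_rep M D H (map_rep C D f y)
        (fder (map_rep C D f) y u) (fder (map_rep C D f) y v) (fder (map_rep C D f) y w))"
      using loc[OF C] by (elim exE conjE) (rule that)
    let ?F = "map_rep C D f"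
    have al: "alt3 (form_rep M D H (?F (snd C b)))" using alt3_form_rep[OF M sH W(3)] W(2,6) by blast
    have l: "linear (fder ?F (snd C b))" by (rule linear_fder[OF W(5,2)])
    have e: "form_rep B C ?H (snd C b) = (\<lambda>u v w. form_rep M D H (?F (snd C b))
        (fder ?F (snd C b) u) (fder ?F (snd C b) v) (fder ?F (snd C b) w))" using W(2,6) by blast
    note a = alt3_linear[OF al]
    show ?thesis unfolding e alt3_def
      using linear_compose[OF l a(1), unfolded o_def] linear_compose[OF l a(2), unfolded o_def]
        linear_compose[OF l a(3), unfolded o_def] al unfolding alt3_def by blast
  qed
  have smooth: "smooth_on (snd C ` fst C) (\<lambda>x. form_rep B C ?H x u v w)" if C: "C \<in> B" for C u v w
  proof (rule smooth_on_local)
    fix x assume "x \<in> snd C ` fst C"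
    then obtain b where b: "b \<in> fst C" "x = snd C b" by blast
    have Cb: "C \<in> charts_at B b" using C b by (intro charts_atI)
    obtain W D where W: "open W" "snd C b \<in> W" "D \<in> M" "D \<in> charts_at M (f b)" "smooth_on W (map_rep C D f)"
      "\<forall>y\<in>W. map_rep C D f y \<in> snd D ` fst D \<and> (\<forall>u v w. form_rep B C ?H y u v w = form_rep M D H (map_rep C D f y)
        (fder (map_rep C D f) y u) (fder (map_rep C D f) y v) (fder (map_rep C D f) y w))"
      using loc[OF Cb] by (elim exE conjE) (rule that)
    let ?F = "map_rep C D f"
    have sm: "smooth_on W (\<lambda>y. form_rep M D H (?F y) (fder ?F y u) (fder ?F y v) (fder ?F y w))"
    proof (rule smooth_on_alt3[where h = "\<lambda>y. form_rep M D H (?F y)", OF W(1)])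
      show "alt3 (form_rep M D H (?F y))" if "y \<in> W" for y using alt3_form_rep[OF M sH W(3)] W(6) that by blast
      show "smooth_on W (\<lambda>y. form_rep M D H (?F y) p q r)" for p q r
        by (rule smooth_on_compose[where g = "\<lambda>z. form_rep M D H z p q r", OF W(1,5) smooth_form_rep[OF sH W(3)]])
          (use W(6) in blast)
    qed (intro smooth_on_fder_const W(5))+
    have "smooth_on W (\<lambda>x. form_rep B C ?H x u v w)"
      by (rule smooth_on_cong[OF W(1) _ sm]) (use W(6) in simp)
    then show "\<exists>T. open T \<and> x \<in> T \<and> smooth_on T (\<lambda>x. form_rep B C ?H x u v w)" using W(1,2) b(2) by blast
  qed
  have sm: "smooth_form3 B ?H"
  proof (rule smooth_form3I[OF B _ smooth])
    show "\<exists>c\<in>charts_at B p. alt3 (form_rep B c ?H (snd c p))" if "p \<in> points B" for p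
      using ex_chart_at[OF that] alt by blast
  qed
  show ?thesis unfolding closed_form3_def
  proof (intro conjI sm ballI)
    fix b u0 u1 u2 u3
    assume b: "b \<in> points B" and u: "u0 \<in> tangent_space B b" "u1 \<in> tangent_space B b" "u2 \<in> tangent_space B b" "u3 \<in> tangent_space B b"
    obtain C where C: "C \<in> charts_at B b" using ex_chart_at[OF b] by blast
    obtain W D where W: "open W" "snd C b \<in> W" "D \<in> M" "D \<in> charts_at M (f b)" "smooth_on W (map_rep C D f)"
      "\<forall>y\<in>W. map_rep C D f y \<in> snd D ` fst D \<and> (\<forall>u v w. form_rep B C ?H y u v w = form_rep M D H (map_rep C D f y)
        (fder (map_rep C D f) y u) (fder (map_rep C D f) y v) (fder (map_rep C D f) y w))"
      using loc[OF C] by (elim exE conjE) (rule that)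
    have e: "map_rep C D f (snd C b) = snd D (f b)"
      by (simp add: map_rep_def chart_inv_snd[OF atlasD(1)[OF B charts_atD(1)[OF C]] charts_atD(2)[OF C]])
    have "dform3 (form_rep B C ?H) (snd C b) (u0 C) (u1 C) (u2 C) (u3 C) = dform3 (form_rep M D H) (map_rep C D f (snd C b))
        (fder (map_rep C D f) (snd C b) (u0 C)) (fder (map_rep C D f) (snd C b) (u1 C))
        (fder (map_rep C D f) (snd C b) (u2 C)) (fder (map_rep C D f) (snd C b) (u3 C))"
      by (rule dform3_pullback[OF W(1,2,5) _ alt3_form_rep[OF M sH W(3)] smooth_form_rep[OF sH W(3)]]) (use W(6) in auto)
    then show "ext_deriv3 B ?H b u0 u1 u2 u3 = 0"
      unfolding ext_deriv3_rep[OF B sm C u] e closed_form3_rep[OF M H W(4)] .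
  qed
qed

section \<open>Backward images of Lagrangian subbundles in charts\<close>

lemma covec_pullback_coords:
  assumes B: "smooth_atlas B" and M: "smooth_atlas M" and f: "smooth_map B M f"
    and C: "C \<in> charts_at B b" and D: "D \<in> charts_at M (f b)"
    and w: "w \<in> tangent_space B b" and s: "(t, \<xi>) \<in> gtangent_space M (f b)"
  shows "(w, covec_pullback B M f b \<xi>) =
    gvec_of B C b (w C, transpose_map (fder (map_rep C D f) (snd C b)) (snd (gcoords M D (f b) (t, \<xi>))))"
proof -
  let ?A = "fder (map_rep C D f) (snd C b)" and ?a = "snd (gcoords M D (f b) (t, \<xi>))"
  have l: "linear ?A" by (rule linear_frechet_derivative[OF map_rep_differentiable[OF B M f C D]])
  have "covec_pullback B M f b \<xi> v = (if v \<in> tangent_space B b then transpose_map ?A ?a \<bullet> v C else 0)" for v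
  proof (cases "v \<in> tangent_space B b")
    case True
    have "\<xi> (tangent_map B M f b v) = ?a \<bullet> tangent_map B M f b v D"
      using covec_coords[OF M D s tangent_map_in[OF B M f charts_at_points[OF C] True]] by simp
    then show ?thesis using True by (simp add: covec_pullback_def tangent_map_coord[OF B M f C D True] inner_transpose_map[OF l])
  qed (simp add: covec_pullback_def)
  then show ?thesis using tangent_eq_tvec_of[OF w C] by (simp add: gvec_of_def fun_eq_iff)
qed

text \<open>Covectors pull back by the transposed derivative, which reduces the backward image to
  the linear one.\<close>

lemma backward_image_coords:
  assumes B: "smooth_atlas B" and M: "smooth_atlas M" and f: "smooth_map B M f"
    and C: "C \<in> charts_at B b" and D: "D \<in> charts_at M (f b)" and L: "L (f b) \<subseteq> gtangent_space M (f b)"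
  shows "backward_image B M f L b \<subseteq> gtangent_space B b"
    and "gcoords B C b ` backward_image B M f L b = pull (fder (map_rep C D f) (snd C b)) (gcoords M D (f b) ` L (f b))"
proof -
  let ?A = "fder (map_rep C D f) (snd C b)" and ?g = "gcoords M D (f b)"
  note cp = covec_pullback_coords[OF B M f C D]
  have sub: "s \<in> gtangent_space B b \<and> gcoords B C b s \<in> pull ?A (?g ` L (f b))" if "s \<in> backward_image B M f L b" for s
  proof -
    obtain w \<xi> where s: "s = (w, covec_pullback B M f b \<xi>)" "w \<in> tangent_space B b" "(tangent_map B M f b w, \<xi>) \<in> L (f b)"
      using \<open>s \<in> backward_image B M f L b\<close> unfolding backward_image_def by blast
    note e = cp[OF s(2) subsetD[OF L s(3)]]
    have "?g (tangent_map B M f b w, \<xi>) = (?A (w C), snd (?g (tangent_map B M f b w, \<xi>)))"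
      by (simp add: gcoords_def tangent_map_coord[OF B M f C D s(2)])
    then have "(?A (w C), snd (?g (tangent_map B M f b w, \<xi>))) \<in> ?g ` L (f b)" using imageI[OF s(3), of ?g] by simp
    then show ?thesis unfolding s(1) e gcoords_gvec_of[OF B C] using gvec_of_in[OF B C] unfolding pull_def by blast
  qed
  then show "backward_image B M f L b \<subseteq> gtangent_space B b" by blast
  have "x \<in> gcoords B C b ` backward_image B M f L b" if "x \<in> pull ?A (?g ` L (f b))" for x
  proof -
    obtain w a l where x: "x = (w, transpose_map ?A a)" "l \<in> L (f b)" "(?A w, a) = ?g l" using \<open>x \<in> _\<close> unfolding pull_def by blast
    let ?w = "tvec_of B C b w"
    have w: "?w \<in> tangent_space B b" by (rule tvec_of_in[OF B C])
    have gl: "l \<in> gtangent_space M (f b)" using L x(2) by blast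
    have "fst l \<in> tangent_space M (f b)" using gl by (auto simp: gtangent_space_def)
    moreover have "tangent_map B M f b ?w D = fst l D"
      using x(3) by (simp add: tangent_map_coord[OF B M f C D w] tvec_of_same[OF B C] gcoords_def)
    ultimately have "tangent_map B M f b ?w = fst l"
      by (intro tangent_eqI[OF tangent_map_in[OF B M f charts_at_points[OF C] w] _ D])
    then have l: "(tangent_map B M f b ?w, snd l) = l" by simp
    have "(?w, covec_pullback B M f b (snd l)) \<in> backward_image B M f L b"
      unfolding backward_image_def using w x(2) l by (auto simp del: prod.collapse)
    moreover have "gcoords B C b (?w, covec_pullback B M f b (snd l)) = x"
      unfolding cp[OF w, of "fst l" "snd l", unfolded prod.collapse, OF gl] gcoords_gvec_of[OF B C] x(1)
      using x(3) by (simp add: tvec_of_same[OF B C] prod_eq_iff)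
    ultimately show ?thesis by (rule rev_image_eqI[OF _ sym])
  qed
  then show "gcoords B C b ` backward_image B M f L b = pull ?A (?g ` L (f b))" using sub by blast
qed

text \<open>Linearity is all that is needed to move a linear combination from the chart of a frame
  to another chart.\<close>

lemma gcoords_change_linear:
  assumes A: "smooth_atlas A" and c: "c \<in> charts_at A p" "d \<in> charts_at A p"
  shows "\<exists>G. linear G \<and> (\<forall>s\<in>gtangent_space A p. gcoords A d p s = G (gcoords A c p s))"
proof (intro exI conjI ballI)
  let ?G = "\<lambda>x. (tr_deriv c d p (fst x), transpose_map (tr_deriv d c p) (snd x))"
  note l = linear_tr_deriv[OF A c] linear_tr_deriv[OF A c(2,1)]
  show "linear ?G"
    by (rule linearI) (auto simp: linear_add[OF l(1)] linear_cmul[OF l(1)] transpose_map_def vec_eq_iff inner_add_left)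
  fix s assume s: "s \<in> gtangent_space A p"
  have "snd (gcoords A d p s) \<bullet> v = transpose_map (tr_deriv d c p) (snd (gcoords A c p s)) \<bullet> v" for v
    using gcoords_change(2)[OF A c(2,1) s, of v] by (simp add: inner_transpose_map[OF l(2)])
  then have "snd (gcoords A d p s) = transpose_map (tr_deriv d c p) (snd (gcoords A c p s))" by (metis vector_eq_rdot)
  then show "gcoords A d p s = ?G (gcoords A c p s)" using gcoords_change(1)[OF A c s] by (simp add: prod_eq_iff)
qed

text \<open>An element of the fibre is a combination of the frame, and the same constants extend it.
  The frame lives in another chart than \<open>d\<close>, hence the change of coordinates.\<close>

lemma subbundle_has_sections:
  fixes L :: "'a \<Rightarrow> ('a, 'n::finite) gvec set"
  assumes A: "smooth_atlas A" and L: "smooth_subbundle A L" and d: "d \<in> charts_at A p"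
    and sub: "\<And>q. q \<in> fst d \<Longrightarrow> subspace (gcoords A d q ` L q)"
  shows "has_sections (bundle_rep A d L) (snd d p)"
  unfolding has_sections_def
proof
  note dA = charts_atD(1)[OF d] and pd = charts_atD(2)[OF d]
  note chd = atlasD(1)[OF A dA]
  have invd: "chart_inv d (snd d q) = q" if "q \<in> fst d" for q by (rule chart_inv_snd[OF chd that])
  fix k assume "k \<in> bundle_rep A d L (snd d p)"
  then obtain l where l: "l \<in> L p" "k = gcoords A d p l" unfolding bundle_rep_def invd[OF pd] by blast
  have LG: "L q \<subseteq> gtangent_space A q" if "q \<in> points A" for q using L that unfolding smooth_subbundle_def by blast
  define P where "P c r \<sigma> \<longleftrightarrow> (\<forall>j<r. smooth_section A (fst c) (\<sigma> j)) \<and>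
      (\<forall>q\<in>fst c. inj_on (\<lambda>j. gcoords A c q (\<sigma> j q)) {..<r} \<and>
           independent ((\<lambda>j. gcoords A c q (\<sigma> j q)) ` {..<r}) \<and>
           gcoords A c q ` L q = span ((\<lambda>j. gcoords A c q (\<sigma> j q)) ` {..<r}))" for c :: "('a, 'n) chart" and r :: nat and \<sigma>
  have "\<exists>c\<in>charts_at A p. \<exists>r \<sigma>. P c r \<sigma>"
    unfolding P_def by (rule bspec[OF conjunct2[OF L[unfolded smooth_subbundle_def]] charts_at_points[OF d]])
  then obtain c r \<sigma> where c: "c \<in> charts_at A p" and P: "P c r \<sigma>" by blast
  note sec' = conjunct1[OF P[unfolded P_def]] and fr = conjunct2[OF P[unfolded P_def]]
  have sec: "smooth_section A (fst c) (\<sigma> j)" if "j < r" for j using sec' that by blast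
  have inj: "inj_on (\<lambda>j. gcoords A c q (\<sigma> j q)) {..<r}"
    and sp: "gcoords A c q ` L q = span ((\<lambda>j. gcoords A c q (\<sigma> j q)) ` {..<r})" if "q \<in> fst c" for q
    using bspec[OF fr that] by simp_all
  note cA = charts_atD(1)[OF c] and pc = charts_atD(2)[OF c]
  have gt: "\<sigma> j q \<in> gtangent_space A q" if "j < r" "q \<in> fst c" for j q
    by (rule smooth_sectionD(1)[OF sec[OF that(1)] that(2)])
  have \<sigma>L: "\<sigma> j q \<in> L q" if "j < r" "q \<in> fst c" for j q
  proof -
    have cq: "c \<in> charts_at A q" by (rule charts_atI[OF cA that(2)])
    have "gcoords A c q (\<sigma> j q) \<in> gcoords A c q ` L q" unfolding sp[OF that(2)] by (rule span_base) (use that in blast)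
    then show ?thesis using gcoords_mem_iff[OF A cq LG[OF charts_at_points[OF cq]] gt[OF that]] by blast
  qed
  have "gcoords A c p l \<in> span ((\<lambda>j. gcoords A c p (\<sigma> j p)) ` {..<r})" using sp[OF pc] l(1) by blast
  then obtain u where "gcoords A c p l = (\<Sum>v\<in>(\<lambda>j. gcoords A c p (\<sigma> j p)) ` {..<r}. u v *\<^sub>R v)"
    by (subst (asm) span_finite) auto
  then have lc: "gcoords A c p l = (\<Sum>j<r. u (gcoords A c p (\<sigma> j p)) *\<^sub>R gcoords A c p (\<sigma> j p))"
    by (simp add: sum.reindex[OF inj[OF pc]])
  define \<rho> where "\<rho> j = u (gcoords A c p (\<sigma> j p))" for j
  obtain G where G: "linear G" "\<And>s. s \<in> gtangent_space A p \<Longrightarrow> gcoords A d p s = G (gcoords A c p s)"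
    using gcoords_change_linear[OF A c d] by blast
  have "gcoords A d p l = G (gcoords A c p l)" using G(2) LG[OF charts_at_points[OF c]] l(1) by blast
  also have "\<dots> = (\<Sum>j<r. \<rho> j *\<^sub>R G (gcoords A c p (\<sigma> j p)))"
    unfolding lc \<rho>_def by (simp add: linear_sum[OF G(1)] linear_cmul[OF G(1)])
  also have "\<dots> = (\<Sum>j<r. \<rho> j *\<^sub>R gcoords A d p (\<sigma> j p))"
    by (rule sum.cong) (use G(2) gt pc in auto)
  finally have kd: "k = (\<Sum>j<r. \<rho> j *\<^sub>R gcoords A d p (\<sigma> j p))" using l(2) by simp
  let ?S = "snd d ` (fst d \<inter> fst c)"
  let ?s = "\<lambda>x. \<Sum>j<r. \<rho> j *\<^sub>R sec_rep A d (\<sigma> j) x"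
  have S: "open ?S" by (rule transition_smooth(2)[OF A dA cA])
  have "smooth_on ?S ?s"
    by (intro smooth_on_sum[OF S] smooth_on_scaleR[OF S] smooth_on_const smooth_sectionD(2)[OF sec dA]) auto
  moreover have "?s (snd d p) = k" unfolding kd sec_rep_def invd[OF pd] ..
  moreover have "?s y \<in> bundle_rep A d L y" if "y \<in> ?S" for y
  proof -
    obtain q where q: "q \<in> fst d" "q \<in> fst c" "y = snd d q" using \<open>y \<in> ?S\<close> by blast
    show ?thesis unfolding q(3) sec_rep_def bundle_rep_def invd[OF q(1)]
      by (intro subspace_sum[OF sub[OF q(1)]] subspace_scale[OF sub[OF q(1)]] imageI \<sigma>L) (use q in auto)
  qed
  ultimately show "\<exists>S s. open S \<and> snd d p \<in> S \<and> smooth_on S s \<and> s (snd d p) = k \<and> (\<forall>y\<in>S. s y \<in> bundle_rep A d L y)"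
    using S pd pc by (intro exI[of _ ?S] exI[of _ ?s] conjI ballI) auto
qed

text \<open>Converse of \<open>subbundle_has_sections\<close> for Lagrangian fibres, by way of
  \<open>smooth_frame\<close>.\<close>

lemma smooth_subbundleI:
  assumes A: "smooth_atlas A" "max_atlas A = A" and L: "\<And>p. p \<in> points A \<Longrightarrow> L p \<subseteq> gtangent_space A p"
    and lag: "\<And>c p. c \<in> charts_at A p \<Longrightarrow> lagrangian (gcoords A c p ` L p)"
    and sec: "\<And>c p. c \<in> charts_at A p \<Longrightarrow> has_sections (bundle_rep A c L) (snd c p)"
  shows "smooth_subbundle A (L :: 'a \<Rightarrow> ('a, 'n::finite) gvec set)"
  unfolding smooth_subbundle_def
proof (intro conjI ballI)
  show "L p \<subseteq> gtangent_space A p" if "p \<in> points A" for p by (rule L[OF that])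
  fix p assume p: "p \<in> points A"
  obtain C where C: "C \<in> charts_at A p" using ex_chart_at[OF p] by blast
  note CA = charts_atD(1)[OF C] and pC = charts_atD(2)[OF C]
  note ch = atlasD(1)[OF A(1) CA]
  let ?S = "snd C ` fst C"
  have S: "open ?S" "snd C p \<in> ?S" using ch pC by (auto simp: is_chart_def)
  have inv: "chart_inv C (snd C q) = q" if "q \<in> fst C" for q by (rule chart_inv_snd[OF ch that])
  have lagb: "lagrangian (bundle_rep A C L y)" if "y \<in> ?S" for y
    unfolding bundle_rep_def by (rule lag[OF charts_atI[OF CA chart_inv_in[OF that]]])
  define P where "P U e \<longleftrightarrow> open U \<and> snd C p \<in> U \<and> U \<subseteq> ?S \<and>
      (\<forall>j<CARD('n). smooth_on U (e j) \<and> (\<forall>y\<in>U. e j y \<in> bundle_rep A C L y)) \<and>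
      (\<forall>y\<in>U. inj_on (\<lambda>j. e j y) {..<CARD('n)} \<and> independent ((\<lambda>j. e j y) ` {..<CARD('n)}) \<and>
       bundle_rep A C L y = span ((\<lambda>j. e j y) ` {..<CARD('n)}))" for U e
  have "\<exists>U e. P U e" unfolding P_def by (rule smooth_frame[OF S _ sec[OF C]]) (rule lagb)
  then obtain U e where P: "P U e" by blast
  note P' = P[unfolded P_def]
  note U = conjunct1[OF P'] conjunct1[OF conjunct2[OF P']] conjunct1[OF conjunct2[OF conjunct2[OF P']]]
  note e' = conjunct1[OF conjunct2[OF conjunct2[OF conjunct2[OF P']]]]
    and fr' = conjunct2[OF conjunct2[OF conjunct2[OF conjunct2[OF P']]]]
  note fr = bspec[OF fr']
  have e: "smooth_on U (e j)" if "j < CARD('n)" for j using e' that by blast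
  \<comment> \<open>The chart is cut down to the part over which the frame is defined and
    independent.\<close>
  define V where "V = {q \<in> fst C. snd C q \<in> U}"
  have VU: "snd C ` V = U" using U(3) by (auto simp: V_def)
  have V: "V \<subseteq> fst C" "open (snd C ` V)" "p \<in> V" using U VU pC by (auto simp: V_def)
  define c where "c = (V, snd C)"
  have cA: "c \<in> A" unfolding c_def by (rule restrict_chart[OF A CA V(1,2)])
  have fc: "fst c = V" by (simp add: c_def)
  define \<sigma> where "\<sigma> j q = gvec_of A C q (e j (snd C q))" for j q
  have Cq: "C \<in> charts_at A q" if "q \<in> V" for q using that V(1) by (intro charts_atI[OF CA]) auto
  have \<sigma>g: "\<sigma> j q \<in> gtangent_space A q" if "q \<in> V" for j q unfolding \<sigma>_def by (rule gvec_of_in[OF A(1) Cq[OF that]])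
  have g\<sigma>: "gcoords A C q (\<sigma> j q) = e j (snd C q)" if "q \<in> V" for j q
    unfolding \<sigma>_def by (rule gcoords_gvec_of[OF A(1) Cq[OF that]])
  have gc: "gcoords A c q s = gcoords A C q s" if "q \<in> V" "s \<in> gtangent_space A q" for q s
    by (rule restricted_chart_coords[OF A CA c_def V(1,2) that])
  show "\<exists>c\<in>charts_at A p. \<exists>r::nat. \<exists>\<sigma>. (\<forall>j<r. smooth_section A (fst c) (\<sigma> j)) \<and>
      (\<forall>q\<in>fst c. inj_on (\<lambda>j. gcoords A c q (\<sigma> j q)) {..<r} \<and>
        independent ((\<lambda>j. gcoords A c q (\<sigma> j q)) ` {..<r}) \<and>
        gcoords A c q ` L q = span ((\<lambda>j. gcoords A c q (\<sigma> j q)) ` {..<r}))"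
  proof (intro bexI[of _ c] exI[of _ "CARD('n)"] exI[of _ \<sigma>] conjI allI impI ballI)
    show "c \<in> charts_at A p" using cA V(3) fc by (auto intro: charts_atI)
    show "smooth_section A (fst c) (\<sigma> j)" if j: "j < CARD('n)" for j
      unfolding fc
    proof (rule smooth_section_of_chart[OF A(1) CA V(1,2) \<sigma>g])
      show "smooth_on (snd C ` V) (sec_rep A C (\<sigma> j))" unfolding VU
      proof (rule smooth_on_cong[OF U(1) _ e[OF j]])
        fix x assume "x \<in> U"
        then obtain q where q: "q \<in> V" "x = snd C q" using VU by blast
        show "e j x = sec_rep A C (\<sigma> j) x"
          using q V(1) inv g\<sigma> by (auto simp: sec_rep_def)
      qed
    qed
    fix q assume "q \<in> fst c"
    then have q: "q \<in> V" by (simp add: fc)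
    then have qU: "snd C q \<in> U" by (simp add: V_def)
    have 1: "gcoords A c q (\<sigma> j q) = e j (snd C q)" for j using gc[OF q \<sigma>g[OF q]] g\<sigma>[OF q] by simp
    have 2: "gcoords A c q ` L q = bundle_rep A C L (snd C q)"
      unfolding bundle_rep_def inv[OF subsetD[OF V(1) q]]
      by (rule image_cong[OF refl]) (rule gc[OF q subsetD[OF L[OF charts_at_points[OF Cq[OF q]]]]])
    show "inj_on (\<lambda>j. gcoords A c q (\<sigma> j q)) {..<CARD('n)}"
      "independent ((\<lambda>j. gcoords A c q (\<sigma> j q)) ` {..<CARD('n)})"
      "gcoords A c q ` L q = span ((\<lambda>j. gcoords A c q (\<sigma> j q)) ` {..<CARD('n)})"
      unfolding 1 2 using fr[OF qU] by simp_all
  qed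
qed

lemma has_sections_cong:
  assumes W: "open W" "x \<in> W" "\<And>y. y \<in> W \<Longrightarrow> K y = K' y" and K: "has_sections K x"
  shows "has_sections K' x"
  unfolding has_sections_def
proof
  fix k assume "k \<in> K' x"
  then have "k \<in> K x" using W by blast
  from bspec[OF K[unfolded has_sections_def] this]
  obtain S s where s: "open S" "x \<in> S" "smooth_on S s" "s x = k" "\<forall>y\<in>S. s y \<in> K y" by (elim exE conjE)
  show "\<exists>S s. open S \<and> x \<in> S \<and> smooth_on S s \<and> s x = k \<and> (\<forall>y\<in>S. s y \<in> K' y)"
  proof (intro exI conjI)
    show "open (S \<inter> W)" "x \<in> S \<inter> W" "s x = k" using s W by auto
    show "smooth_on (S \<inter> W) s" by (rule smooth_on_subset[OF s(3)]) auto
    show "\<forall>y\<in>S \<inter> W. s y \<in> K' y" using s(5) W(3) by blast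
  qed
qed

text \<open>The assumption on \<open>u\<close> is transversality of \<open>f\<close> to
  \<open>L\<close> at \<open>f b\<close>. In charts it becomes the surjectivity required by
  \<open>lagrangian_pull\<close> and \<open>has_sections_pull\<close>.\<close>

lemma backward_image_bundle:
  assumes B: "smooth_atlas B" and M: "smooth_atlas M" and f: "smooth_map B M f"
    and L: "smooth_subbundle M L" and lag: "\<And>D q. D \<in> charts_at M q \<Longrightarrow> lagrangian (gcoords M D q ` L q)"
    and tv: "\<And>u. u \<in> tangent_space M (f b) \<Longrightarrow> \<exists>w\<in>tangent_space B b. \<exists>l\<in>L (f b). u = tadd (tangent_map B M f b w) (fst l)"
    and C: "C \<in> charts_at B b"
  shows "lagrangian (gcoords B C b ` backward_image B M f L b)"
    and "has_sections (bundle_rep B C (backward_image B M f L)) (snd C b)"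
proof -
  obtain D where D: "D \<in> charts_at M (f b)" using ex_chart_at[OF smooth_map_points[OF f charts_at_points[OF C]]] ..
  note DA = charts_atD(1)[OF D] and pD = charts_atD(2)[OF D]
  have LG: "L q \<subseteq> gtangent_space M q" if "q \<in> points M" for q using L that unfolding smooth_subbundle_def by blast
  let ?F = "map_rep C D f"
  have lin: "linear (fder ?F (snd C b))" by (rule linear_frechet_derivative[OF map_rep_differentiable[OF B M f C D]])
  have surj: "\<exists>w. \<exists>l\<in>gcoords M D (f b) ` L (f b). u = fder ?F (snd C b) w + fst l" for u
  proof -
    obtain w l where w: "w \<in> tangent_space B b" "l \<in> L (f b)" "tvec_of M D (f b) u = tadd (tangent_map B M f b w) (fst l)"
      using tv[OF tvec_of_in[OF M D, of u]] by blast
    from fun_cong[OF w(3), of D] have "u = fder ?F (snd C b) (w C) + fst (gcoords M D (f b) l)"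
      by (simp add: tvec_of_same[OF M D] tadd_def tangent_map_coord[OF B M f C D w(1)] gcoords_def)
    then show ?thesis using w(2) by blast
  qed
  show "lagrangian (gcoords B C b ` backward_image B M f L b)"
    unfolding backward_image_coords(2)[where L=L, OF B M f C D LG[OF charts_at_points[OF D]]]
    by (rule lagrangian_pull[OF lin lag[OF D] surj])
  obtain W where W: "open W" "snd C b \<in> W" "W \<subseteq> snd C ` fst C" "\<And>x. x \<in> W \<Longrightarrow> f (chart_inv C x) \<in> fst D"
      "smooth_on W ?F" by (rule smooth_map_rep[OF B M f C D]) (rule that; (assumption | blast))
  have inv: "chart_inv D (snd D q) = q" if "q \<in> fst D" for q by (rule chart_inv_snd[OF atlasD(1)[OF M DA] that])
  have F: "?F (snd C b) = snd D (f b)"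
    by (simp add: map_rep_def chart_inv_snd[OF atlasD(1)[OF B charts_atD(1)[OF C]] charts_atD(2)[OF C]])
  have V: "open (snd D ` fst D)" using atlasD(1)[OF M DA] by (simp add: is_chart_def)
  have FV: "?F (snd C b) \<in> snd D ` fst D" unfolding F using pD by blast
  have br: "bundle_rep M D L (?F (snd C b)) = gcoords M D (f b) ` L (f b)"
    unfolding F bundle_rep_def inv[OF pD] ..
  have subL: "subspace (gcoords M D q ` L q)" if "q \<in> fst D" for q
    by (rule lagrangian_subspace[OF lag[OF charts_atI[OF DA that]]])
  have "has_sections (\<lambda>y. pull (fder ?F y) (bundle_rep M D L (?F y))) (snd C b)"
  proof (rule has_sections_pull[OF W(1,2,5) V FV])
    show "subspace (bundle_rep M D L z)" if "z \<in> snd D ` fst D" for z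
      unfolding bundle_rep_def by (rule subL[OF chart_inv_in[OF that]])
    show "has_sections (bundle_rep M D L) (?F (snd C b))" unfolding F by (rule subbundle_has_sections[OF M L D subL])
    show "\<exists>w. \<exists>l\<in>bundle_rep M D L (?F (snd C b)). u = fder ?F (snd C b) w + fst l" for u
      unfolding br by (rule surj)
  qed
  then show "has_sections (bundle_rep B C (backward_image B M f L)) (snd C b)"
  proof (rule has_sections_cong[OF W(1,2), rotated])
    fix y assume y: "y \<in> W"
    have yC: "y \<in> snd C ` fst C" using W(3) y by blast
    have 1: "C \<in> charts_at B (chart_inv C y)" by (rule charts_atI[OF charts_atD(1)[OF C] chart_inv_in[OF yC]])
    have 2: "D \<in> charts_at M (f (chart_inv C y))" by (rule charts_atI[OF DA W(4)[OF y]])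
    have e: "bundle_rep M D L (?F y) = gcoords M D (f (chart_inv C y)) ` L (f (chart_inv C y))"
      unfolding bundle_rep_def map_rep_def o_def inv[OF W(4)[OF y]] ..
    show "pull (fder ?F y) (bundle_rep M D L (?F y)) = bundle_rep B C (backward_image B M f L) y"
      unfolding e using backward_image_coords(2)[where L=L, OF B M f 1 2 LG[OF charts_at_points[OF 2]], unfolded snd_chart_inv[OF yC]]
      unfolding bundle_rep_def[of B] by simp
  qed
qed

section \<open>The atlas of the blowup\<close>

text \<open>The line through \<open>x\<close> in direction \<open>v\<close> stays in the coordinate
  subspace, on which the component vanishes near \<open>x\<close>.\<close>

lemma fder_nth_zero_along:
  fixes \<phi> :: "real ^ 'm \<Rightarrow> real ^ 'n"
  assumes W: "open W" "x \<in> W" and \<phi>: "smooth_on W \<phi>"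
    and z: "\<And>y. y \<in> W \<Longrightarrow> (\<forall>j\<in>J. y $ j = 0) \<Longrightarrow> \<phi> y $ i = 0"
    and x: "\<forall>j\<in>J. x $ j = 0" and v: "\<forall>j\<in>J. v $ j = 0"
  shows "fder \<phi> x v $ i = 0"
proof -
  let ?l = "\<lambda>s::real. x + s *\<^sub>R v"
  have l: "(?l has_derivative (\<lambda>s. s *\<^sub>R v)) (at 0)" by (auto intro!: derivative_eq_intros)
  have d: "(\<phi> has_derivative fder \<phi> x) (at (?l 0))" using smooth_on_has_derivative[OF \<phi> W(2)] by simp
  have D: "((\<lambda>s. \<phi> (?l s) $ i) has_derivative (\<lambda>s. fder \<phi> x (s *\<^sub>R v) $ i)) (at 0)"
    by (rule bounded_linear.has_derivative[OF bounded_linear_vec_nth has_derivative_compose[OF l d]])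
  have O: "open (?l -` W)" by (intro open_vimage W continuous_intros)
  have "((\<lambda>s. \<phi> (?l s) $ i) has_derivative (\<lambda>s. 0)) (at 0)"
    by (rule has_derivative_transform_within_open[OF has_derivative_const[of 0] O])
      (use W x v z in auto)
  from has_derivative_unique[OF D this] have "fder \<phi> x (1 *\<^sub>R v) $ i = 0" by (rule fun_cong)
  then show ?thesis by simp
qed

text \<open>The blowdown map in a blowup chart; \<open>unblow\<close> is its inverse off the
  divisor.\<close>

definition blow :: "'n set \<Rightarrow> 'n \<Rightarrow> real ^ 'n \<Rightarrow> real ^ ('n::finite)" where
  "blow I i x = (\<chi> j. if j \<in> I - {i} then x $ i * x $ j else x $ j)"

definition unblow :: "'n set \<Rightarrow> 'n \<Rightarrow> real ^ 'n \<Rightarrow> real ^ ('n::finite)" where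
  "unblow I i x = (\<chi> j. if j \<in> I - {i} then x $ j / x $ i else x $ j)"

lemma blow_nth: "blow I i x $ j = (if j \<in> I - {i} then x $ i * x $ j else x $ j)"
  by (simp add: blow_def)

lemma blow_unblow: "x $ i \<noteq> 0 \<Longrightarrow> blow I i (unblow I i x) = x" "x $ i \<noteq> 0 \<Longrightarrow> unblow I i (blow I i x) = x"
  by (auto simp: blow_def unblow_def vec_eq_iff)

lemma smooth_on_blow: "open S \<Longrightarrow> smooth_on S (blow I i)"
proof -
  assume S: "open S"
  have 1: "smooth_on S (\<lambda>x. x $ j)" for j by (rule smooth_on_vec_nth[OF S smooth_on_ident])
  have "smooth_on S (\<lambda>x. if j \<in> I - {i} then x $ i * x $ j else x $ j)" for j
    using smooth_on_mult[OF S 1 1] 1 by (cases "j \<in> I - {i}") auto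
  then show ?thesis unfolding blow_def[abs_def] by (rule smooth_on_vec[OF S])
qed

lemma smooth_on_unblow:
  assumes S: "open S" and z: "\<And>x. x \<in> S \<Longrightarrow> x $ i \<noteq> 0" shows "smooth_on S (unblow I i)"
proof -
  have 1: "smooth_on S (\<lambda>x. x $ j)" for j by (rule smooth_on_vec_nth[OF S smooth_on_ident])
  have "smooth_on S (\<lambda>x. if j \<in> I - {i} then x $ j / x $ i else x $ j)" for j
    using smooth_on_divide[OF S 1 1 z] 1 by (cases "j \<in> I - {i}") auto
  then show ?thesis unfolding unblow_def[abs_def] by (rule smooth_on_vec[OF S])
qed

text \<open>At a point of the divisor this is the image of the \<open>i\<close>-th basis vector
  under the derivative of \<open>blow\<close>, see \<open>fder_blow_axis\<close>: the normal
  direction for which the point stands, scaled to \<open>i\<close>-th component 1.\<close>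

definition blow_dir :: "'n set \<Rightarrow> 'n \<Rightarrow> real ^ 'n \<Rightarrow> real ^ ('n::finite)" where
  "blow_dir I i x = (\<chi> j. if j = i then 1 else if j \<in> I then x $ j else 0)"

lemma fder_blow: "fder (blow I i) x v = (\<chi> j. if j \<in> I - {i} then x $ i * v $ j + v $ i * x $ j else v $ j)"
proof -
  have n: "((\<lambda>x. x $ j) has_derivative (\<lambda>v. v $ j)) (at x)" for j
    by (rule bounded_linear_imp_has_derivative[OF bounded_linear_vec_nth])
  have "((\<lambda>x. if j \<in> I - {i} then x $ i * x $ j else x $ j) has_derivative
      (\<lambda>v. if j \<in> I - {i} then x $ i * v $ j + v $ i * x $ j else v $ j)) (at x)" for j
    using n has_derivative_mult[OF n n] by (cases "j \<in> I - {i}") auto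
  then have "(blow I i has_derivative (\<lambda>v. \<chi> j. if j \<in> I - {i} then x $ i * v $ j + v $ i * x $ j else v $ j)) (at x)"
    unfolding blow_def[abs_def] vec_sum_axis by (intro has_derivative_sum has_derivative_scaleR_left)
  then show ?thesis by (simp only: fder_eqI)
qed

lemma fder_blow_axis: "x $ i = 0 \<Longrightarrow> i \<in> I \<Longrightarrow> fder (blow I i) x (axis i 1) = blow_dir I i x"
  by (auto simp: fder_blow blow_dir_def vec_eq_iff axis_def)

lemma blow_zero: "x $ i = 0 \<Longrightarrow> i \<in> I \<Longrightarrow> l \<in> I \<Longrightarrow> blow I i x $ l = 0"
  by (auto simp: blow_nth)

section \<open>Tangent vectors and projective classes in slice charts\<close>

locale submanifold =
  fixes M :: "('a, 'n::finite) chart set" and N :: "'a set"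
  assumes man: "smooth_manifold M" and clo: "closed_embedded_submanifold M N"
begin

lemma at: "smooth_atlas M" and mx: "max_atlas M = M"
  using man by (auto simp: smooth_manifold_def)

lemma sliceD:
  assumes "slice_chart M N c I"
  shows "c \<in> M" "q \<in> fst c \<Longrightarrow> q \<in> N \<longleftrightarrow> (\<forall>i\<in>I. snd c q $ i = 0)"
  using assms unfolding slice_chart_def by auto

lemma ex_slice: "q \<in> N \<Longrightarrow> \<exists>c I. slice_chart M N c I \<and> q \<in> fst c"
  using clo unfolding closed_embedded_submanifold_def charts_at_def by blast

lemma chart_inv_c: "c \<in> M \<Longrightarrow> q \<in> fst c \<Longrightarrow> chart_inv c (snd c q) = q"
  by (rule chart_inv_snd[OF atlasD(1)[OF at]])

text \<open>\<open>sub_tangent_space\<close> asks for some slice chart. Any other one gives the same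
  condition, since transitions preserve the zero sets of the normal coordinates.\<close>

lemma sub_tangent_iff:
  assumes c: "slice_chart M N c I" and q: "q \<in> fst c" "q \<in> N" and v: "v \<in> tangent_space M q"
  shows "v \<in> sub_tangent_space M N q \<longleftrightarrow> (\<forall>i\<in>I. v c $ i = 0)"
proof
  assume "\<forall>i\<in>I. v c $ i = 0"
  then show "v \<in> sub_tangent_space M N q" using c q v unfolding sub_tangent_space_def by blast
next
  assume "v \<in> sub_tangent_space M N q"
  then obtain d J where d: "slice_chart M N d J" "q \<in> fst d" "\<forall>j\<in>J. v d $ j = 0"
    unfolding sub_tangent_space_def by blast
  note cM = sliceD(1)[OF c] and dM = sliceD(1)[OF d(1)]
  have vc: "v c = fder (snd c \<circ> chart_inv d) (snd d q) (v d)"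
    using tangent_spaceD[OF v charts_atI[OF dM d(2)] charts_atI[OF cM q(1)]] by (simp add: tr_deriv_def)
  show "\<forall>i\<in>I. v c $ i = 0"
  proof
    fix i assume i: "i \<in> I"
    show "v c $ i = 0" unfolding vc
    proof (rule fder_nth_zero_along[OF transition_smooth(2)[OF at dM cM] _ transition_smooth(1)[OF at dM cM] _ _ d(3)])
      show "snd d q \<in> snd d ` (fst d \<inter> fst c)" using d q by blast
      show "\<forall>j\<in>J. snd d q $ j = 0" using sliceD(2)[OF d(1,2)] q by blast
      fix y assume "y \<in> snd d ` (fst d \<inter> fst c)" and y: "\<forall>j\<in>J. y $ j = 0"
      then obtain p where p: "p \<in> fst d" "p \<in> fst c" "y = snd d p" by blast
      have "p \<in> N" using sliceD(2)[OF d(1) p(1)] y p(3) by blast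
      then show "(snd c \<circ> chart_inv d) y $ i = 0"
        using sliceD(2)[OF c p(2)] i chart_inv_c[OF dM p(1)] p(3) by simp
    qed
  qed
qed

lemma normal_class_eqI:
  assumes c: "slice_chart M N c I" and q: "q \<in> fst c" "q \<in> N"
    and u: "u \<in> tangent_space M q" "u' \<in> tangent_space M q" and eq: "\<forall>i\<in>I. u c $ i = u' c $ i"
  shows "normal_class M N q u = normal_class M N q u'"
proof -
  have sub: "normal_class M N q u \<subseteq> normal_class M N q u'"
    if u: "u \<in> tangent_space M q" "u' \<in> tangent_space M q" and eq: "\<forall>i\<in>I. u c $ i = u' c $ i" for u u'
  proof
    fix x assume "x \<in> normal_class M N q u"
    then obtain t where t: "t \<in> sub_tangent_space M N q" "x = tadd u t" unfolding normal_class_def by blast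
    have tT: "t \<in> tangent_space M q" using t(1) unfolding sub_tangent_space_def by blast
    let ?t = "tadd t (tadd u (tscale (- 1) u'))"
    have T: "?t \<in> tangent_space M q" by (intro tadd_in[OF at] tscale_in[OF at] u tT)
    have "\<forall>i\<in>I. t c $ i = 0" using t(1) sub_tangent_iff[OF c q tT] by blast
    then have "?t \<in> sub_tangent_space M N q"
      unfolding sub_tangent_iff[OF c q T] using eq by (simp add: tadd_def tscale_def)
    moreover have "x = tadd u' ?t" unfolding t(2) by (simp add: tadd_def tscale_def fun_eq_iff)
    ultimately show "x \<in> normal_class M N q u'" unfolding normal_class_def by blast
  qed
  show ?thesis using sub[OF u eq] sub[OF u(2,1)] eq by auto
qed

text \<open>Representatives with proportional normal coordinates differ, after rescaling, by a
  vector tangent to \<open>N\<close>.\<close>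

lemma proj_class_eqI:
  assumes c: "slice_chart M N c I" and q: "q \<in> fst c" "q \<in> N"
    and u: "u \<in> tangent_space M q" "u' \<in> tangent_space M q" and r: "r \<noteq> 0" "\<forall>i\<in>I. u c $ i = r * u' c $ i"
  shows "proj_class M N q u = proj_class M N q u'"
proof -
  have eq: "normal_class M N q (tscale s u) = normal_class M N q (tscale (s * r) u')" for s
    by (rule normal_class_eqI[OF c q tscale_in[OF at u(1)] tscale_in[OF at u(2)]])
      (use r(2) in \<open>simp add: tscale_def\<close>)
  show ?thesis unfolding proj_class_def
  proof (intro equalityI subsetI)
    fix x assume "x \<in> {normal_class M N q (tscale r u) |r. r \<noteq> 0}"
    then obtain s where "s \<noteq> 0" "x = normal_class M N q (tscale s u)" by blast
    then show "x \<in> {normal_class M N q (tscale r u') |r. r \<noteq> 0}" unfolding eq using r(1)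
      by (intro CollectI exI[of _ "s * r"]) auto
  next
    fix x assume "x \<in> {normal_class M N q (tscale r u') |r. r \<noteq> 0}"
    then obtain s where "s \<noteq> 0" "x = normal_class M N q (tscale s u')" by blast
    then show "x \<in> {normal_class M N q (tscale r u) |r. r \<noteq> 0}" using eq[of "s / r"] r(1)
      by (intro CollectI exI[of _ "s / r"]) auto
  qed
qed

text \<open>Prepares for the choice hidden in \<open>blup_coord\<close>: whatever member is picked,
  its normal coordinates are proportional to those of \<open>u\<close>.\<close>

lemma proj_class_memD:
  assumes c: "slice_chart M N c I" and q: "q \<in> fst c" "q \<in> N" and u: "u \<in> tangent_space M q"
    and w: "w \<in> \<Union> (proj_class M N q u)"
  shows "w \<in> tangent_space M q" "\<exists>r. r \<noteq> 0 \<and> (\<forall>i\<in>I. w c $ i = r * u c $ i)"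
proof -
  obtain r t where r: "r \<noteq> 0" "t \<in> sub_tangent_space M N q" "w = tadd (tscale r u) t"
    using w unfolding proj_class_def normal_class_def by blast
  have tT: "t \<in> tangent_space M q" using r(2) unfolding sub_tangent_space_def by blast
  have "\<forall>i\<in>I. t c $ i = 0" using r(2) sub_tangent_iff[OF c q tT] by blast
  then show "\<exists>r. r \<noteq> 0 \<and> (\<forall>i\<in>I. w c $ i = r * u c $ i)"
    using r by (intro exI[of _ r]) (simp add: tadd_def tscale_def)
  show "w \<in> tangent_space M q" unfolding r(3) by (intro tadd_in[OF at] tscale_in[OF at] u tT)
qed

lemma proj_class_self:
  assumes c: "slice_chart M N c I" and q: "q \<in> fst c" "q \<in> N" and u: "u \<in> tangent_space M q"
  shows "u \<in> \<Union> (proj_class M N q u)"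
proof -
  have z: "tscale 0 u \<in> tangent_space M q" by (rule tscale_in[OF at u])
  have "tscale 0 u \<in> sub_tangent_space M N q" unfolding sub_tangent_iff[OF c q z] by (simp add: tscale_def)
  moreover have "u = tadd (tscale 1 u) (tscale 0 u)" by (simp add: tadd_def tscale_def)
  ultimately show ?thesis unfolding proj_class_def normal_class_def by (auto intro!: exI[of _ 1])
qed

text \<open>The unknown factor of the member picked by \<open>SOME\<close> cancels in the ratios, so
  any representative gives the coordinates.\<close>

lemma blup_coord_Exc:
  assumes d: "slice_chart M N d J" and q: "q \<in> fst d" "q \<in> N" and j: "j \<in> J"
    and v: "v \<in> tangent_space M q" "v d $ j \<noteq> 0"
  shows "blup_coord d J j (Exc q (proj_class M N q v)) =
    (\<chi> l. if l = j then 0 else if l \<in> J then v d $ l / v d $ j else snd d q $ l)"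
proof -
  define w where "w = (SOME w. w \<in> \<Union> (proj_class M N q v))"
  have "w \<in> \<Union> (proj_class M N q v)" unfolding w_def by (rule someI[where P = "\<lambda>w. w \<in> \<Union> (proj_class M N q v)", OF proj_class_self[OF d q v(1)]])
  from proj_class_memD(2)[OF d q v(1) this] obtain r where r: "r \<noteq> 0" "\<forall>i\<in>J. w d $ i = r * v d $ i" by blast
  have "w d $ l / w d $ j = v d $ l / v d $ j" if "l \<in> J" for l
    using r that j v(2) by simp
  then show ?thesis unfolding blup_coord.simps Let_def w_def[symmetric] by (simp add: vec_eq_iff)
qed

text \<open>The domain is defined with a representative that may differ from \<open>v\<close>;
  proportionality makes the condition independent of it.\<close>

lemma Exc_in_blup_domain:
  assumes d: "slice_chart M N d J" and q: "q \<in> N" and j: "j \<in> J" and v: "v \<in> tangent_space M q"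
  shows "Exc q (proj_class M N q v) \<in> blup_domain M N d j \<longleftrightarrow> q \<in> fst d \<and> v d $ j \<noteq> 0"
proof
  assume "Exc q (proj_class M N q v) \<in> blup_domain M N d j"
  then obtain v' where v': "proj_class M N q v = proj_class M N q v'" "q \<in> fst d" "v' \<in> tangent_space M q" "v' d $ j \<noteq> 0"
    unfolding blup_domain_def by blast
  have "v \<in> \<Union> (proj_class M N q v')" using proj_class_self[OF d v'(2) q v] v'(1) by simp
  from proj_class_memD(2)[OF d v'(2) q v'(3) this] show "q \<in> fst d \<and> v d $ j \<noteq> 0"
    using v' j by auto
next
  assume a: "q \<in> fst d \<and> v d $ j \<noteq> 0"
  then have "v \<notin> sub_tangent_space M N q" using sub_tangent_iff[OF d _ q v] j by blast
  then show "Exc q (proj_class M N q v) \<in> blup_domain M N d j"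
    using a q v unfolding blup_domain_def by blast
qed

lemma Off_in_blup_domain: "Off q \<in> blup_domain M N d j \<longleftrightarrow> q \<in> fst d \<and> q \<notin> N \<and> snd d q $ j \<noteq> 0"
  unfolding blup_domain_def by auto

section \<open>Charts of the blowup and their inverses\<close>

definition gchart :: "('a, 'n) chart \<Rightarrow> 'n set \<Rightarrow> 'n \<Rightarrow> (('a, 'n) blup_point, 'n) chart" where
  "gchart c I i = (blup_domain M N c i, blup_coord c I i)"

definition tchart :: "('a, 'n) chart \<Rightarrow> (('a, 'n) blup_point, 'n) chart" where
  "tchart c = (Off ` fst c, snd c \<circ> blowdown)"

text \<open>The inverse of \<open>gchart c I i\<close>, as \<open>ginv_gchart\<close> and
  \<open>gchart_ginv\<close> confirm. On the divisor the representative of the line is normalised by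
  \<open>dx_i = 1\<close>.\<close>

definition ginv :: "('a, 'n) chart \<Rightarrow> 'n set \<Rightarrow> 'n \<Rightarrow> real ^ 'n \<Rightarrow> ('a, 'n) blup_point" where
  "ginv c I i x = (let q = chart_inv c (blow I i x) in
     if x $ i \<noteq> 0 then Off q else Exc q (proj_class M N q (tvec_of M c q (blow_dir I i x))))"

lemma blup_charts_eq:
  "blup_charts M N = {gchart c I i | c I i. slice_chart M N c I \<and> i \<in> I} \<union> {tchart c | c. c \<in> M \<and> fst c \<inter> N = {}}"
  unfolding blup_charts_def gchart_def tchart_def ..

lemma ginv_gchart:
  assumes c: "slice_chart M N c I" and i: "i \<in> I" and b: "b \<in> fst (gchart c I i)"
  shows "blow I i (snd (gchart c I i) b) \<in> snd c ` fst c"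
    and "ginv c I i (snd (gchart c I i) b) = b"
    and "blow I i (snd (gchart c I i) b) = snd c (blowdown b)"
    and "blowdown b \<in> fst c"
    and "blowdown b \<in> N \<longleftrightarrow> snd (gchart c I i) b $ i = 0"
proof -
  note cM = sliceD(1)[OF c]
  have "(blow I i (snd (gchart c I i) b) \<in> snd c ` fst c \<and> ginv c I i (snd (gchart c I i) b) = b) \<and>
      blow I i (snd (gchart c I i) b) = snd c (blowdown b) \<and> blowdown b \<in> fst c \<and>
      (blowdown b \<in> N \<longleftrightarrow> snd (gchart c I i) b $ i = 0)"
  proof (cases b)
    case (Off q)
    then have q: "q \<in> fst c" "q \<notin> N" "snd c q $ i \<noteq> 0" using b by (auto simp: gchart_def Off_in_blup_domain)
    have s: "snd (gchart c I i) b = unblow I i (snd c q)" by (simp add: gchart_def Off unblow_def)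
    have e: "blow I i (snd (gchart c I i) b) = snd c q" unfolding s by (rule blow_unblow(1)[where x = "snd c q", OF q(3)])
    have n: "snd (gchart c I i) b $ i \<noteq> 0" unfolding s using q(3) by (simp add: unblow_def)
    show ?thesis using q n unfolding e ginv_def Let_def chart_inv_c[OF cM q(1)] by (simp add: Off)
  next
    case (Exc q l)
    then obtain v where v: "l = proj_class M N q v" "q \<in> fst c" "q \<in> N" "v \<in> tangent_space M q" "v c $ i \<noteq> 0"
      using b by (auto simp: gchart_def blup_domain_def)
    have s: "snd (gchart c I i) b = (\<chi> l. if l = i then 0 else if l \<in> I then v c $ l / v c $ i else snd c q $ l)"
      unfolding gchart_def snd_conv Exc v(1) by (rule blup_coord_Exc[OF c v(2,3) i v(4,5)])
    have z: "\<forall>k\<in>I. snd c q $ k = 0" using sliceD(2)[OF c v(2)] v(3) by blast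
    have e: "blow I i (snd (gchart c I i) b) = snd c q"
      unfolding s using z i by (auto simp: vec_eq_iff blow_nth)
    have n: "snd (gchart c I i) b $ i = 0" unfolding s by simp
    let ?w = "tvec_of M c q (blow_dir I i (snd (gchart c I i) b))"
    have cq: "c \<in> charts_at M q" using cM v(2) by (rule charts_atI)
    have "proj_class M N q ?w = proj_class M N q v"
    proof (rule proj_class_eqI[OF c v(2,3) tvec_of_in[OF at cq] v(4)])
      show "1 / v c $ i \<noteq> 0" using v(5) by simp
      show "\<forall>k\<in>I. ?w c $ k = 1 / v c $ i * v c $ k"
        unfolding tvec_of_same[OF at cq] blow_dir_def s using v(5) by auto
    qed
    then have "ginv c I i (snd (gchart c I i) b) = b"
      unfolding ginv_def Let_def e chart_inv_c[OF cM v(2)] using n by (simp add: Exc v(1))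
    then show ?thesis using e v(2,3) n Exc by auto
  qed
  then show "blow I i (snd (gchart c I i) b) \<in> snd c ` fst c" "ginv c I i (snd (gchart c I i) b) = b"
    "blow I i (snd (gchart c I i) b) = snd c (blowdown b)" "blowdown b \<in> fst c"
    "blowdown b \<in> N \<longleftrightarrow> snd (gchart c I i) b $ i = 0"
    by simp_all
qed

lemma gchart_ginv:
  assumes c: "slice_chart M N c I" and i: "i \<in> I" and x: "blow I i x \<in> snd c ` fst c"
  shows "ginv c I i x \<in> fst (gchart c I i)" "snd (gchart c I i) (ginv c I i x) = x"
proof -
  note cM = sliceD(1)[OF c]
  let ?q = "chart_inv c (blow I i x)"
  have q: "?q \<in> fst c" "snd c ?q = blow I i x" using chart_inv_in[OF x] snd_chart_inv[OF x] .
  have cq: "c \<in> charts_at M ?q" using cM q(1) by (rule charts_atI)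
  have "ginv c I i x \<in> fst (gchart c I i) \<and> snd (gchart c I i) (ginv c I i x) = x"
  proof (cases "x $ i = 0")
    case False
    have qi: "snd c ?q $ i \<noteq> 0" unfolding q(2) using False by (simp add: blow_nth)
    have "?q \<notin> N" using sliceD(2)[OF c q(1)] i qi by blast
    moreover have "snd (gchart c I i) (Off ?q) = unblow I i (blow I i x)"
      unfolding gchart_def snd_conv blup_coord.simps q(2) unblow_def ..
    ultimately show ?thesis
      using False q qi blow_unblow(2)[where x=x and i=i and I=I, OF False] by (simp add: ginv_def Let_def gchart_def Off_in_blup_domain)
  next
    case True
    have qN: "?q \<in> N" using sliceD(2)[OF c q(1)] q(2) blow_zero[OF True i] by simp
    let ?w = "tvec_of M c ?q (blow_dir I i x)"
    note w = tvec_of_in[OF at cq] tvec_of_same[OF at cq]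
    have wi: "?w c $ i = 1" unfolding w(2) by (simp add: blow_dir_def)
    have g: "ginv c I i x = Exc ?q (proj_class M N ?q ?w)" using True by (simp add: ginv_def Let_def)
    have "ginv c I i x \<in> fst (gchart c I i)"
      unfolding g gchart_def fst_conv Exc_in_blup_domain[OF c qN i w(1)] using q(1) wi by simp
    moreover have "snd (gchart c I i) (ginv c I i x) = x"
    proof -
      have wi': "?w c $ i \<noteq> 0" using wi by simp
      show ?thesis unfolding g gchart_def snd_conv blup_coord_Exc[OF c q(1) qN i w(1) wi'] wi unfolding w(2) q(2)
        using True by (auto simp: vec_eq_iff blow_dir_def blow_nth)
    qed
    ultimately show ?thesis ..
  qed
  then show "ginv c I i x \<in> fst (gchart c I i)" "snd (gchart c I i) (ginv c I i x) = x" by simp_all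
qed

text \<open>The chart fills the whole preimage under \<open>blow\<close>, divisor included; hence
  its image is open.\<close>

lemma gchart_image:
  assumes "slice_chart M N c I" "i \<in> I"
  shows "snd (gchart c I i) ` fst (gchart c I i) = {x. blow I i x \<in> snd c ` fst c}"
  using ginv_gchart(1)[OF assms] gchart_ginv[OF assms] by (force simp: image_iff)

lemma open_blow_vimage: "open S \<Longrightarrow> open {x. blow I i x \<in> S}"
  using open_vimage[of S "blow I i"] smooth_on_continuous[OF smooth_on_blow[of UNIV I i]] by (simp add: vimage_def)

lemma is_chart_gchart:
  assumes c: "slice_chart M N c I" "i \<in> I" shows "is_chart (gchart c I i)"
  unfolding is_chart_def
proof
  show "inj_on (snd (gchart c I i)) (fst (gchart c I i))" by (rule inj_on_inverseI[of _ "ginv c I i"]) (rule ginv_gchart(2)[OF c])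
  show "open (snd (gchart c I i) ` fst (gchart c I i))"
    unfolding gchart_image[OF c] using atlasD(1)[OF at sliceD(1)[OF c(1)]] by (intro open_blow_vimage) (simp add: is_chart_def)
qed

lemma chart_inv_gchart:
  assumes c: "slice_chart M N c I" "i \<in> I" and x: "blow I i x \<in> snd c ` fst c"
  shows "chart_inv (gchart c I i) x = ginv c I i x"
  using chart_inv_snd[OF is_chart_gchart[OF c] gchart_ginv(1)[OF c x]] gchart_ginv(2)[OF c x] by simp

lemma blowdown_ginv [simp]: "blowdown (ginv c I i x) = chart_inv c (blow I i x)"
  by (simp add: ginv_def Let_def)

lemma is_chart_tchart: "c \<in> M \<Longrightarrow> is_chart (tchart c)"
  using atlasD(1)[OF at, of c] by (auto simp: is_chart_def tchart_def image_image inj_on_def)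

lemma tchart_image: "snd (tchart c) ` Off ` V = snd c ` V"
  by (simp add: tchart_def image_image)

lemma chart_inv_tchart: "c \<in> M \<Longrightarrow> x \<in> snd c ` fst c \<Longrightarrow> chart_inv (tchart c) x = Off (chart_inv c x)"
  using chart_inv_snd[OF is_chart_tchart, of c "Off (chart_inv c x)"] chart_inv_in[of x c] snd_chart_inv[of x c]
  by (simp add: tchart_def)

section \<open>Compatibility of the blowup charts, one direction at a time\<close>

definition half_compatible :: "(('a, 'n) blup_point, 'n) chart \<Rightarrow> (('a, 'n) blup_point, 'n) chart \<Rightarrow> bool" where
  "half_compatible X Y \<longleftrightarrow> open (snd X ` (fst X \<inter> fst Y)) \<and> smooth_on (snd X ` (fst X \<inter> fst Y)) (snd Y \<circ> chart_inv X)"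

lemma compatible_half: "compatible X Y \<longleftrightarrow> half_compatible X Y \<and> half_compatible Y X"
  by (auto simp: compatible_def half_compatible_def Int_commute)

lemma half_tt:
  assumes c: "c \<in> M" "d \<in> M" shows "half_compatible (tchart c) (tchart d)"
proof -
  have "fst (tchart c) \<inter> fst (tchart d) = Off ` (fst c \<inter> fst d)" by (auto simp: tchart_def)
  then have im: "snd (tchart c) ` (fst (tchart c) \<inter> fst (tchart d)) = snd c ` (fst c \<inter> fst d)" by (simp add: tchart_image)
  show ?thesis unfolding half_compatible_def im
  proof
    show "open (snd c ` (fst c \<inter> fst d))" by (rule transition_smooth(2)[OF at c])
    then show "smooth_on (snd c ` (fst c \<inter> fst d)) (snd (tchart d) \<circ> chart_inv (tchart c))"
      by (rule smooth_on_cong[OF _ _ transition_smooth(1)[OF at c]]) (auto simp: chart_inv_tchart[OF c(1)], simp add: tchart_def)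
  qed
qed

text \<open>The overlap consists of points off the divisor, and the transition is one of
  \<open>M\<close> followed by \<open>unblow\<close>.\<close>

lemma half_tg:
  assumes c: "c \<in> M" "fst c \<inter> N = {}" and d: "slice_chart M N d J" "j \<in> J"
  shows "half_compatible (tchart c) (gchart d J j)"
proof -
  note dM = sliceD(1)[OF d(1)]
  let ?\<phi> = "snd d \<circ> chart_inv c" and ?V = "{q \<in> fst c \<inter> fst d. snd d q $ j \<noteq> 0}"
  let ?W = "snd c ` (fst c \<inter> fst d)"
  have "fst (tchart c) \<inter> fst (gchart d J j) = Off ` ?V"
    using c(2) by (auto simp: tchart_def gchart_def Off_in_blup_domain)
  then have im: "snd (tchart c) ` (fst (tchart c) \<inter> fst (gchart d J j)) = snd c ` ?V" by (simp add: tchart_image)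
  have eq: "snd c ` ?V = ?W \<inter> ?\<phi> -` {y. y $ j \<noteq> 0}" using chart_inv_c[OF c(1)] by auto
  have o1: "open {y :: real ^ 'n. y $ j \<noteq> 0}" by (intro open_Collect_neq continuous_intros)
  have o: "open (snd c ` ?V)" unfolding eq
    by (rule continuous_open_preimage[OF smooth_on_continuous[OF transition_smooth(1)[OF at c(1) dM]] transition_smooth(2)[OF at c(1) dM] o1])
  have s: "smooth_on (snd c ` ?V) (\<lambda>x. unblow J j (?\<phi> x))"
  proof (rule smooth_on_compose[where f = "?\<phi>" and g = "unblow J j", OF o])
    show "smooth_on (snd c ` ?V) ?\<phi>" by (rule smooth_on_subset[OF transition_smooth(1)[OF at c(1) dM]]) auto
    show "smooth_on {y. y $ j \<noteq> 0} (unblow J j)" by (rule smooth_on_unblow[OF o1]) simp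
    show "?\<phi> ` snd c ` ?V \<subseteq> {y. y $ j \<noteq> 0}" unfolding eq by blast
  qed
  show ?thesis unfolding half_compatible_def im
  proof
    show "open (snd c ` ?V)" by (rule o)
    show "smooth_on (snd c ` ?V) (snd (gchart d J j) \<circ> chart_inv (tchart c))"
    proof (rule smooth_on_cong[OF o _ s])
      fix x assume "x \<in> snd c ` ?V"
      then obtain q where q: "q \<in> fst c" "q \<in> fst d" "x = snd c q" by blast
      have "chart_inv (tchart c) x = Off q" using chart_inv_tchart[OF c(1), of x] q chart_inv_c[OF c(1) q(1)] by auto
      then show "unblow J j (?\<phi> x) = (snd (gchart d J j) \<circ> chart_inv (tchart c)) x"
        using chart_inv_c[OF c(1) q(1)] q by (simp add: gchart_def unblow_def)
    qed
  qed
qed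

text \<open>Since \<open>fst d\<close> avoids \<open>N\<close>, the overlap lies off the divisor and
  the transition is \<open>blow\<close> followed by one of \<open>M\<close>.\<close>

lemma half_gt:
  assumes c: "slice_chart M N c I" "i \<in> I" and d: "d \<in> M" "fst d \<inter> N = {}"
  shows "half_compatible (gchart c I i) (tchart d)"
proof -
  note cM = sliceD(1)[OF c(1)]
  let ?\<phi> = "snd d \<circ> chart_inv c" and ?W = "snd c ` (fst c \<inter> fst d)" and ?O = "{x. blow I i x \<in> snd c ` (fst c \<inter> fst d)}"
  have o: "open ?O" by (rule open_blow_vimage[OF transition_smooth(2)[OF at cM d(1)]])
  have in1: "blow I i x \<in> snd c ` fst c" if "x \<in> ?O" for x using that by blast
  have gi: "ginv c I i x = Off (chart_inv c (blow I i x)) \<and> chart_inv c (blow I i x) \<in> fst d" if x: "x \<in> ?O" for x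
  proof -
    obtain q where q: "q \<in> fst c" "q \<in> fst d" "blow I i x = snd c q" using x by blast
    have e: "chart_inv c (blow I i x) = q" unfolding q(3) by (rule chart_inv_c[OF cM q(1)])
    have "q \<notin> N" using q(2) d(2) by blast
    then have "x $ i \<noteq> 0" using sliceD(2)[OF c(1) q(1)] blow_zero[OF _ c(2)] unfolding q(3)[symmetric] by blast
    then show ?thesis using q(2) e by (simp add: ginv_def Let_def)
  qed
  have im: "snd (gchart c I i) ` (fst (gchart c I i) \<inter> fst (tchart d)) = ?O"
  proof (intro equalityI subsetI)
    fix x assume "x \<in> snd (gchart c I i) ` (fst (gchart c I i) \<inter> fst (tchart d))"
    then obtain b where b: "b \<in> fst (gchart c I i)" "b \<in> fst (tchart d)" "x = snd (gchart c I i) b" by blast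
    have "blowdown b \<in> fst d" using b(2) by (auto simp: tchart_def)
    then show "x \<in> ?O" using ginv_gchart(3,4)[OF c b(1)] b(3) by auto
  next
    fix x assume x: "x \<in> ?O"
    then have "ginv c I i x \<in> fst (tchart d)" using gi by (auto simp: tchart_def)
    then show "x \<in> snd (gchart c I i) ` (fst (gchart c I i) \<inter> fst (tchart d))"
      using gchart_ginv[OF c in1[OF x]] by (metis IntI image_eqI)
  qed
  have s: "smooth_on ?O (\<lambda>x. ?\<phi> (blow I i x))"
    by (rule smooth_on_compose[OF o smooth_on_blow[OF o] transition_smooth(1)[OF at cM d(1)]]) auto
  show ?thesis unfolding half_compatible_def im
  proof
    show "open ?O" by (rule o)
    show "smooth_on ?O (snd (tchart d) \<circ> chart_inv (gchart c I i))"
      by (rule smooth_on_cong[OF o _ s]) (use gi in1 chart_inv_gchart[OF c] in \<open>simp add: tchart_def\<close>)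
  qed
qed

text \<open>The normal coordinates of the second chart vanish on the exceptional divisor and are divided
  by the equation \<open>x\<^sub>i\<close> of the latter.\<close>

lemma half_gg:
  assumes c: "slice_chart M N c I" "i \<in> I" and d: "slice_chart M N d J" "j \<in> J"
  shows "half_compatible (gchart c I i) (gchart d J j)"
proof -
  note cM = sliceD(1)[OF c(1)] and dM = sliceD(1)[OF d(1)]
  let ?\<phi> = "snd d \<circ> chart_inv c" and ?W = "snd c ` (fst c \<inter> fst d)" and ?O = "{x. blow I i x \<in> snd c ` (fst c \<inter> fst d)}"
  have o: "open ?O" by (rule open_blow_vimage[OF transition_smooth(2)[OF at cM dM]])
  define F where "F x = ?\<phi> (blow I i x)" for x
  have sF: "smooth_on ?O F" unfolding F_def[abs_def]
    by (rule smooth_on_compose[OF o smooth_on_blow[OF o] transition_smooth(1)[OF at cM dM]]) auto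
  have pt: "chart_inv c (blow I i x) \<in> fst c \<and> chart_inv c (blow I i x) \<in> fst d \<and> snd c (chart_inv c (blow I i x)) = blow I i x
      \<and> F x = snd d (chart_inv c (blow I i x)) \<and> (chart_inv c (blow I i x) \<in> N \<longleftrightarrow> x $ i = 0)" if x: "x \<in> ?O" for x
  proof -
    obtain q where q: "q \<in> fst c" "q \<in> fst d" "blow I i x = snd c q" using x by blast
    have e: "chart_inv c (blow I i x) = q" unfolding q(3) by (rule chart_inv_c[OF cM q(1)])
    have "q \<in> N \<longleftrightarrow> x $ i = 0" using sliceD(2)[OF c(1) q(1)] blow_zero[OF _ c(2), of x] c(2) unfolding q(3)[symmetric]
      by (auto simp: blow_nth)
    then show ?thesis using e q by (simp add: F_def)
  qed
  \<comment> \<open>The quotient \<open>F x $ l / x $ i\<close>, continued over the divisor by a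
    derivative; it is smooth for \<open>l\<close> in \<open>J\<close>, where the numerator vanishes
    on the divisor.\<close>
  define g where "g l x = (if x $ i = 0 then fder (\<lambda>y. F y $ l) x (axis i 1) else F x $ l / x $ i)" for l x
  have sFl: "smooth_on ?O (\<lambda>x. F x $ l)" for l by (rule smooth_on_vec_nth[OF o sF])
  have sg: "smooth_on ?O (g l)" if l: "l \<in> J" for l
    unfolding g_def[abs_def]
  proof (rule smooth_on_divide_coord[OF o sFl])
    fix x assume x: "x \<in> ?O" "x $ i = 0"
    show "F x $ l = 0" using pt[OF x(1)] x(2) sliceD(2)[OF d(1), of "chart_inv c (blow I i x)"] l by simp
  qed
  \<comment> \<open>Non-vanishing of \<open>g j\<close> describes the domain of the second chart
    uniformly, on the divisor and off it.\<close>
  let ?P = "?O \<inter> g j -` (- {0})"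
  have oP: "open ?P" by (rule continuous_open_preimage[OF smooth_on_continuous[OF sg[OF d(2)]] o open_Compl[OF closed_singleton]])
  have exc: "ginv c I i x \<in> fst (gchart d J j) \<longleftrightarrow> g j x \<noteq> 0"
    "g j x \<noteq> 0 \<Longrightarrow> snd (gchart d J j) (ginv c I i x) = (\<chi> l. if l \<in> J - {j} then g l x / g j x else F x $ l)"
    if x: "x \<in> ?O" for x
  proof -
    let ?q = "chart_inv c (blow I i x)"
    note p = pt[OF x]
    have "(ginv c I i x \<in> fst (gchart d J j) \<longleftrightarrow> g j x \<noteq> 0) \<and>
      (g j x \<noteq> 0 \<longrightarrow> snd (gchart d J j) (ginv c I i x) = (\<chi> l. if l \<in> J - {j} then g l x / g j x else F x $ l))"
    proof (cases "x $ i = 0")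
      case False
      then show ?thesis using p
        by (simp add: ginv_def Let_def gchart_def Off_in_blup_domain g_def vec_eq_iff)
    next
      case True
      have qN: "?q \<in> N" using p True by blast
      have cq: "c \<in> charts_at M ?q" and dq: "d \<in> charts_at M ?q" using p cM dM by (auto intro: charts_atI)
      let ?w = "tvec_of M c ?q (blow_dir I i x)"
      have w: "?w \<in> tangent_space M ?q" by (rule tvec_of_in[OF at cq])
      have gi: "ginv c I i x = Exc ?q (proj_class M N ?q ?w)" using True by (simp add: ginv_def Let_def)
      \<comment> \<open>By the chain rule the derivative defining \<open>g\<close> on the divisor
        gives the coordinates, in the chart \<open>d\<close>, of the representative of the line;
        their ratios are the coordinates of the exceptional point in the second chart.\<close>
      have "fder F x (axis i 1) = fder ?\<phi> (blow I i x) (fder (blow I i) x (axis i 1))"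
        unfolding F_def[abs_def]
        by (rule fder_compose[OF smooth_on_differentiable[OF smooth_on_blow[OF open_UNIV] UNIV_I]
              smooth_on_differentiable[OF transition_smooth(1)[OF at cM dM]]]) (use x in blast)
      also have "\<dots> = ?w d" unfolding fder_blow_axis[OF True c(2)] tvec_of_coord[OF dq] tr_deriv_def using p by simp
      finally have Fw: "fder F x (axis i 1) = ?w d" .
      have gw: "g l x = ?w d $ l" for l
        using fder_eqI[OF bounded_linear.has_derivative[OF bounded_linear_vec_nth smooth_on_has_derivative[OF sF x]], of l]
        unfolding g_def Fw[symmetric] using True by simp
      have e1: "ginv c I i x \<in> fst (gchart d J j) \<longleftrightarrow> g j x \<noteq> 0"
        unfolding gi gw gchart_def fst_conv Exc_in_blup_domain[OF d(1) qN d(2) w] using p by blast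
      have "snd (gchart d J j) (ginv c I i x) = (\<chi> l. if l \<in> J - {j} then g l x / g j x else F x $ l)" if "g j x \<noteq> 0"
      proof -
        have qd: "?q \<in> fst d" using p by blast
        have Fj: "F x $ j = 0" using sliceD(2)[OF d(1) qd] qN p d(2) by simp
        show ?thesis unfolding gi gchart_def snd_conv blup_coord_Exc[OF d(1) qd qN d(2) w that[unfolded gw]] gw
          using p Fj d(2) by (auto simp: vec_eq_iff)
      qed
      then show ?thesis using e1 by blast
    qed
    then show "ginv c I i x \<in> fst (gchart d J j) \<longleftrightarrow> g j x \<noteq> 0"
    "g j x \<noteq> 0 \<Longrightarrow> snd (gchart d J j) (ginv c I i x) = (\<chi> l. if l \<in> J - {j} then g l x / g j x else F x $ l)" by blast+
  qed
  have in1: "blow I i x \<in> snd c ` fst c" if "x \<in> ?O" for x using that by blast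
  have im: "snd (gchart c I i) ` (fst (gchart c I i) \<inter> fst (gchart d J j)) = ?P"
  proof (intro equalityI subsetI)
    fix x assume "x \<in> snd (gchart c I i) ` (fst (gchart c I i) \<inter> fst (gchart d J j))"
    then obtain b where b: "b \<in> fst (gchart c I i)" "b \<in> fst (gchart d J j)" "x = snd (gchart c I i) b" by blast
    have "x \<in> ?O" using ginv_gchart(3,4)[OF c b(1)] ginv_gchart(4)[OF d b(2)] b(3) by auto
    then have xO: "x \<in> ?O" .
    have "ginv c I i x \<in> fst (gchart d J j)" using ginv_gchart(2)[OF c b(1)] b(2,3) by simp
    then have "g j x \<noteq> 0" unfolding exc(1)[OF xO] .
    then show "x \<in> ?P" using xO by blast
  next
    fix x assume x: "x \<in> ?P"
    then have "ginv c I i x \<in> fst (gchart d J j)" using exc(1) by blast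
    then show "x \<in> snd (gchart c I i) ` (fst (gchart c I i) \<inter> fst (gchart d J j))"
      using gchart_ginv[OF c in1] x by (metis IntD1 IntI image_eqI)
  qed
  have sP: "smooth_on ?P (g l)" if "l \<in> J" for l by (rule smooth_on_subset[OF sg[OF that]]) auto
  have sl: "smooth_on ?P (\<lambda>x. if l \<in> J - {j} then g l x / g j x else F x $ l)" for l
  proof (cases "l \<in> J - {j}")
    case True
    then show ?thesis using smooth_on_divide[OF oP sP sP[OF d(2)], of l] by auto
  next
    case False
    have "smooth_on ?P (\<lambda>x. F x $ l)" by (rule smooth_on_subset[OF sFl]) auto
    then show ?thesis by (simp only: False if_False)
  qed
  have s: "smooth_on ?P (\<lambda>x. \<chi> l. if l \<in> J - {j} then g l x / g j x else F x $ l)" by (rule smooth_on_vec[OF oP sl])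
  show ?thesis unfolding half_compatible_def im
  proof
    show "open ?P" by (rule oP)
    show "smooth_on ?P (snd (gchart d J j) \<circ> chart_inv (gchart c I i))"
    proof (rule smooth_on_cong[OF oP _ s])
      fix x assume "x \<in> ?P"
      then have x: "x \<in> ?O" "g j x \<noteq> 0" by auto
      show "(\<chi> l. if l \<in> J - {j} then g l x / g j x else F x $ l) = (snd (gchart d J j) \<circ> chart_inv (gchart c I i)) x"
        using exc(2)[OF x] chart_inv_gchart[OF c in1[OF x(1)]] by simp
    qed
  qed
qed

lemma blup_chart_cases:
  assumes "X \<in> blup_charts M N"
  shows "(\<exists>c I i. X = gchart c I i \<and> slice_chart M N c I \<and> i \<in> I) \<or> (\<exists>c. X = tchart c \<and> c \<in> M \<and> fst c \<inter> N = {})"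
  using assms unfolding blup_charts_eq by blast

lemma smooth_atlas_blup_charts: "smooth_atlas (blup_charts M N)"
proof -
  have ch: "is_chart X" if "X \<in> blup_charts M N" for X
    using blup_chart_cases[OF that] by (elim disjE exE conjE) (simp_all only: is_chart_gchart is_chart_tchart)
  have "half_compatible X Y" if "X \<in> blup_charts M N" "Y \<in> blup_charts M N" for X Y
    using blup_chart_cases[OF that(1)] blup_chart_cases[OF that(2)]
    by (elim disjE exE conjE) (simp_all only: half_tt half_tg half_gt half_gg)
  then show ?thesis unfolding smooth_atlas_def using ch by (simp add: compatible_half)
qed

end

section \<open>The blowup as a manifold\<close>

text \<open>Preimages of a countable base of the coordinate space under countably many covering
  charts form a base.\<close>

lemma second_countable_mtop:
  fixes A :: "('a, 'n::finite) chart set"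
  assumes A: "smooth_atlas A" and C: "countable C" "C \<subseteq> A" "points A \<subseteq> \<Union> (fst ` C)"
  shows "second_countable (mtop A)"
proof -
  obtain T :: "(real ^ 'n) set set" where T: "countable T" "topological_basis T" using ex_countable_basis by blast
  let ?V = "\<lambda>c S. {q \<in> fst c. snd c q \<in> S}"
  have o: "openin (mtop A) (?V c S)" if "c \<in> C" "S \<in> T" for c S
    by (rule openin_chart_preimage[OF A]) (use that C topological_basis_open[OF T(2)] in auto)
  show ?thesis unfolding second_countable_def
  proof (intro exI[of _ "(\<lambda>(c, S). ?V c S) ` (C \<times> T)"] conjI ballI allI impI)
    show "countable ((\<lambda>(c, S). ?V c S) ` (C \<times> T))" using C(1) T(1) by (intro countable_image countable_SIGMA)
    show "openin (mtop A) V" if "V \<in> (\<lambda>(c, S). ?V c S) ` (C \<times> T)" for V using that o by auto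
    fix U x assume U: "openin (mtop A) U \<and> x \<in> U"
    then have "x \<in> points A" using openin_mtop[OF A] by blast
    then obtain c where c: "c \<in> C" "x \<in> fst c" using C(3) by blast
    note ch = atlasD(1)[OF A subsetD[OF C(2) c(1)]]
    have "open (snd c ` (fst c \<inter> U))" using open_chart_Int[OF A subsetD[OF C(2) c(1)]] U by blast
    then obtain S where S: "S \<in> T" "snd c x \<in> S" "S \<subseteq> snd c ` (fst c \<inter> U)"
      using topological_basisE[OF T(2)] c(2) U by (metis IntI imageI)
    have "?V c S \<subseteq> U"
    proof
      fix q assume "q \<in> ?V c S"
      then have q: "q \<in> fst c" "snd c q \<in> snd c ` (fst c \<inter> U)" using S(3) by auto
      then show "q \<in> U" using chart_image_iff[OF ch q(1), of "fst c \<inter> U"] by auto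
    qed
    then show "\<exists>V\<in>(\<lambda>(c, S). ?V c S) ` (C \<times> T). x \<in> V \<and> V \<subseteq> U"
      using c S by (intro bexI[of _ "?V c S"]) auto
  qed
qed

lemma chart_separation:
  assumes A: "smooth_atlas A" and c: "c \<in> A" and x: "x \<in> fst c" "y \<in> fst c" "x \<noteq> y"
  shows "\<exists>U V. openin (mtop A) U \<and> openin (mtop A) V \<and> x \<in> U \<and> y \<in> V \<and> disjnt U V"
proof -
  have "snd c x \<noteq> snd c y"
    using chart_inv_snd[OF atlasD(1)[OF A c] x(1)] chart_inv_snd[OF atlasD(1)[OF A c] x(2)] x(3) by auto
  from hausdorff[OF this] obtain S T where S: "open S" "open T" "snd c x \<in> S" "snd c y \<in> T" "S \<inter> T = {}"
    by (elim exE conjE)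
  let ?U = "{q \<in> fst c. snd c q \<in> S}" and ?V = "{q \<in> fst c. snd c q \<in> T}"
  have "disjnt ?U ?V" using S(5) unfolding disjnt_def by blast
  then show ?thesis using openin_chart_preimage[OF A c S(1)] openin_chart_preimage[OF A c S(2)] S(3,4) x(1,2)
    by (intro exI[of _ ?U] exI[of _ ?V]) simp
qed

context submanifold
begin

abbreviation B :: "(('a, 'n) blup_point, 'n) chart set" where "B \<equiv> blowup M N"

lemma B_at: "smooth_atlas B"
  unfolding blowup_def by (rule smooth_atlas_max_atlas[OF smooth_atlas_blup_charts])

lemma B_mx: "max_atlas B = B"
  unfolding blowup_def by (rule max_atlas_idem[OF smooth_atlas_blup_charts])

lemma blup_charts_B: "blup_charts M N \<subseteq> B"
  unfolding blowup_def by (rule max_atlas_superset[OF smooth_atlas_blup_charts])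

lemma gchart_B: "slice_chart M N c I \<Longrightarrow> i \<in> I \<Longrightarrow> gchart c I i \<in> B"
  using blup_charts_B unfolding blup_charts_eq by blast

lemma tchart_B: "c \<in> M \<Longrightarrow> fst c \<inter> N = {} \<Longrightarrow> tchart c \<in> B"
  using blup_charts_B unfolding blup_charts_eq by blast

lemma points_B_cases:
  assumes "b \<in> points B"
  obtains (g) c I i where "slice_chart M N c I" "i \<in> I" "b \<in> fst (gchart c I i)"
  | (t) c where "c \<in> M" "fst c \<inter> N = {}" "b \<in> fst (tchart c)"
proof -
  have "b \<in> points (blup_charts M N)"
    using assms points_max_atlas[OF smooth_atlas_blup_charts] unfolding blowup_def by simp
  then obtain X where X: "X \<in> blup_charts M N" "b \<in> fst X" unfolding points_def by blast
  from blup_chart_cases[OF X(1)] X(2) g t show thesis by (elim disjE exE conjE) simp_all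
qed

text \<open>Closedness of \<open>N\<close> enters here: the part of a chart off \<open>N\<close> is
  open, hence the domain of a chart.\<close>

lemma off_chart:
  assumes "q \<in> points M" "q \<notin> N"
  obtains c where "c \<in> M" "q \<in> fst c" "fst c \<inter> N = {}"
proof -
  obtain c where c: "c \<in> M" "q \<in> fst c" using assms(1) unfolding points_def by blast
  let ?V = "fst c \<inter> (points M - N)"
  have "openin (mtop M) (points M - N)"
    using clo openin_closedin_eq topspace_mtop[OF at] unfolding closed_embedded_submanifold_def
    by (metis closedin_def)
  then have "open (snd c ` ?V)" by (rule open_chart_Int[OF at c(1)])
  then have "(?V, snd c) \<in> M" by (intro restrict_chart[OF at mx c(1)]) auto
  then show thesis using that[of "(?V, snd c)"] c assms by auto
qed

lemma blowdown_points:
  assumes "b \<in> points B" shows "blowdown b \<in> points M"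
  using assms
proof (cases rule: points_B_cases)
  case (g c I i)
  then show ?thesis using ginv_gchart(4)[OF g] sliceD(1)[OF g(1)] unfolding points_def by blast
next
  case (t c)
  then show ?thesis by (auto simp: tchart_def points_def)
qed

lemma not_N_Off:
  assumes "b \<in> points B" "blowdown b \<notin> N" shows "b = Off (blowdown b)"
  using assms(1)
proof (cases rule: points_B_cases)
  case (g c I i)
  then show ?thesis using assms(2) by (auto simp: gchart_def blup_domain_def)
qed (auto simp: tchart_def)

lemma Exc_of_N:
  assumes "b \<in> points B" "blowdown b \<in> N"
  obtains q v where "b = Exc q (proj_class M N q v)" "q \<in> N" "v \<in> tangent_space M q" "v \<notin> sub_tangent_space M N q"
  using assms(1)
proof (cases rule: points_B_cases)
  case (g c I i)
  then show ?thesis using assms(2) that by (auto simp: gchart_def blup_domain_def)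
next
  case (t c)
  then show ?thesis using assms(2) by (auto simp: tchart_def)
qed

lemma ex_gchart:
  assumes b: "b \<in> points B" "blowdown b \<in> N" and c: "slice_chart M N c I" "blowdown b \<in> fst c"
  obtains i where "i \<in> I" "b \<in> fst (gchart c I i)"
proof -
  obtain q v where v: "b = Exc q (proj_class M N q v)" "q \<in> N" "v \<in> tangent_space M q" "v \<notin> sub_tangent_space M N q"
    using Exc_of_N[OF b] .
  have qc: "q \<in> fst c" using c(2) v(1) by simp
  obtain i where i: "i \<in> I" "v c $ i \<noteq> 0" using sub_tangent_iff[OF c(1) qc v(2,3)] v(4) by blast
  show thesis by (rule that[OF i(1)]) (use Exc_in_blup_domain[OF c(1) v(2) i(1) v(3)] qc i v(1) in \<open>simp add: gchart_def\<close>)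
qed

lemma map_rep_gchart:
  assumes c: "slice_chart M N c I" "i \<in> I" and x: "blow I i x \<in> snd c ` fst c"
  shows "map_rep (gchart c I i) c blowdown x = blow I i x"
  unfolding map_rep_def o_def chart_inv_gchart[OF c x] using snd_chart_inv[OF x] by simp

lemma map_rep_tchart:
  assumes c: "c \<in> M" and x: "x \<in> snd c ` fst c"
  shows "map_rep (tchart c) c blowdown x = x"
  unfolding map_rep_def o_def chart_inv_tchart[OF c x] using snd_chart_inv[OF x] by simp

lemma open_gchart_image: "slice_chart M N c I \<Longrightarrow> open {x. blow I i x \<in> snd c ` fst c}"
  by (rule open_blow_vimage) (use atlasD(1)[OF at sliceD(1)] in \<open>simp add: is_chart_def\<close>)

lemma smooth_map_blowdown: "smooth_map B M blowdown"
  unfolding smooth_map_def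
proof (intro conjI ballI)
  show "blowdown ` points B \<subseteq> points M" using blowdown_points by blast
  fix b assume "b \<in> points B"
  then show "\<exists>c\<in>charts_at B b. \<exists>d\<in>charts_at M (blowdown b). blowdown ` fst c \<subseteq> fst d \<and>
      smooth_on (snd c ` fst c) (snd d \<circ> blowdown \<circ> chart_inv c)"
  proof (cases rule: points_B_cases)
    case (g c I i)
    let ?G = "gchart c I i"
    have "smooth_on (snd ?G ` fst ?G) (snd c \<circ> blowdown \<circ> chart_inv ?G)"
      unfolding gchart_image[OF g(1,2)]
      by (rule smooth_on_cong[OF open_gchart_image[OF g(1)] _ smooth_on_blow[OF open_gchart_image[OF g(1)]]])
        (use map_rep_gchart[OF g(1,2)] in \<open>simp add: map_rep_def\<close>)
    moreover have "blowdown ` fst ?G \<subseteq> fst c" using ginv_gchart(4)[OF g(1,2)] by blast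
    ultimately show ?thesis
      using charts_atI[OF gchart_B[OF g(1,2)] g(3)] charts_atI[OF sliceD(1)[OF g(1)] ginv_gchart(4)[OF g]] by blast
  next
    case (t c)
    let ?T = "tchart c"
    have im: "snd ?T ` fst ?T = snd c ` fst c" by (simp add: tchart_def image_image)
    have o: "open (snd c ` fst c)" using atlasD(1)[OF at t(1)] by (simp add: is_chart_def)
    have "smooth_on (snd ?T ` fst ?T) (snd c \<circ> blowdown \<circ> chart_inv ?T)"
      unfolding im
      by (rule smooth_on_cong[OF o _ smooth_on_ident]) (use map_rep_tchart[OF t(1)] in \<open>simp add: map_rep_def\<close>)
    moreover have "blowdown ` fst ?T \<subseteq> fst c" by (auto simp: tchart_def)
    moreover have "blowdown b \<in> fst c" using t(3) by (auto simp: tchart_def)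
    ultimately show ?thesis
      using charts_atI[OF tchart_B[OF t(1,2)] t(3)] charts_atI[OF t(1)] by blast
  qed
qed

section \<open>Hausdorff property and second countability of the blowup\<close>

lemma openin_blowdown_vimage:
  assumes V: "openin (mtop M) V" shows "openin (mtop B) {b \<in> points B. blowdown b \<in> V}"
proof (rule openin_mtopI[OF B_at])
  let ?V = "{b \<in> points B. blowdown b \<in> V}"
  fix b assume b: "b \<in> ?V"
  then have "b \<in> points B" by blast
  then show "\<exists>c\<in>B. b \<in> fst c \<and> open (snd c ` (fst c \<inter> ?V))"
  proof (cases rule: points_B_cases)
    case (g c I i)
    let ?G = "gchart c I i"
    have "snd ?G ` (fst ?G \<inter> ?V) = {x. blow I i x \<in> snd c ` (fst c \<inter> V)}"
    proof (intro equalityI subsetI)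
      fix x assume "x \<in> snd ?G ` (fst ?G \<inter> ?V)"
      then obtain a where "a \<in> fst ?G" "blowdown a \<in> V" "x = snd ?G a" by blast
      then show "x \<in> {x. blow I i x \<in> snd c ` (fst c \<inter> V)}" using ginv_gchart(3,4)[OF g(1,2)] by auto
    next
      fix x assume "x \<in> {x. blow I i x \<in> snd c ` (fst c \<inter> V)}"
      then obtain q where q: "q \<in> fst c" "q \<in> V" "blow I i x = snd c q" by blast
      have x: "blow I i x \<in> snd c ` fst c" using q by blast
      have "blowdown (ginv c I i x) = q" using q chart_inv_c[OF sliceD(1)[OF g(1)] q(1)] by simp
      moreover have "ginv c I i x \<in> points B"
        using gchart_ginv(1)[OF g(1,2) x] gchart_B[OF g(1,2)] unfolding points_def by blast
      ultimately show "x \<in> snd ?G ` (fst ?G \<inter> ?V)" using gchart_ginv[OF g(1,2) x] q(2) by (intro rev_image_eqI[of "ginv c I i x"]) auto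
    qed
    moreover have "open {x. blow I i x \<in> snd c ` (fst c \<inter> V)}"
      by (rule open_blow_vimage[OF open_chart_Int[OF at sliceD(1)[OF g(1)] V]])
    ultimately show ?thesis using gchart_B[OF g(1,2)] g(3) by auto
  next
    case (t c)
    have "fst (tchart c) \<subseteq> points B" using tchart_B[OF t(1,2)] unfolding points_def by blast
    then have "fst (tchart c) \<inter> ?V = Off ` (fst c \<inter> V)" by (auto simp: tchart_def)
    then have "snd (tchart c) ` (fst (tchart c) \<inter> ?V) = snd c ` (fst c \<inter> V)" by (simp add: tchart_image)
    then show ?thesis using open_chart_Int[OF at t(1) V] tchart_B[OF t(1,2)] t(3) by auto
  qed
qed

text \<open>The coordinates are \<open>x_j / x_i\<close> and \<open>x_i / x_j\<close>, with
  components of a normal vector instead of \<open>x\<close> on the divisor.\<close>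

lemma gchart_ratio:
  assumes c: "slice_chart M N c I" and ij: "i \<in> I" "j \<in> I" "i \<noteq> j"
    and b: "b \<in> fst (gchart c I i)" "b \<in> fst (gchart c I j)"
  shows "snd (gchart c I i) b $ j * snd (gchart c I j) b $ i = 1"
proof (cases b)
  case (Off q)
  then show ?thesis using b ij by (simp add: gchart_def Off_in_blup_domain)
next
  case (Exc q l)
  then obtain v where v: "l = proj_class M N q v" "q \<in> fst c" "q \<in> N" "v \<in> tangent_space M q" "v c $ i \<noteq> 0"
    using b(1) by (auto simp: gchart_def blup_domain_def)
  have "v c $ j \<noteq> 0" using b(2) Exc_in_blup_domain[OF c v(3) ij(2) v(4)] by (simp add: gchart_def Exc v(1))
  then show ?thesis
    using blup_coord_Exc[OF c v(2,3) ij(1) v(4,5)] blup_coord_Exc[OF c v(2,3) ij(2) v(4)] v(5) ij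
    by (simp add: gchart_def Exc v(1) del: blup_coord.simps)
qed

lemma gchart_zero:
  assumes c: "slice_chart M N c I" and ij: "i \<in> I" "j \<in> I" "i \<noteq> j"
    and b: "b \<in> fst (gchart c I i)" "b \<notin> fst (gchart c I j)" "blowdown b \<in> N"
  shows "snd (gchart c I i) b $ j = 0"
proof -
  obtain q v where v: "b = Exc q (proj_class M N q v)" "q \<in> fst c" "q \<in> N" "v \<in> tangent_space M q" "v c $ i \<noteq> 0"
    using b(1,3) by (auto simp: gchart_def blup_domain_def)
  have "v c $ j = 0" using b(2) Exc_in_blup_domain[OF c v(3) ij(2) v(4)] v(2) by (simp add: gchart_def v(1))
  then show ?thesis
    using blup_coord_Exc[OF c v(2,3) ij(1) v(4,5)] ij by (simp add: gchart_def v(1) del: blup_coord.simps)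
qed

text \<open>Points over different points of \<open>M\<close> are separated there. Two points of one
  projective fibre either share a blowup chart or are separated by reciprocal coordinates.\<close>

lemma Hausdorff_B: "Hausdorff_space (mtop B)"
  unfolding Hausdorff_space_def topspace_mtop[OF B_at]
proof (intro allI impI)
  fix x y assume "x \<in> points B \<and> y \<in> points B \<and> x \<noteq> y"
  then have xy: "x \<in> points B" "y \<in> points B" "x \<noteq> y" by auto
  show "\<exists>U V. openin (mtop B) U \<and> openin (mtop B) V \<and> x \<in> U \<and> y \<in> V \<and> disjnt U V"
  proof (cases "blowdown x = blowdown y")
    case False
    have "Hausdorff_space (mtop M)" using man by (simp add: smooth_manifold_def)
    then obtain U V where UV: "openin (mtop M) U" "openin (mtop M) V" "blowdown x \<in> U" "blowdown y \<in> V" "disjnt U V"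
      using False blowdown_points[OF xy(1)] blowdown_points[OF xy(2)]
      unfolding Hausdorff_space_def topspace_mtop[OF at] by meson
    show ?thesis
      by (rule exI[of _ "{b \<in> points B. blowdown b \<in> U}"], rule exI[of _ "{b \<in> points B. blowdown b \<in> V}"])
        (use UV xy openin_blowdown_vimage in \<open>auto simp: disjnt_def\<close>)
  next
    case True
    have xN: "blowdown x \<in> N" using not_N_Off[OF xy(1)] not_N_Off[OF xy(2)] True xy(3) by auto
    then have yN: "blowdown y \<in> N" using True by simp
    obtain c I where c: "slice_chart M N c I" "blowdown x \<in> fst c" using ex_slice[OF xN] by blast
    obtain i where i: "i \<in> I" "x \<in> fst (gchart c I i)" using ex_gchart[OF xy(1) xN c] .
    obtain j where j: "j \<in> I" "y \<in> fst (gchart c I j)" using ex_gchart[OF xy(2) yN c(1)] c(2) True by auto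
    show ?thesis
    proof (cases "y \<in> fst (gchart c I i) \<or> x \<in> fst (gchart c I j)")
      case True
      then show ?thesis using chart_separation[OF B_at gchart_B[OF c(1) i(1)] i(2) _ xy(3)]
          chart_separation[OF B_at gchart_B[OF c(1) j(1)] _ j(2) xy(3)] by blast
    next
      case False
      then have ne: "i \<noteq> j" using i j by auto
      have z: "snd (gchart c I i) x $ j = 0" "snd (gchart c I j) y $ i = 0"
        using gchart_zero[OF c(1) i(1) j(1) ne i(2) _ xN] gchart_zero[OF c(1) j(1) i(1) ne[symmetric] j(2) _ yN] False by auto
      have o: "open {z :: real ^ 'n. \<bar>z $ k\<bar> < 1}" for k by (intro open_Collect_less continuous_intros)
      \<comment> \<open>At a common point the two coordinates would be smaller than 1 in absolute
        value and yet have product 1.\<close>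
      let ?U = "\<lambda>k l. {b \<in> fst (gchart c I k). snd (gchart c I k) b \<in> {z. \<bar>z $ l\<bar> < 1}}"
      have "disjnt (?U i j) (?U j i)"
        unfolding disjnt_def
      proof (rule equals0I)
        fix b assume b: "b \<in> ?U i j \<inter> ?U j i"
        then have "\<bar>snd (gchart c I i) b $ j\<bar> * \<bar>snd (gchart c I j) b $ i\<bar> < 1 * 1"
          by (intro mult_strict_mono') auto
        then show False using gchart_ratio[OF c(1) i(1) j(1) ne, of b] b by (simp add: abs_mult[symmetric])
      qed
      then show ?thesis using z i j openin_chart_preimage[OF B_at gchart_B[OF c(1) i(1)] o[of j]]
          openin_chart_preimage[OF B_at gchart_B[OF c(1) j(1)] o[of i]]
        by (intro exI[of _ "?U i j"] exI[of _ "?U j i"]) simp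
    qed
  qed
qed

text \<open>A countable subatlas comes from a countable base of \<open>M\<close>: each basic set
  that fits into a suitable chart domain selects one such chart.\<close>

lemma second_countable_B: "second_countable (mtop B)"
proof -
  obtain T where T: "countable T" "\<And>V. V \<in> T \<Longrightarrow> openin (mtop M) V"
    "\<And>U x. openin (mtop M) U \<Longrightarrow> x \<in> U \<Longrightarrow> \<exists>V\<in>T. x \<in> V \<and> V \<subseteq> U"
    using man unfolding smooth_manifold_def second_countable_def by metis
  \<comment> \<open>\<open>P\<close> concerns slice charts around the basic set \<open>V\<close>,
    together with their index sets, and \<open>Q\<close> charts around \<open>V\<close> that avoid
    \<open>N\<close>.\<close>
  define P where "P V s \<longleftrightarrow> slice_chart M N (fst s) (snd s) \<and> V \<subseteq> fst (fst s)" for V and s :: "('a, 'n) chart \<times> 'n set"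
  define Q where "Q V c \<longleftrightarrow> c \<in> M \<and> fst c \<inter> N = {} \<and> V \<subseteq> fst c" for V c
  define s where "s V = (SOME s. P V s)" for V
  define oc where "oc V = (SOME c. Q V c)" for V
  have sP: "P V (s V)" if "\<exists>s. P V s" for V unfolding s_def using that by (rule someI_ex)
  have oQ: "Q V (oc V)" if "\<exists>c. Q V c" for V unfolding oc_def using that by (rule someI_ex)
  let ?G = "(\<lambda>(V, i). gchart (fst (s V)) (snd (s V)) i) ` {(V, i). V \<in> T \<and> (\<exists>s. P V s) \<and> i \<in> snd (s V)}"
  let ?O = "(\<lambda>V. tchart (oc V)) ` {V \<in> T. \<exists>c. Q V c}"
  show ?thesis
  proof (rule second_countable_mtop[OF B_at, of "?G \<union> ?O"])
    have "countable {(V, i :: 'n). V \<in> T \<and> (\<exists>s. P V s) \<and> i \<in> snd (s V)}"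
      by (rule countable_subset[of _ "T \<times> UNIV"]) (use T(1) in \<open>auto intro: countable_SIGMA countable_finite\<close>)
    then show "countable (?G \<union> ?O)" using T(1) by auto
    show "?G \<union> ?O \<subseteq> B"
    proof (intro Un_least image_subsetI)
      fix p assume "p \<in> {(V, i). V \<in> T \<and> (\<exists>s. P V s) \<and> i \<in> snd (s V)}"
      then have "\<exists>s. P (fst p) s" and i: "snd p \<in> snd (s (fst p))" by (simp_all only: mem_Collect_eq split_def)
      note P = sP[OF this(1), unfolded P_def]
      show "(case p of (V, i) \<Rightarrow> gchart (fst (s V)) (snd (s V)) i) \<in> B"
        unfolding split_def by (rule gchart_B[OF conjunct1[OF P] i])
    next
      fix V assume "V \<in> {V \<in> T. \<exists>c. Q V c}"
      then have "\<exists>c. Q V c" by blast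
      note Q = oQ[OF this, unfolded Q_def]
      show "tchart (oc V) \<in> B" by (rule tchart_B[OF conjunct1[OF Q] conjunct1[OF conjunct2[OF Q]]])
    qed
    show "points B \<subseteq> \<Union> (fst ` (?G \<union> ?O))"
    proof
      fix b assume b: "b \<in> points B"
      show "b \<in> \<Union> (fst ` (?G \<union> ?O))"
      proof (cases "blowdown b \<in> N")
        case True
        obtain c I where c: "slice_chart M N c I" "blowdown b \<in> fst c" using ex_slice[OF True] by blast
        obtain V where V: "V \<in> T" "blowdown b \<in> V" "V \<subseteq> fst c"
          using T(3)[OF openin_chart[OF at sliceD(1)[OF c(1)]] c(2)] by blast
        have ex: "\<exists>s. P V s" using c(1) V(3) by (intro exI[of _ "(c, I)"]) (simp add: P_def)
        have s: "slice_chart M N (fst (s V)) (snd (s V))" "blowdown b \<in> fst (fst (s V))"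
          using sP[OF ex] V(2) unfolding P_def by auto
        obtain i where "i \<in> snd (s V)" "b \<in> fst (gchart (fst (s V)) (snd (s V)) i)" using ex_gchart[OF b True s] .
        then show ?thesis using V(1) ex by blast
      next
        case False
        obtain c where c: "c \<in> M" "blowdown b \<in> fst c" "fst c \<inter> N = {}" using off_chart[OF blowdown_points[OF b] False] .
        obtain V where V: "V \<in> T" "blowdown b \<in> V" "V \<subseteq> fst c" using T(3)[OF openin_chart[OF at c(1)] c(2)] by blast
        have ex: "\<exists>c. Q V c" using c V(3) by (intro exI[of _ c]) (simp add: Q_def)
        then have "blowdown b \<in> fst (oc V)" using oQ[OF ex] V(2) unfolding Q_def by blast
        then have "b \<in> fst (tchart (oc V))" using not_N_Off[OF b False] by (auto simp: tchart_def)
        then show ?thesis using V(1) ex by blast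
      qed
    qed
  qed
qed

lemma manifold_B: "smooth_manifold B"
  unfolding smooth_manifold_def using B_at B_mx Hausdorff_B second_countable_B by blast

text \<open>In a blowup chart the divisor is a coordinate hyperplane, so a small step along the
  \<open>i\<close>-th axis leaves it.\<close>

lemma Off_dense:
  assumes C: "C \<in> charts_at B b" and S: "open S" "snd C b \<in> S"
  obtains b' where "b' \<in> fst C" "snd C b' \<in> S" "blowdown b' \<notin> N"
proof (cases "blowdown b \<in> N")
  case False
  then show thesis using that[of b] charts_atD(2)[OF C] S(2) by blast
next
  case True
  note b = charts_at_points[OF C]
  let ?V = "{q \<in> fst C. snd C q \<in> S}"
  have V: "openin (mtop B) ?V" by (rule openin_chart_preimage[OF B_at charts_atD(1)[OF C] S(1)])
  obtain c I where c: "slice_chart M N c I" "blowdown b \<in> fst c" using ex_slice[OF True] by blast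
  obtain i where i: "i \<in> I" "b \<in> fst (gchart c I i)" using ex_gchart[OF b True c] .
  let ?G = "gchart c I i"
  have "open (snd ?G ` (fst ?G \<inter> ?V))" by (rule open_chart_Int[OF B_at gchart_B[OF c(1) i(1)] V])
  moreover have "snd ?G b \<in> snd ?G ` (fst ?G \<inter> ?V)" using i charts_atD(2)[OF C] S(2) by blast
  ultimately obtain e where e: "e > 0" "ball (snd ?G b) e \<subseteq> snd ?G ` (fst ?G \<inter> ?V)" using openE by blast
  have z: "snd ?G b $ i = 0" using ginv_gchart(5)[OF c(1) i] True by blast
  \<comment> \<open>Half the radius keeps the point inside the ball and its \<open>i\<close>-th
    coordinate away from 0.\<close>
  let ?y = "snd ?G b + (e / 2) *\<^sub>R axis i 1"
  have "?y \<in> ball (snd ?G b) e" using e(1) by (simp add: dist_norm)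
  then obtain b' where b': "b' \<in> fst ?G" "b' \<in> ?V" "?y = snd ?G b'" using e(2) by blast
  have "snd ?G b' $ i \<noteq> 0" unfolding b'(3)[symmetric] using z e(1) by (simp add: axis_def)
  then have "blowdown b' \<notin> N" using ginv_gchart(5)[OF c(1) i(1) b'(1)] by blast
  then show thesis using that b'(2) by blast
qed

lemma zero_by_density:
  fixes f :: "real ^ 'n \<Rightarrow> real"
  assumes C: "C \<in> charts_at B b" and S: "open S" "snd C b \<in> S" and f: "continuous_on S f"
    and z: "\<And>b'. b' \<in> fst C \<Longrightarrow> snd C b' \<in> S \<Longrightarrow> blowdown b' \<notin> N \<Longrightarrow> f (snd C b') = 0"
  shows "f (snd C b) = 0"
proof (rule ccontr)
  assume "f (snd C b) \<noteq> 0"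
  then have x: "snd C b \<in> S \<inter> f -` (- {0})" using S(2) by simp
  have "open (S \<inter> f -` (- {0}))" by (rule continuous_open_preimage[OF f S(1) open_Compl[OF closed_singleton]])
  then obtain b' where "b' \<in> fst C" "snd C b' \<in> S \<inter> f -` (- {0})" "blowdown b' \<notin> N" using Off_dense[OF C _ x] by blast
  then show False using z by blast
qed

text \<open>Over \<open>N\<close> a vector tangent to \<open>N\<close> lifts to the vector with the
  same coordinates in the blowup chart, since the derivative of \<open>blow\<close> at
  \<open>x_i = 0\<close> fixes vectors without normal components; transversality takes care of the
  rest. Off \<open>N\<close> the blowdown has identity derivative in matching charts.\<close>

lemma blowdown_transversal:
  assumes tr: "transversal_for M N L" and LG: "\<And>q. q \<in> points M \<Longrightarrow> L q \<subseteq> gtangent_space M q"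
    and lag: "\<And>D q. D \<in> charts_at M q \<Longrightarrow> lagrangian (gcoords M D q ` L q)"
    and b: "b \<in> points B" and u: "u \<in> tangent_space M (blowdown b)"
  shows "\<exists>w\<in>tangent_space B b. \<exists>l\<in>L (blowdown b). u = tadd (tangent_map B M blowdown b w) (fst l)"
proof (cases "blowdown b \<in> N")
  case True
  obtain t l where t: "t \<in> sub_tangent_space M N (blowdown b)" "l \<in> L (blowdown b)" "u = tadd t (fst l)"
    using tr u True unfolding transversal_for_def by blast
  obtain c I where c: "slice_chart M N c I" "blowdown b \<in> fst c" using ex_slice[OF True] by blast
  obtain i where i: "i \<in> I" "b \<in> fst (gchart c I i)" using ex_gchart[OF b True c] .
  let ?G = "gchart c I i"
  have G: "?G \<in> charts_at B b" by (rule charts_atI[OF gchart_B[OF c(1) i(1)] i(2)])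
  have cq: "c \<in> charts_at M (blowdown b)" by (rule charts_atI[OF sliceD(1)[OF c(1)] c(2)])
  have tT: "t \<in> tangent_space M (blowdown b)" using t(1) unfolding sub_tangent_space_def by blast
  have tz: "\<forall>k\<in>I. t c $ k = 0" using t(1) sub_tangent_iff[OF c True tT] by blast
  have xi: "snd ?G b $ i = 0" using ginv_gchart(5)[OF c(1) i] True by blast
  have x: "snd ?G b \<in> {x. blow I i x \<in> snd c ` fst c}" using ginv_gchart(1)[OF c(1) i] by blast
  have "fder (blow I i) (snd ?G b) = fder (map_rep ?G c blowdown) (snd ?G b)"
    by (rule frechet_derivative_transform_within_open[OF smooth_on_differentiable[OF smooth_on_blow[OF open_UNIV] UNIV_I]
          open_gchart_image[OF c(1)] x]) (use map_rep_gchart[OF c(1) i(1)] in simp)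
  moreover have "fder (blow I i) (snd ?G b) (t c) = t c"
    unfolding fder_blow using tz i(1) xi by (auto simp: vec_eq_iff)
  ultimately have "tangent_map B M blowdown b (tvec_of B ?G b (t c)) = t"
    using tangent_map_tvec_of[OF B_at at smooth_map_blowdown G cq] tangent_eq_tvec_of[OF tT cq] by simp
  then show ?thesis using t(2,3) tvec_of_in[OF B_at G] by metis
next
  case False
  obtain c where c: "c \<in> M" "blowdown b \<in> fst c" "fst c \<inter> N = {}" using off_chart[OF blowdown_points[OF b] False] .
  have bT: "b \<in> fst (tchart c)" using not_N_Off[OF b False] c(2) by (auto simp: tchart_def)
  have T: "tchart c \<in> charts_at B b" by (rule charts_atI[OF tchart_B[OF c(1,3)] bT])
  have cq: "c \<in> charts_at M (blowdown b)" by (rule charts_atI[OF c(1,2)])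
  \<comment> \<open>Off \<open>N\<close> all of \<open>u\<close> is lifted, so the summand from
    \<open>L\<close> is taken to be zero.\<close>
  have "0 \<in> gcoords M c (blowdown b) ` L (blowdown b)" by (rule subspace_0[OF lagrangian_subspace[OF lag[OF cq]]])
  then obtain l where l: "l \<in> L (blowdown b)" "gcoords M c (blowdown b) l = 0" by auto
  have lT: "fst l \<in> tangent_space M (blowdown b)" using LG[OF blowdown_points[OF b]] l(1) by (auto simp: gtangent_space_def)
  have lc: "fst l c = 0" using l(2) by (simp add: gcoords_def zero_prod_def)
  have x: "snd (tchart c) b \<in> snd c ` fst c" using bT by (auto simp: tchart_def)
  have o: "open (snd c ` fst c)" using atlasD(1)[OF at c(1)] by (simp add: is_chart_def)
  have D: "fder (\<lambda>x. x) (snd (tchart c) b) = fder (map_rep (tchart c) c blowdown) (snd (tchart c) b)"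
    by (rule frechet_derivative_transform_within_open[OF differentiable_ident o x]) (use map_rep_tchart[OF c(1)] in simp)
  have tm: "tangent_map B M blowdown b (tvec_of B (tchart c) b (u c)) = u"
    unfolding tangent_map_tvec_of[OF B_at at smooth_map_blowdown T cq] D[symmetric] frechet_derivative_ident
    by (rule tangent_eq_tvec_of[OF u cq, symmetric])
  have "u = tadd u (fst l)" by (rule tangent_eqI[OF u tadd_in[OF at u lT] cq]) (simp add: tadd_def lc)
  then have "u = tadd (tangent_map B M blowdown b (tvec_of B (tchart c) b (u c))) (fst l)" unfolding tm .
  then show ?thesis using l(1) tvec_of_in[OF B_at T] by blast
qed

end

section \<open>The lifted Dirac structure\<close>

text \<open>Locality of the bracket, as naturality under the identity map.\<close>

lemma bracket_cong:
  fixes s t :: "'a::euclidean_space \<Rightarrow> 'a \<times> 'a"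
  assumes S: "open S" "x \<in> S" and d: "s differentiable (at x)" "t differentiable (at x)"
    and eq: "\<And>y. y \<in> S \<Longrightarrow> s' y = s y" "\<And>y. y \<in> S \<Longrightarrow> t' y = t y" and h: "\<And>u v w. h x u v w = h' x u v w"
  shows "bracket_vec s' t' x = bracket_vec s t x" "bracket_form h s t x v = bracket_form h' s' t' x v"
proof -
  have tf: "f' differentiable (at x)" if "f differentiable (at x)" "\<And>y. y \<in> S \<Longrightarrow> f' y = f y" for f f' :: "'a \<Rightarrow> 'a \<times> 'a"
    using has_derivative_transform_within_open[OF fder_works[OF that(1)] S, of f'] that(2)
    unfolding differentiable_def by metis
  have r: "related (\<lambda>x. x) S s s'" "related (\<lambda>x. x) S t t'" using eq by (auto simp: related_def)
  note br = bracket_related[where h = h and h' = h' and \<phi> = "\<lambda>x. x", OF S smooth_on_ident d tf[OF d(1) eq(1)] tf[OF d(2) eq(2)] r]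
  show "bracket_vec s' t' x = bracket_vec s t x" "bracket_form h s t x v = bracket_form h' s' t' x v"
    using br h by simp_all
qed

text \<open>Expresses the pairing through local representatives, which makes its continuity across
  the divisor visible.\<close>

lemma qform_bracket:
  assumes A: "smooth_atlas A" "smooth_form3 A H" "openin (mtop A) U" "p \<in> U"
    "smooth_section A U \<sigma>" "smooth_section A U \<tau>" "c \<in> charts_at A p"
  shows "qform (gcoords A c p (courant_bracket A H \<sigma> \<tau> p)) k =
    bracket_form (form_rep A c H) (sec_rep A c \<sigma>) (sec_rep A c \<tau>) (snd c p) (fst k) +
    snd k \<bullet> bracket_vec (sec_rep A c \<sigma>) (sec_rep A c \<tau>) (snd c p)"
  unfolding qform_def courant_bracket_rep(2)[OF A] courant_bracket_rep(3)[OF A] ..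

lemma bundle_rep_at: "smooth_atlas A \<Longrightarrow> c \<in> charts_at A p \<Longrightarrow> bundle_rep A c L (snd c p) = gcoords A c p ` L p"
  using chart_inv_snd[OF atlasD(1)[OF _ charts_atD(1)] charts_atD(2)] by (metis bundle_rep_def)

lemma dirac_fibres:
  assumes "twisted_dirac A H L"
  shows "p \<in> points A \<Longrightarrow> L p \<subseteq> gtangent_space A p"
    and "c \<in> charts_at A p \<Longrightarrow> lagrangian (gcoords A c p ` L p)"
    and "c \<in> charts_at A p \<Longrightarrow> has_sections (bundle_rep A c L) (snd c p)"
proof -
  have A: "smooth_atlas A" and sub: "smooth_subbundle A L" and max: "maximally_isotropic A L"
    using assms by (auto simp: twisted_dirac_def smooth_manifold_def)
  show "p \<in> points A \<Longrightarrow> L p \<subseteq> gtangent_space A p" using sub unfolding smooth_subbundle_def by blast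
  have lag: "lagrangian (gcoords A c p ` L p)" if c: "c \<in> charts_at A p" for c p
  proof -
    have "isotropic_at A p (L p) \<and> (\<forall>K. isotropic_at A p K \<and> L p \<subseteq> K \<longrightarrow> K = L p)"
      by (rule bspec[OF max[unfolded maximally_isotropic_def] charts_at_points[OF c]])
    then show ?thesis unfolding maximally_isotropic_iff_lagrangian[OF A c] by (rule conjunct2)
  qed
  then show "c \<in> charts_at A p \<Longrightarrow> lagrangian (gcoords A c p ` L p)" .
  show "has_sections (bundle_rep A c L) (snd c p)" if c: "c \<in> charts_at A p"
    by (rule subbundle_has_sections[OF A sub c lagrangian_subspace[OF lag[OF charts_atI[OF charts_atD(1)[OF c]]]]])
qed

lemma pull_id:
  fixes K :: "((real ^ 'n) \<times> (real ^ 'n)) set"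
  shows "pull (\<lambda>x. x) K = K"
proof -
  have "transpose_map (\<lambda>x. x) a = a" for a :: "real ^ 'n" by (simp add: transpose_map_def vec_eq_iff inner_axis)
  then show ?thesis by (auto simp: pull_def)
qed

locale dirac_submanifold = submanifold M N
  for M :: "('a, 'n::finite) chart set" and N :: "'a set" +
  fixes H :: "('a, 'n) form3" and L :: "'a \<Rightarrow> ('a, 'n) gvec set"
  assumes dirac: "twisted_dirac M H L" and transversal: "transversal_for M N L"
begin

definition HB :: "(('a, 'n) blup_point, 'n) form3" where "HB = form3_pullback B M blowdown H"

definition LB :: "('a, 'n) blup_point \<Rightarrow> (('a, 'n) blup_point, 'n) gvec set" where
  "LB = backward_image B M blowdown L"

lemma closed_H: "closed_form3 M H" and subL: "smooth_subbundle M L" and invL: "involutive M H L"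
  using dirac by (auto simp: twisted_dirac_def)

lemma closed_HB: "closed_form3 B HB"
  unfolding HB_def by (rule closed_form3_pullback[OF B_at at smooth_map_blowdown closed_H])

lemma smooth_HB: "smooth_form3 B HB" and smooth_H: "smooth_form3 M H"
  using closed_HB closed_H by (auto simp: closed_form3_def)

lemma LB_sub: "b \<in> points B \<Longrightarrow> LB b \<subseteq> gtangent_space B b"
proof -
  assume b: "b \<in> points B"
  obtain C where C: "C \<in> charts_at B b" using ex_chart_at[OF b] ..
  obtain D where D: "D \<in> charts_at M (blowdown b)" using ex_chart_at[OF blowdown_points[OF b]] ..
  show ?thesis unfolding LB_def
    by (rule backward_image_coords(1)[where L = L, OF B_at at smooth_map_blowdown C D dirac_fibres(1)[OF dirac blowdown_points[OF b]]])
qed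

lemma LB_fibres:
  assumes C: "C \<in> charts_at B b"
  shows "lagrangian (gcoords B C b ` LB b)" "has_sections (bundle_rep B C LB) (snd C b)"
proof -
  note tv = blowdown_transversal[where L = L, OF transversal dirac_fibres(1)[OF dirac] dirac_fibres(2)[OF dirac] charts_at_points[OF C]]
  show "lagrangian (gcoords B C b ` LB b)" unfolding LB_def
    by (rule backward_image_bundle(1)[where L = L, OF B_at at smooth_map_blowdown subL dirac_fibres(2)[OF dirac] tv C])
  show "has_sections (bundle_rep B C LB) (snd C b)" unfolding LB_def
    by (rule backward_image_bundle(2)[where L = L, OF B_at at smooth_map_blowdown subL dirac_fibres(2)[OF dirac] tv C])
qed

lemma fder_map_rep_tchart:
  assumes c: "c \<in> M" and q: "q \<in> fst c"
  shows "fder (map_rep (tchart c) c blowdown) (snd c q) = (\<lambda>v. v)"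
proof -
  have o: "open (snd c ` fst c)" using atlasD(1)[OF at c] by (simp add: is_chart_def)
  have "fder (\<lambda>x. x) (snd c q) = fder (map_rep (tchart c) c blowdown) (snd c q)"
    by (rule frechet_derivative_transform_within_open[OF differentiable_ident o imageI[OF q]]) (simp add: map_rep_tchart[OF c])
  then show ?thesis by simp
qed

text \<open>\<open>tchart c\<close> borrows the coordinates of \<open>c\<close>, so the blowdown is
  the identity in these charts and the backward image does nothing.\<close>

lemma LB_Off:
  assumes c: "c \<in> M" "fst c \<inter> N = {}" and q: "q \<in> fst c"
  shows "gcoords B (tchart c) (Off q) ` LB (Off q) = gcoords M c q ` L q"
proof -
  have T: "tchart c \<in> charts_at B (Off q)" by (rule charts_atI[OF tchart_B[OF c]]) (use q in \<open>simp add: tchart_def\<close>)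
  let ?b = "Off q :: ('a, 'n) blup_point"
  have C: "c \<in> charts_at M (blowdown ?b)" using charts_atI[OF c(1) q] by simp
  have L: "L (blowdown ?b) \<subseteq> gtangent_space M (blowdown ?b)" by (rule dirac_fibres(1)[where L = L, OF dirac charts_at_points[OF C]])
  have s: "snd (tchart c) (Off q) = snd c q" by (simp add: tchart_def)
  show ?thesis unfolding LB_def backward_image_coords(2)[where L = L, OF B_at at smooth_map_blowdown T C L]
      s fder_map_rep_tchart[OF c(1) q] pull_id by simp
qed

text \<open>Sections of the lift off the divisor and sections of \<open>L\<close> have the same
  coordinate representatives, the twists agree too, and so do the brackets.\<close>

lemma involutive_Off:
  assumes U: "openin (mtop B) U" "b \<in> U" and bN: "blowdown b \<notin> N"
    and \<sigma>: "smooth_section B U \<sigma>" and \<tau>: "smooth_section B U \<tau>" and L\<sigma>: "\<And>a. a \<in> U \<Longrightarrow> \<sigma> a \<in> LB a \<and> \<tau> a \<in> LB a"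
  shows "courant_bracket B HB \<sigma> \<tau> b \<in> LB b"
proof -
  have b: "b \<in> points B" using U openin_mtop[OF B_at] by blast
  obtain c where c: "c \<in> M" "blowdown b \<in> fst c" "fst c \<inter> N = {}" using off_chart[OF blowdown_points[OF b] bN] .
  define q0 where "q0 = blowdown b"
  have bq: "b = Off q0" unfolding q0_def by (rule not_N_Off[OF b bN])
  have q0: "q0 \<in> fst c" using c(2) by (simp add: q0_def)
  let ?T = "tchart c"
  have TB: "?T \<in> B" by (rule tchart_B[OF c(1,3)])
  have Tq: "?T \<in> charts_at B (Off q)" if "q \<in> fst c" for q by (rule charts_atI[OF TB]) (use that in \<open>simp add: tchart_def\<close>)
  have cq: "c \<in> charts_at M q" if "q \<in> fst c" for q by (rule charts_atI[OF c(1) that])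
  let ?V = "{q \<in> fst c. Off q \<in> U}"
  have V: "fst ?T \<inter> U = Off ` ?V" by (auto simp: tchart_def)
  have im: "snd ?T ` (fst ?T \<inter> U) = snd c ` ?V" unfolding V by (rule tchart_image)
  have oV: "open (snd c ` ?V)" using open_chart_Int[OF B_at TB U(1)] unfolding im .
  have VM: "openin (mtop M) ?V"
  proof (rule openin_mtopI[OF at])
    show "\<exists>c\<in>M. p \<in> fst c \<and> open (snd c ` (fst c \<inter> ?V))" if "p \<in> ?V" for p
      by (rule bexI[OF _ c(1)]) (use that oV in \<open>simp add: Int_absorb1 Collect_conj_eq Int_assoc[symmetric]\<close>)
  qed
  \<comment> \<open>The section of \<open>M\<close> that has in \<open>c\<close> the coordinates of
    \<open>\<rho>\<close> in \<open>tchart c\<close>.\<close>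
  define lift where "lift \<rho> q = gvec_of M c q (gcoords B ?T (Off q) (\<rho> (Off q)))" for \<rho> :: "('a, 'n) blup_point \<Rightarrow> (('a, 'n) blup_point, 'n) gvec" and q
  have rep: "sec_rep M c (lift \<rho>) x = sec_rep B ?T \<rho> x" if x: "x \<in> snd c ` ?V" for \<rho> x
  proof -
    have xc: "x \<in> snd c ` fst c" using x by blast
    show ?thesis unfolding sec_rep_def lift_def chart_inv_tchart[OF c(1) xc]
      by (rule gcoords_gvec_of[OF at cq[OF chart_inv_in[OF xc]]])
  qed
  have sec: "smooth_section M ?V (lift \<rho>)" if \<rho>: "smooth_section B U \<rho>" for \<rho>
  proof (rule smooth_section_of_chart[OF at c(1) _ oV])
    show "?V \<subseteq> fst c" by blast
    show "lift \<rho> q \<in> gtangent_space M q" if "q \<in> ?V" for q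
      unfolding lift_def by (rule gvec_of_in[OF at cq]) (use that in blast)
    show "smooth_on (snd c ` ?V) (sec_rep M c (lift \<rho>))"
      by (rule smooth_on_cong[OF oV _ smooth_sectionD(2)[OF \<rho> TB, unfolded im]]) (rule rep[symmetric])
  qed
  have inL: "lift \<rho> q \<in> L q" if q: "q \<in> ?V" and \<rho>: "\<rho> (Off q) \<in> LB (Off q)" for \<rho> q
  proof -
    have qc: "q \<in> fst c" using q by blast
    show ?thesis unfolding lift_def gvec_of_mem_iff[OF at cq[OF qc] dirac_fibres(1)[OF dirac charts_at_points[OF cq[OF qc]]]]
        LB_Off[OF c(1,3) qc, symmetric] by (rule imageI[where f = "gcoords B ?T (Off q)", OF \<rho>])
  qed
  have q0V: "q0 \<in> ?V" using q0 U(2) bq by simp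
  have "\<forall>q\<in>?V. lift \<sigma> q \<in> L q \<and> lift \<tau> q \<in> L q" using inL L\<sigma> by blast
  then have brM: "courant_bracket M H (lift \<sigma>) (lift \<tau>) q0 \<in> L q0"
    using invL VM sec[OF \<sigma>] sec[OF \<tau>] q0V unfolding involutive_def by blast
  have U0: "Off q0 \<in> U" using U(2) bq by simp
  let ?brM = "courant_bracket M H (lift \<sigma>) (lift \<tau>) q0" and ?brB = "courant_bracket B HB \<sigma> \<tau> (Off q0)"
  note rM = courant_bracket_rep[OF at smooth_H VM q0V sec[OF \<sigma>] sec[OF \<tau>] cq[OF q0]]
  note rB = courant_bracket_rep[OF B_at smooth_HB U(1) U0 \<sigma> \<tau> Tq[OF q0]]
  let ?x = "snd c q0"
  have x: "?x \<in> snd c ` ?V" using q0V by blast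
  have sT: "snd ?T (Off q0) = ?x" by (simp add: tchart_def)
  have diff: "sec_rep B ?T \<rho> differentiable (at ?x)" if "smooth_section B U \<rho>" for \<rho>
    by (rule smooth_on_differentiable[OF smooth_sectionD(2)[OF that TB, unfolded im] x])
  have "form_rep B ?T HB ?x u v w = form_rep M c H ?x u v w" for u v w
  proof -
    have "map_rep ?T c blowdown ?x = ?x" by (rule map_rep_tchart[OF c(1) imageI[OF q0]])
    then show ?thesis
      using form_rep_pullback[OF B_at at smooth_map_blowdown Tq[OF q0], of c H u v w] cq[OF q0]
      unfolding sT HB_def fder_map_rep_tchart[OF c(1) q0] by simp
  qed
  note bc = bracket_cong[where h = "form_rep B ?T HB" and h' = "form_rep M c H", OF oV x diff[OF \<sigma>] diff[OF \<tau>] rep rep this]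
  have "gcoords B ?T (Off q0) ?brB = gcoords M c q0 ?brM"
  proof (rule prod_eqI)
    show "fst (gcoords B ?T (Off q0) ?brB) = fst (gcoords M c q0 ?brM)" unfolding rM(2) rB(2) sT using bc(1) by simp
    have "snd (gcoords B ?T (Off q0) ?brB) \<bullet> v = snd (gcoords M c q0 ?brM) \<bullet> v" for v
      unfolding rM(3) rB(3) sT using bc(2) by simp
    then show "snd (gcoords B ?T (Off q0) ?brB) = snd (gcoords M c q0 ?brM)" by (rule vector_eq_rdot[THEN iffD1, OF allI])
  qed
  then have "gcoords B ?T (Off q0) ?brB \<in> gcoords B ?T (Off q0) ` LB (Off q0)"
    unfolding LB_Off[OF c(1,3) q0] using brM by simp
  then show ?thesis
    using gcoords_mem_iff[OF B_at Tq[OF q0] LB_sub[OF charts_at_points[OF Tq[OF q0]]] rB(1)] unfolding bq by blast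
qed

lemma involutive_LB: "involutive B HB LB"
  unfolding involutive_def
proof (intro allI impI ballI)
  fix U \<sigma> \<tau> b
  assume a: "openin (mtop B) U \<and> smooth_section B U \<sigma> \<and> smooth_section B U \<tau> \<and> (\<forall>q\<in>U. \<sigma> q \<in> LB q \<and> \<tau> q \<in> LB q)"
    and bU: "b \<in> U"
  then have U: "openin (mtop B) U" and \<sigma>: "smooth_section B U \<sigma>" and \<tau>: "smooth_section B U \<tau>"
    and L\<sigma>: "\<And>a. a \<in> U \<Longrightarrow> \<sigma> a \<in> LB a \<and> \<tau> a \<in> LB a" by blast+
  have b: "b \<in> points B" using U bU openin_mtop[OF B_at] by blast
  obtain C where C: "C \<in> charts_at B b" using ex_chart_at[OF b] ..
  note CB = charts_atD(1)[OF C] and bC = charts_atD(2)[OF C]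
  let ?br = "\<lambda>b. courant_bracket B HB \<sigma> \<tau> b"
  let ?s = "sec_rep B C \<sigma>" and ?t = "sec_rep B C \<tau>" and ?h = "form_rep B C HB"
  have "qform (gcoords B C b (?br b)) k = 0" if k: "k \<in> gcoords B C b ` LB b" for k
  proof -
    have "k \<in> bundle_rep B C LB (snd C b)" using k unfolding bundle_rep_at[OF B_at C] .
    from bspec[OF LB_fibres(2)[OF C, unfolded has_sections_def] this]
    obtain S r where S: "open S" "snd C b \<in> S" "smooth_on S r" "r (snd C b) = k" "\<forall>y\<in>S. r y \<in> bundle_rep B C LB y"
      by (elim exE conjE)
    let ?W = "S \<inter> snd C ` (fst C \<inter> U)"
    have W: "open ?W" using S(1) open_chart_Int[OF B_at CB U] by auto
    have xW: "snd C b \<in> ?W" using S(2) bC bU by blast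
    have st: "smooth_on ?W ?s" "smooth_on ?W ?t"
      by (rule smooth_on_subset[OF smooth_sectionD(2)[OF \<sigma> CB]], blast) (rule smooth_on_subset[OF smooth_sectionD(2)[OF \<tau> CB]], blast)
    have r: "smooth_on ?W r" by (rule smooth_on_subset[OF S(3)]) blast
    have alt: "alt3 (?h y)" if "y \<in> ?W" for y by (rule alt3_form_rep[OF B_at smooth_HB CB]) (use that in blast)
    have h: "smooth_on ?W (\<lambda>y. ?h y u v w)" for u v w by (rule smooth_on_subset[OF smooth_form_rep[OF smooth_HB CB]]) blast
    \<comment> \<open>The pairing of the bracket with the section \<open>r\<close>, as a function of
      chart coordinates; off the divisor it vanishes by \<open>involutive_Off\<close> and
      isotropy.\<close>
    define f where "f y = bracket_form ?h ?s ?t y (fst (r y)) + snd (r y) \<bullet> bracket_vec ?s ?t y" for y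
    have "smooth_on ?W (\<lambda>y. bracket_form ?h ?s ?t y (fst (r y)))"
    proof (rule smooth_on_linear_family[where g = "bracket_form ?h ?s ?t", OF W smooth_on_fst[OF W r]])
      show "smooth_on ?W (\<lambda>y. bracket_form ?h ?s ?t y v)" for v
        by (rule smooth_on_bracket(2)[where h = ?h, OF W st alt h])
      show "linear (bracket_form ?h ?s ?t y)" if "y \<in> ?W" for y
        by (rule linear_bracket_form[where h = ?h, OF smooth_on_differentiable[OF st(1) that] smooth_on_differentiable[OF st(2) that] alt[OF that]])
    qed
    moreover have "smooth_on ?W (\<lambda>y. snd (r y) \<bullet> bracket_vec ?s ?t y)"
      by (rule smooth_on_inner[OF W smooth_on_snd[OF W r] smooth_on_bracket(1)[where h = ?h, OF W st alt h]])
    ultimately have "continuous_on ?W f" unfolding f_def[abs_def] by (rule smooth_on_continuous[OF smooth_on_add[OF W]])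
    then have "f (snd C b) = 0"
    proof (rule zero_by_density[OF C W xW])
      fix b' assume b': "b' \<in> fst C" "snd C b' \<in> ?W" "blowdown b' \<notin> N"
      have bU': "b' \<in> U" using chart_image_iff[OF atlasD(1)[OF B_at CB] b'(1), of "fst C \<inter> U"] b'(2) by blast
      have C': "C \<in> charts_at B b'" by (rule charts_atI[OF CB b'(1)])
      have m1: "gcoords B C b' (?br b') \<in> gcoords B C b' ` LB b'"
        by (rule imageI[OF involutive_Off[OF U bU' b'(3) \<sigma> \<tau> L\<sigma>]])
      have m2: "r (snd C b') \<in> gcoords B C b' ` LB b'"
        using S(5) b'(2) unfolding bundle_rep_at[OF B_at C', symmetric] by blast
      have "f (snd C b') = qform (gcoords B C b' (?br b')) (r (snd C b'))"
        unfolding f_def qform_bracket[OF B_at smooth_HB U bU' \<sigma> \<tau> C'] ..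
      also have "\<dots> = 0" by (rule lagrangian_isotropic[OF LB_fibres(1)[OF C'] m1 m2])
      finally show "f (snd C b') = 0" .
    qed
    then show ?thesis unfolding qform_bracket[OF B_at smooth_HB U bU \<sigma> \<tau> C] f_def S(4) .
  qed
  then have "gcoords B C b (?br b) \<in> gcoords B C b ` LB b" using LB_fibres(1)[OF C] unfolding lagrangian_def by blast
  then show "?br b \<in> LB b"
    using gcoords_mem_iff[OF B_at C LB_sub[OF b] courant_bracket_rep(1)[OF B_at smooth_HB U bU \<sigma> \<tau> C]] by blast
qed

lemma dirac_LB: "twisted_dirac B HB LB"
  unfolding twisted_dirac_def
proof (intro conjI manifold_B closed_HB involutive_LB)
  show "smooth_subbundle B LB"
    by (rule smooth_subbundleI[OF B_at B_mx LB_sub LB_fibres])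
  show "maximally_isotropic B LB" unfolding maximally_isotropic_def
  proof
    fix b assume b: "b \<in> points B"
    obtain C where C: "C \<in> charts_at B b" using ex_chart_at[OF b] ..
    show "isotropic_at B b (LB b) \<and> (\<forall>K. isotropic_at B b K \<and> LB b \<subseteq> K \<longrightarrow> K = LB b)"
      unfolding maximally_isotropic_iff_lagrangian[OF B_at C] using LB_sub[OF b] LB_fibres(1)[OF C] by blast
  qed
qed

lemma is_lift_LB: "is_lift M N H L LB"
  unfolding is_lift_def using dirac_LB by (simp add: HB_def LB_def)

text \<open>Off the divisor both lifts have the same isotropic fibres, so sections of one pair to
  zero with sections of the other. By density this persists on the divisor, and two Lagrangian
  spaces orthogonal to each other coincide.\<close>

lemma lift_unique:
  assumes lift: "is_lift M N H L L'" and b: "b \<in> points B"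
  shows "L' b = LB b"
proof -
  have d': "twisted_dirac B HB L'" and Off: "\<And>q. q \<in> points M - N \<Longrightarrow> L' (Off q) = LB (Off q)"
    using lift unfolding is_lift_def HB_def LB_def by blast+
  obtain C where C: "C \<in> charts_at B b" using ex_chart_at[OF b] ..
  note CB = charts_atD(1)[OF C]
  note lag' = dirac_fibres(2)[OF d'] and sec' = dirac_fibres(3)[OF d']
  have orth: "qform k' k = 0" if k: "k' \<in> gcoords B C b ` L' b" "k \<in> gcoords B C b ` LB b" for k' k
  proof -
    have "k' \<in> bundle_rep B C L' (snd C b)" "k \<in> bundle_rep B C LB (snd C b)" using k unfolding bundle_rep_at[OF B_at C] .
    from bspec[OF sec'[OF C, unfolded has_sections_def] this(1)] bspec[OF LB_fibres(2)[OF C, unfolded has_sections_def] this(2)]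
    obtain S r S' r' where S: "open S" "snd C b \<in> S" "smooth_on S r" "r (snd C b) = k" "\<forall>y\<in>S. r y \<in> bundle_rep B C LB y"
      and S': "open S'" "snd C b \<in> S'" "smooth_on S' r'" "r' (snd C b) = k'" "\<forall>y\<in>S'. r' y \<in> bundle_rep B C L' y"
      by (elim exE conjE)
    let ?W = "S \<inter> S'"
    have W: "open ?W" "snd C b \<in> ?W" using S(1,2) S'(1,2) by auto
    have "smooth_on ?W (\<lambda>y. qform (r' y) (r y))"
      by (rule smooth_on_qform[OF W(1) smooth_on_subset[OF S'(3)] smooth_on_subset[OF S(3)]]) auto
    then have "continuous_on ?W (\<lambda>y. qform (r' y) (r y))" by (rule smooth_on_continuous)
    then have "qform (r' (snd C b)) (r (snd C b)) = 0"
    proof (rule zero_by_density[where f = "\<lambda>y. qform (r' y) (r y)", OF C W])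
      fix b' assume b': "b' \<in> fst C" "snd C b' \<in> ?W" "blowdown b' \<notin> N"
      have C': "C \<in> charts_at B b'" by (rule charts_atI[OF CB b'(1)])
      note bp = charts_at_points[OF C']
      have "L' b' = LB b'" using Off[of "blowdown b'"] not_N_Off[OF bp b'(3)] blowdown_points[OF bp] b'(3) by simp
      moreover have "r (snd C b') \<in> gcoords B C b' ` LB b'" "r' (snd C b') \<in> gcoords B C b' ` L' b'"
        using S(5) S'(5) b'(2) unfolding bundle_rep_at[OF B_at C', symmetric] by blast+
      ultimately show "qform (r' (snd C b')) (r (snd C b')) = 0"
        using lagrangian_isotropic[OF LB_fibres(1)[OF C']] by simp
    qed
    then show ?thesis unfolding S(4) S'(4) .
  qed
  have "gcoords B C b ` L' b \<subseteq> gcoords B C b ` LB b"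
    using orth LB_fibres(1)[OF C] unfolding lagrangian_def by blast
  moreover have "gcoords B C b ` LB b \<subseteq> gcoords B C b ` L' b"
  proof
    fix k assume k: "k \<in> gcoords B C b ` LB b"
    have "qform k t = 0" if "t \<in> gcoords B C b ` L' b" for t using orth[OF that k] qform_sym[of k t] by simp
    then show "k \<in> gcoords B C b ` L' b" using lag'[OF C] unfolding lagrangian_def by blast
  qed
  ultimately have eq: "gcoords B C b ` L' b = gcoords B C b ` LB b" by blast
  have "s \<in> L' b \<longleftrightarrow> s \<in> LB b" if s: "s \<in> gtangent_space B b" for s
    using gcoords_mem_iff[OF B_at C dirac_fibres(1)[OF d' b] s] gcoords_mem_iff[OF B_at C LB_sub[OF b] s] eq by simp
  then show ?thesis using dirac_fibres(1)[OF d' b] LB_sub[OF b] by blast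
qed

text \<open>Every lift coincides with \<open>LB\<close>, for which the backward condition holds by
  definition.\<close>

lemma backward_dirac_lift:
  assumes "is_lift M N H L L'" shows "backward_dirac B HB L' M H L blowdown"
  unfolding backward_dirac_def
  using smooth_map_blowdown lift_unique[OF assms] by (simp add: HB_def LB_def)

end

theorem theorem4p2:
  fixes M :: "('a, 'n::finite) chart set"
    and H :: "('a, 'n) form3"
    and L :: "'a \<Rightarrow> ('a, 'n) gvec set"
    and N :: "'a set"
  assumes "smooth_manifold M"
    and "closed_form3 M H"
    and "twisted_dirac M H L"
    and "closed_embedded_submanifold M N"
    and "transversal_for M N L"
  shows "lifts_to_blowup M N H L \<and>
    (\<forall>Lt. is_lift M N H L Lt \<longrightarrow>
       backward_dirac (blowup M N) (form3_pullback (blowup M N) M blowdown H) Lt M H L blowdown)"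
proof -
  interpret dirac_submanifold M N H L
    using assms by unfold_locales
  show ?thesis unfolding lifts_to_blowup_def
    using is_lift_LB backward_dirac_lift unfolding HB_def by blast
qed

end
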